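(* Let $(P,\{\cdot,\cdot\},H)$ be a Poisson dynamical system, $z_e\in P$ an equilibrium point of the Hamiltonian vector field $X_H$, and $C_1,\ldots,C_k:P\to\mathbb{R}$ conserved quantities, that is, $\{C_i,H\}=0$ for $i\in\{1,\ldots,k\}$. Let $F:P\to\mathbb{R}$ be a function satisfying at least one of the following two conditions: (i) $\{(F-F(z_e))^2,H\}(z)\le 0$ for all $z\in P\setminus\{z_e\}$, and $\{F-F(z_e),H\}(y)\le 0$ for all points $y\in P\setminus\{z_e\}$ such that $\{(F-F(z_e))^2,H\}(y)=0$; (ii) $\{(F-F(z_e))^2,H\}(z)\le 0$ for all $z\in P\setminus\{z_e\}$, and $F-F(z_e)$ is positive on $P$ around $z_e$. Assume that there exist real constants $\lambda_0,\lambda_1,\ldots,\lambda_k,\mu$ such that $$\mathbf{d}(\lambda_0H+\lambda_1C_1+\cdots+\lambda_kC_k+\mu F)(z_e)=0$$ and the quadratic form $$\mathbf{d}^2(\lambda_0H+\lambda_1C_1+\cdots+\lambda_kC_k+\mu F)(z_e)\big|_{W\times W}$$ is positive definite, where $$W=\ker\mathbf{d}H(z_e)\cap\ker\mathbf{d}C_1(z_e)\cap\cdots\cap\ker\mathbf{d}C_k(z_e).$$ Then $z_e$ is a weakly asymptotically stable equilibrium (and hence Lyapunov stable). If, moreover, the inequality $\{(F-F(z_e))^2,H\}(z)\le 0$ is strict for every $z\in P\setminus\{z_e\}$, then $z_e$ is asymptotically stable (this can only happen if the symplectic leaf that contains $z_e$ is trivial).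
   Context: A Poisson dynamical system $(P,\{\cdot,\cdot\},H)$ consists of a smooth finite dimensional Poisson manifold $(P,\{\cdot,\cdot\})$ and a smooth Hamiltonian function $H\in C^\infty(P)$. The Hamiltonian vector field $X_H$ is defined by $X_H[F]=\{F,H\}$ for all $F\in C^\infty(P)$; its flow is denoted $F_t$. All functions $H,C_i,F$ are smooth. The symplectic leaves are the maximal integral manifolds of the distribution spanned by Hamiltonian vector fields; a leaf is trivial if it is a single point. For a critical point $z_e$ of a smooth function $f$, the Hessian $\mathbf{d}^2f(z_e)$ is the symmetric bilinear form on $T_{z_e}P$ given by $\mathbf{d}^2f(z_e)(v,w)=v[W[f]]$, where $W$ is any local vector field extending $w$. A function $f\in C^\infty(P)$ is positive around $z_e$ if $f(z_e)=0$ and there is an open neighborhood $U$ of $z_e$ such that $f(z)>0$ for all $z\in U\setminus\{z_e\}$. An equilibrium $z_e$ of a vector field with flow $F_t$ is (Lyapunov) stable if for any open neighborhood $U$ of $z_e$ there is an open neighborhood $V\subset U$ of $z_e$ such that $F_t(z)\in U$ for all $z\in V$ and all $t>0$. It is weakly asymptotically stable if there is a neighborhood $V$ of $z_e$ such that $F_t(V)\subset F_s(V)$ whenever $t>s$. It is asymptotically stable if there is a neighborhood $V$ of $z_e$ such that $F_t(V)\subset F_s(V)$ whenever $t>s$ and $\lim_{t\to\infty}F_t(V)=z_e$, i.e. for any neighborhood $W'$ of $z_e$ there is $T>0$ such that $F_t(V)\subset W'$ for $t\ge T$. *)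

theory Defs
  imports "HOL-Analysis.Analysis"
begin

section \<open>Smooth maps between subsets of Euclidean spaces\<close>

primrec higher_differentiable_on ::
  "nat \<Rightarrow> 'a::real_normed_vector set \<Rightarrow> ('a \<Rightarrow> 'b::real_normed_vector) \<Rightarrow> bool" where
  "higher_differentiable_on 0 U f \<longleftrightarrow> continuous_on U f"
| "higher_differentiable_on (Suc n) U f \<longleftrightarrow>
     (\<forall>x\<in>U. f differentiable (at x)) \<and>
     (\<forall>v. higher_differentiable_on n U (\<lambda>x. frechet_derivative f (at x) v))"

text \<open>Charts take values in a linear subspace of a Euclidean space, so smoothness is needed on sets
  that are only relatively open: a map is smooth on \<open>A\<close> if it extends locally to a \<open>C\<^sup>\<infinity>\<close> map on an
  open set of the ambient space.\<close>

definition smooth_on :: "'a::real_normed_vector set \<Rightarrow> ('a \<Rightarrow> 'b::real_normed_vector) \<Rightarrow> bool" where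
  "smooth_on A f \<longleftrightarrow>
     (\<forall>x\<in>A. \<exists>U g. open U \<and> x \<in> U \<and> (\<forall>n. higher_differentiable_on n U g) \<and>
        (\<forall>y\<in>A \<inter> U. g y = f y))"


section \<open>Smooth manifolds\<close>

text \<open>The model space is a linear subspace of a Euclidean space. Since the type class
  \<open>euclidean_space\<close> excludes dimension zero, this is what admits zero-dimensional manifolds;
  it also allows manifolds of different dimensions (such as symplectic leaves) over one model type.
  A chart is a pair of its domain and its coordinate map.\<close>

record ('a, 'e) manifold =
  man_top :: "'a topology"
  man_model :: "'e set"
  man_charts :: "('a set \<times> ('a \<Rightarrow> 'e)) set"

abbreviation points :: "('a, 'e) manifold \<Rightarrow> 'a set" where
  "points M \<equiv> topspace (man_top M)"

definition smooth_manifold :: "('a, 'e::euclidean_space) manifold \<Rightarrow> bool" where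
  "smooth_manifold M \<longleftrightarrow>
     Hausdorff_space (man_top M) \<and> second_countable (man_top M) \<and> subspace (man_model M) \<and>
     (\<forall>(U, \<phi>)\<in>man_charts M.
        openin (man_top M) U \<and> openin (top_of_set (man_model M)) (\<phi> ` U) \<and>
        homeomorphic_map (subtopology (man_top M) U) (top_of_set (\<phi> ` U)) \<phi>) \<and>
     (\<Union>(U, \<phi>)\<in>man_charts M. U) = points M \<and>
     (\<forall>(U, \<phi>)\<in>man_charts M. \<forall>(V, \<psi>)\<in>man_charts M.
        smooth_on (\<phi> ` (U \<inter> V)) (\<psi> \<circ> inv_into U \<phi>))"

definition smooth_map ::
  "('a, 'e::euclidean_space) manifold \<Rightarrow> ('b, 'f::euclidean_space) manifold \<Rightarrow> ('a \<Rightarrow> 'b) \<Rightarrow> bool" where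
  "smooth_map N M h \<longleftrightarrow>
     continuous_map (man_top N) (man_top M) h \<and>
     (\<forall>(U, \<phi>)\<in>man_charts N. \<forall>(V, \<psi>)\<in>man_charts M.
        smooth_on (\<phi> ` (U \<inter> h -` V)) (\<psi> \<circ> h \<circ> inv_into U \<phi>))"

text \<open>\<open>C\<^sup>\<infinity>(U)\<close> for open \<open>U\<close>; the values of its members outside \<open>U\<close> are irrelevant.\<close>

definition smooth_funs :: "('a, 'e::euclidean_space) manifold \<Rightarrow> 'a set \<Rightarrow> ('a \<Rightarrow> real) set" where
  "smooth_funs M U =
     {f. \<forall>(V, \<phi>)\<in>man_charts M. smooth_on (\<phi> ` (U \<inter> V)) (f \<circ> inv_into V \<phi>)}"

abbreviation C_inf :: "('a, 'e::euclidean_space) manifold \<Rightarrow> ('a \<Rightarrow> real) set" where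
  "C_inf M \<equiv> smooth_funs M (points M)"

definition neighbourhood :: "('a, 'e) manifold \<Rightarrow> 'a \<Rightarrow> 'a set \<Rightarrow> bool" where
  "neighbourhood M z V \<longleftrightarrow>
     V \<subseteq> points M \<and> (\<exists>U. openin (man_top M) U \<and> z \<in> U \<and> U \<subseteq> V)"

definition smooth_near :: "('a, 'e::euclidean_space) manifold \<Rightarrow> 'a \<Rightarrow> ('a \<Rightarrow> real) set" where
  "smooth_near M z = {f. \<exists>U. openin (man_top M) U \<and> z \<in> U \<and> f \<in> smooth_funs M U}"


section \<open>Tangent vectors and vector fields\<close>

text \<open>\<open>T\<^sub>z M\<close> consists of the derivations at \<open>z\<close> of the functions that are smooth near \<open>z\<close>. The last
  condition makes the representation of a tangent vector by a total function unique; the zero vector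
  is \<open>\<lambda>_. 0\<close>. The Leibniz rule forces the value to depend only on the germ of the function at \<open>z\<close>:
  if \<open>h\<close> vanishes near \<open>z\<close>, apply it to \<open>h = h \<cdot> b\<close> with \<open>b\<close> the indicator function of \<open>h \<noteq> 0\<close>.\<close>

definition tangent_space ::
  "('a, 'e::euclidean_space) manifold \<Rightarrow> 'a \<Rightarrow> (('a \<Rightarrow> real) \<Rightarrow> real) set" where
  "tangent_space M z = {v.
     (\<forall>f\<in>smooth_near M z. \<forall>g\<in>smooth_near M z. v (\<lambda>x. f x + g x) = v f + v g) \<and>
     (\<forall>c. \<forall>f\<in>smooth_near M z. v (\<lambda>x. c * f x) = c * v f) \<and>
     (\<forall>f\<in>smooth_near M z. \<forall>g\<in>smooth_near M z. v (\<lambda>x. f x * g x) = f z * v g + v f * g z) \<and>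
     (\<forall>f. f \<notin> smooth_near M z \<longrightarrow> v f = 0)}"

definition push_forward ::
  "('b, 'f::euclidean_space) manifold \<Rightarrow> ('a \<Rightarrow> 'b) \<Rightarrow> 'a \<Rightarrow>
     (('a \<Rightarrow> real) \<Rightarrow> real) \<Rightarrow> (('b \<Rightarrow> real) \<Rightarrow> real)" where
  "push_forward M h x v = (\<lambda>f. if f \<in> smooth_near M (h x) then v (f \<circ> h) else 0)"

text \<open>The differential: \<open>df(z)(v) = v[f]\<close> for \<open>v \<in> T\<^sub>z M\<close>.\<close>

definition differential :: "('a \<Rightarrow> real) \<Rightarrow> (('a \<Rightarrow> real) \<Rightarrow> real) \<Rightarrow> real" where
  "differential f v = v f"

definition ker_d ::
  "('a, 'e::euclidean_space) manifold \<Rightarrow> ('a \<Rightarrow> real) \<Rightarrow> 'a \<Rightarrow> (('a \<Rightarrow> real) \<Rightarrow> real) set" where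
  "ker_d M f z = {v \<in> tangent_space M z. differential f v = 0}"

definition vector_field_on ::
  "('a, 'e::euclidean_space) manifold \<Rightarrow> 'a set \<Rightarrow> (('a \<Rightarrow> real) \<Rightarrow> 'a \<Rightarrow> real) \<Rightarrow> bool" where
  "vector_field_on M U X \<longleftrightarrow>
     openin (man_top M) U \<and>
     (\<forall>f\<in>smooth_funs M U. X f \<in> smooth_funs M U) \<and>
     (\<forall>f\<in>smooth_funs M U. \<forall>g\<in>smooth_funs M U. \<forall>x\<in>U. X (\<lambda>y. f y + g y) x = X f x + X g x) \<and>
     (\<forall>c. \<forall>f\<in>smooth_funs M U. \<forall>x\<in>U. X (\<lambda>y. c * f y) x = c * X f x) \<and>
     (\<forall>f\<in>smooth_funs M U. \<forall>g\<in>smooth_funs M U. \<forall>x\<in>U.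
        X (\<lambda>y. f y * g y) x = f x * X g x + X f x * g x)"

text \<open>\<open>d\<^sup>2f(z)(v, w) = v[W[f]]\<close> for any local vector field \<open>W\<close> extending \<open>w\<close>; at a critical point \<open>z\<close>
  of \<open>f\<close> the value does not depend on the extension.\<close>

definition hessian ::
  "('a, 'e::euclidean_space) manifold \<Rightarrow> ('a \<Rightarrow> real) \<Rightarrow> 'a \<Rightarrow>
     (('a \<Rightarrow> real) \<Rightarrow> real) \<Rightarrow> (('a \<Rightarrow> real) \<Rightarrow> real) \<Rightarrow> real" where
  "hessian M f z v w = (THE r. \<exists>U X.
     z \<in> U \<and> vector_field_on M U X \<and> (\<forall>g\<in>smooth_funs M U. X g z = w g) \<and> r = v (X f))"

definition positive_around :: "('a, 'e) manifold \<Rightarrow> ('a \<Rightarrow> real) \<Rightarrow> 'a \<Rightarrow> bool" where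
  "positive_around M f z \<longleftrightarrow>
     f z = 0 \<and> (\<exists>U. openin (man_top M) U \<and> z \<in> U \<and> (\<forall>x\<in>U - {z}. f x > 0))"


section \<open>Flows and stability\<close>

text \<open>A vector field is here a derivation \<open>X\<close> of \<open>C\<^sup>\<infinity>(M)\<close>. A curve \<open>c\<close> is an integral curve iff its
  velocity, as a derivation, is \<open>X\<close>, that is \<open>(f \<circ> c)' = X[f] \<circ> c\<close> for all \<open>f \<in> C\<^sup>\<infinity>(M)\<close>.\<close>

definition equilibrium ::
  "('a, 'e::euclidean_space) manifold \<Rightarrow> (('a \<Rightarrow> real) \<Rightarrow> 'a \<Rightarrow> real) \<Rightarrow> 'a \<Rightarrow> bool" where
  "equilibrium M X z \<longleftrightarrow> z \<in> points M \<and> (\<forall>f\<in>C_inf M. X f z = 0)"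

definition integral_curve ::
  "('a, 'e::euclidean_space) manifold \<Rightarrow> (('a \<Rightarrow> real) \<Rightarrow> 'a \<Rightarrow> real) \<Rightarrow>
     (real \<Rightarrow> 'a) \<Rightarrow> real set \<Rightarrow> bool" where
  "integral_curve M X c I \<longleftrightarrow>
     continuous_map (top_of_set I) (man_top M) c \<and>
     (\<forall>t\<in>I. \<forall>f\<in>C_inf M. ((\<lambda>s. f (c s)) has_real_derivative X f (c t)) (at t within I))"

text \<open>The flow need not be complete: \<open>flow M X t z\<close> is meaningful for \<open>t \<in> flow_dom M X z\<close> only, and
  \<open>t\<close> may be negative.\<close>

definition flow_dom ::
  "('a, 'e::euclidean_space) manifold \<Rightarrow> (('a \<Rightarrow> real) \<Rightarrow> 'a \<Rightarrow> real) \<Rightarrow> 'a \<Rightarrow> real set" where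
  "flow_dom M X z = {t. \<exists>c. integral_curve M X c (closed_segment 0 t) \<and> c 0 = z}"

definition flow ::
  "('a, 'e::euclidean_space) manifold \<Rightarrow> (('a \<Rightarrow> real) \<Rightarrow> 'a \<Rightarrow> real) \<Rightarrow> real \<Rightarrow> 'a \<Rightarrow> 'a" where
  "flow M X t z = (THE w. \<exists>c. integral_curve M X c (closed_segment 0 t) \<and> c 0 = z \<and> c t = w)"

definition flow_image ::
  "('a, 'e::euclidean_space) manifold \<Rightarrow> (('a \<Rightarrow> real) \<Rightarrow> 'a \<Rightarrow> real) \<Rightarrow> real \<Rightarrow> 'a set \<Rightarrow> 'a set" where
  "flow_image M X t V = {flow M X t z | z. z \<in> V \<and> t \<in> flow_dom M X z}"

definition lyapunov_stable ::
  "('a, 'e::euclidean_space) manifold \<Rightarrow> (('a \<Rightarrow> real) \<Rightarrow> 'a \<Rightarrow> real) \<Rightarrow> 'a \<Rightarrow> bool" where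
  "lyapunov_stable M X z \<longleftrightarrow>
     (\<forall>U. openin (man_top M) U \<and> z \<in> U \<longrightarrow>
        (\<exists>V. openin (man_top M) V \<and> z \<in> V \<and> V \<subseteq> U \<and>
           (\<forall>x\<in>V. \<forall>t>0. t \<in> flow_dom M X x \<and> flow M X t x \<in> U)))"

text \<open>\<open>F\<^sub>t(V) \<subseteq> F\<^sub>s(V)\<close> for all \<open>s < t\<close>, where all points of \<open>V\<close> are required to have a complete
  forward orbit, as is tacit in writing \<open>F\<^sub>t(V)\<close>.\<close>

definition flow_contracts ::
  "('a, 'e::euclidean_space) manifold \<Rightarrow> (('a \<Rightarrow> real) \<Rightarrow> 'a \<Rightarrow> real) \<Rightarrow> 'a set \<Rightarrow> bool" where
  "flow_contracts M X V \<longleftrightarrow>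
     (\<forall>x\<in>V. \<forall>t\<ge>0. t \<in> flow_dom M X x) \<and>
     (\<forall>s t. s < t \<longrightarrow> flow_image M X t V \<subseteq> flow_image M X s V)"

definition weakly_asymptotically_stable ::
  "('a, 'e::euclidean_space) manifold \<Rightarrow> (('a \<Rightarrow> real) \<Rightarrow> 'a \<Rightarrow> real) \<Rightarrow> 'a \<Rightarrow> bool" where
  "weakly_asymptotically_stable M X z \<longleftrightarrow> (\<exists>V. neighbourhood M z V \<and> flow_contracts M X V)"

definition asymptotically_stable ::
  "('a, 'e::euclidean_space) manifold \<Rightarrow> (('a \<Rightarrow> real) \<Rightarrow> 'a \<Rightarrow> real) \<Rightarrow> 'a \<Rightarrow> bool" where
  "asymptotically_stable M X z \<longleftrightarrow>
     (\<exists>V. neighbourhood M z V \<and> flow_contracts M X V \<and>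
        (\<forall>W. neighbourhood M z W \<longrightarrow> (\<exists>T>0. \<forall>t\<ge>T. flow_image M X t V \<subseteq> W)))"


section \<open>Poisson manifolds\<close>

locale poisson_manifold =
  fixes M :: "('a, 'e::euclidean_space) manifold"
    and br :: "('a \<Rightarrow> real) \<Rightarrow> ('a \<Rightarrow> real) \<Rightarrow> 'a \<Rightarrow> real"
  assumes manifold: "smooth_manifold M"
    and br_smooth: "\<lbrakk>f \<in> C_inf M; g \<in> C_inf M\<rbrakk> \<Longrightarrow> br f g \<in> C_inf M"
    and br_add: "\<lbrakk>f \<in> C_inf M; g \<in> C_inf M; h \<in> C_inf M; x \<in> points M\<rbrakk> \<Longrightarrow>
      br (\<lambda>y. f y + g y) h x = br f h x + br g h x"
    and br_scale: "\<lbrakk>f \<in> C_inf M; h \<in> C_inf M; x \<in> points M\<rbrakk> \<Longrightarrow>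
      br (\<lambda>y. a * f y) h x = a * br f h x"
    and br_antisym: "\<lbrakk>f \<in> C_inf M; g \<in> C_inf M; x \<in> points M\<rbrakk> \<Longrightarrow> br f g x = - br g f x"
    and br_leibniz: "\<lbrakk>f \<in> C_inf M; g \<in> C_inf M; h \<in> C_inf M; x \<in> points M\<rbrakk> \<Longrightarrow>
      br (\<lambda>y. f y * g y) h x = f x * br g h x + br f h x * g x"
    and br_jacobi: "\<lbrakk>f \<in> C_inf M; g \<in> C_inf M; h \<in> C_inf M; x \<in> points M\<rbrakk> \<Longrightarrow>
      br f (br g h) x + br g (br h f) x + br h (br f g) x = 0"

definition hamiltonian_vf ::
  "(('a \<Rightarrow> real) \<Rightarrow> ('a \<Rightarrow> real) \<Rightarrow> 'a \<Rightarrow> real) \<Rightarrow> ('a \<Rightarrow> real) \<Rightarrow> (('a \<Rightarrow> real) \<Rightarrow> 'a \<Rightarrow> real)" where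
  "hamiltonian_vf br H = (\<lambda>f. br f H)"

text \<open>The values at \<open>x\<close> of the Hamiltonian vector fields; they already form a linear subspace of
  \<open>T\<^sub>x M\<close> because the bracket is linear in the Hamiltonian.\<close>

definition char_distribution ::
  "('a, 'e::euclidean_space) manifold \<Rightarrow> (('a \<Rightarrow> real) \<Rightarrow> ('a \<Rightarrow> real) \<Rightarrow> 'a \<Rightarrow> real) \<Rightarrow> 'a \<Rightarrow>
     (('a \<Rightarrow> real) \<Rightarrow> real) set" where
  "char_distribution M br x =
     {v \<in> tangent_space M x. \<exists>h\<in>C_inf M. \<forall>f\<in>C_inf M. v f = hamiltonian_vf br h f x}"

text \<open>An integral manifold is a connected, injectively immersed submanifold \<open>N\<close> tangent to the
  distribution. Its topology may be finer than the subspace topology. That its model space is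
  a subspace of the model type of \<open>M\<close> is no restriction, since \<open>dim N \<le> dim M\<close>.\<close>

definition integral_manifold ::
  "('a, 'e::euclidean_space) manifold \<Rightarrow> (('a \<Rightarrow> real) \<Rightarrow> ('a \<Rightarrow> real) \<Rightarrow> 'a \<Rightarrow> real) \<Rightarrow>
     ('a, 'e) manifold \<Rightarrow> bool" where
  "integral_manifold M br N \<longleftrightarrow>
     smooth_manifold N \<and> connected_space (man_top N) \<and> points N \<subseteq> points M \<and>
     smooth_map N M (\<lambda>x. x) \<and>
     (\<forall>x\<in>points N.
        inj_on (push_forward M (\<lambda>x. x) x) (tangent_space N x) \<and>
        push_forward M (\<lambda>x. x) x ` tangent_space N x = char_distribution M br x)"

definition symplectic_leaf ::
  "('a, 'e::euclidean_space) manifold \<Rightarrow> (('a \<Rightarrow> real) \<Rightarrow> ('a \<Rightarrow> real) \<Rightarrow> 'a \<Rightarrow> real) \<Rightarrow>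
     'a set \<Rightarrow> bool" where
  "symplectic_leaf M br L \<longleftrightarrow>
     (\<exists>N. integral_manifold M br N \<and> points N = L) \<and>
     (\<forall>N. integral_manifold M br N \<and> L \<subseteq> points N \<longrightarrow> points N = L)"

end

theory Submission
  imports Defs
begin

text \<open>Write \<open>u = \<mu> (F - F z)\<close> for the equilibrium \<open>z\<close> and let \<open>L\<close> be the given combination of
  \<open>H\<close>, \<open>C\<^sub>i\<close> and \<open>F\<close>. For large \<open>K\<close> the function
  \<open>\<Phi> = L - L z + K ((H - H z)\<^sup>2 + \<Sum>\<^sub>i (C\<^sub>i - C\<^sub>i z)\<^sup>2) + \<bar>u\<bar>\<close> is positive around \<open>z\<close> by Finsler's lemma.
  It is a conserved quantity plus \<open>u + \<bar>u\<bar>\<close>, hence nonincreasing along the flow, because \<open>u\<^sup>2\<close> is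
  nonincreasing and so \<open>u\<close> stays zero once it vanishes. Small sublevel sets of \<open>\<Phi>\<close> inside a chart
  are therefore forward invariant, and points in them have complete forward orbits. This gives
  Lyapunov stability, and forward invariance of \<open>V\<close> yields \<open>F\<^sub>t(V) \<subseteq> F\<^sub>s(V)\<close> for \<open>t > s\<close>.

  If \<open>(F - F z)\<^sup>2\<close> decreases strictly off \<open>z\<close>, its minimum on the compact invariant set
  \<open>{\<Phi> \<le> \<Phi> x, H = H x}\<close> can only be attained at \<open>z\<close>; so \<open>H x = H z\<close> for all \<open>x\<close> near \<open>z\<close>, the Hamiltonian
  vector field vanishes near \<open>z\<close>, and strictness forces \<open>z\<close> to be an isolated point of the manifold.
  Conversely asymptotic stability makes the conserved \<open>H\<close> constant near \<open>z\<close>; the flow is then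
  stationary near \<open>z\<close>, so again \<open>z\<close> is isolated and its leaf is \<open>{z}\<close>.\<close>

section \<open>Calculus of higher differentiable maps\<close>

text \<open>The quadratic form is definite only on the common kernel \<open>W\<close>; squares of
  conserved quantities repair the other directions and cost nothing along the flow. The term
  \<open>\<mu> * F\<close> is harder: only the modulus of \<open>F - F z\<close> is known not to
  increase, and \<open>\<mu>\<close> may have either sign. Adding the modulus of \<open>u\<close>
  turns \<open>u\<close> into twice its positive part, which works for both signs but makes
  \<open>\<Phi>\<close> nonsmooth. Its monotonicity is therefore proved along curves by the
  intermediate value theorem, and the trapping argument uses it in that form.

  The rest is translation to coordinates. Brackets are abstract derivations on global functions, so
  Hadamard's lemma and cut-off functions are needed to express them by partial derivatives. Charts
  take values in a possibly proper subspace, so a projection thickens their images to open sets. The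
  flow is a definite description and may be undefined: completeness of forward orbits has to come
  out of the trapping, and time shifts to negative times rest on uniqueness of integral curves on
  both sides of 0.\<close>

lemma higher_differentiable_on_Suc_imp:
  "higher_differentiable_on (Suc n) U f \<Longrightarrow> higher_differentiable_on n U f"
proof (induction n arbitrary: f)
  case 0
  then show ?case
    by (auto intro!: continuous_at_imp_continuous_on differentiable_imp_continuous_within)
next
  case (Suc n)
  show ?case
    using Suc.prems Suc.IH
    by (metis higher_differentiable_on.simps(2))
qed

lemma higher_differentiable_on_subset:
  "higher_differentiable_on n U f \<Longrightarrow> V \<subseteq> U \<Longrightarrow> higher_differentiable_on n V f"
  by (induction n arbitrary: f) (auto intro: continuous_on_subset)

lemma frechet_derivative_cong_on:
  assumes "open U" "x \<in> U" "\<And>y. y \<in> U \<Longrightarrow> f y = g y"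
  shows "frechet_derivative f (at x) = frechet_derivative g (at x)"
proof -
  have "(f has_derivative D) (at x) \<longleftrightarrow> (g has_derivative D) (at x)" for D
    using has_derivative_transform_within_open[OF _ assms(1,2), of f D UNIV g]
      has_derivative_transform_within_open[OF _ assms(1,2), of g D UNIV f] assms(3)
    by (metis)
  then show ?thesis
    by (simp add: frechet_derivative_def)
qed

lemma differentiable_cong_on:
  assumes "open U" "x \<in> U" "\<And>y. y \<in> U \<Longrightarrow> f y = g y"
  shows "f differentiable (at x) \<longleftrightarrow> g differentiable (at x)"
  using has_derivative_transform_within_open[OF _ assms(1,2), of f _ UNIV g]
      has_derivative_transform_within_open[OF _ assms(1,2), of g _ UNIV f] assms(3)
  unfolding differentiable_def by metis

text \<open>Derivatives are taken in the full ambient space, so \<open>f\<close> and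
  \<open>g\<close> must agree on a neighbourhood of each point; openness of \<open>U\<close>
  provides that.\<close>

lemma higher_differentiable_on_cong:
  assumes "open U" "\<And>y. y \<in> U \<Longrightarrow> f y = g y"
  shows "higher_differentiable_on n U f \<longleftrightarrow> higher_differentiable_on n U g"
  using assms(2)
proof (induction n arbitrary: f g)
  case 0
  then show ?case by (auto cong: continuous_on_cong)
next
  case (Suc n)
  have "higher_differentiable_on n U (\<lambda>x. frechet_derivative f (at x) v) \<longleftrightarrow>
      higher_differentiable_on n U (\<lambda>x. frechet_derivative g (at x) v)" for v
    by (rule Suc.IH) (metis frechet_derivative_cong_on[OF assms(1)] Suc.prems)
  then show ?case
    using differentiable_cong_on[OF assms(1) _ Suc.prems] by auto
qed

lemma higher_differentiable_on_transform:
  "higher_differentiable_on n U f \<Longrightarrow> (\<And>y. y \<in> U \<Longrightarrow> f y = g y) \<Longrightarrow> open U \<Longrightarrow>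
    higher_differentiable_on n U g"
  using higher_differentiable_on_cong[of U f g n] by metis

lemma higher_differentiable_on_local:
  assumes "\<And>x. x \<in> U \<Longrightarrow> \<exists>V. open V \<and> x \<in> V \<and> higher_differentiable_on n V f"
  shows "higher_differentiable_on n U f"
  using assms
proof (induction n arbitrary: f)
  case 0
  show ?case
    unfolding higher_differentiable_on.simps
  proof (rule continuous_at_imp_continuous_on, rule ballI)
    fix x assume "x \<in> U"
    then obtain V where "open V" "x \<in> V" "continuous_on V f"
      using 0 by auto
    then show "isCont f x"
      by (simp add: continuous_on_eq_continuous_at)
  qed
next
  case (Suc n)
  have "f differentiable (at x)" if "x \<in> U" for x
    using Suc.prems[OF that] by auto
  moreover have "higher_differentiable_on n U (\<lambda>x. frechet_derivative f (at x) v)" for v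
    by (rule Suc.IH) (use Suc.prems in fastforce)
  ultimately show ?case by simp
qed

lemma higher_differentiable_on_const: "higher_differentiable_on n U (\<lambda>x. c)"
  by (induction n arbitrary: c) auto

lemma higher_differentiable_on_bounded_linear_comp:
  assumes "bounded_linear A" "open U"
  shows "higher_differentiable_on n U f \<Longrightarrow> higher_differentiable_on n U (\<lambda>x. A (f x))"
proof (induction n arbitrary: f)
  case 0
  then show ?case
    using assms by (auto intro: bounded_linear.continuous_on)
next
  case (Suc n)
  have D: "((\<lambda>x. A (f x)) has_derivative (\<lambda>v. A (frechet_derivative f (at x) v))) (at x)"
    if "x \<in> U" for x
    using Suc.prems that
    by (auto intro!: bounded_linear.has_derivative[OF assms(1)] simp: frechet_derivative_works[symmetric])
  have "higher_differentiable_on n U (\<lambda>x. frechet_derivative (\<lambda>x. A (f x)) (at x) v)" for v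
    using Suc.IH[of "\<lambda>x. frechet_derivative f (at x) v"] Suc.prems
    by (subst higher_differentiable_on_cong[OF assms(2),
          of _ "\<lambda>x. A (frechet_derivative f (at x) v)"])
      (auto simp: frechet_derivative_at[OF D, symmetric])
  with D show ?case
    unfolding higher_differentiable_on.simps differentiable_def by blast
qed

lemma higher_differentiable_on_add:
  assumes "open U"
  shows "higher_differentiable_on n U f \<Longrightarrow> higher_differentiable_on n U g \<Longrightarrow>
    higher_differentiable_on n U (\<lambda>x. f x + g x)"
proof (induction n arbitrary: f g)
  case 0
  then show ?case
    by (auto intro: continuous_on_add)
next
  case (Suc n)
  have D: "((\<lambda>x. f x + g x) has_derivative
      (\<lambda>v. frechet_derivative f (at x) v + frechet_derivative g (at x) v)) (at x)"
    if "x \<in> U" for x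
    using Suc.prems that
    by (auto intro!: has_derivative_add simp: frechet_derivative_works[symmetric])
  have "higher_differentiable_on n U (\<lambda>x. frechet_derivative (\<lambda>x. f x + g x) (at x) v)" for v
    using Suc.IH[of "\<lambda>x. frechet_derivative f (at x) v" "\<lambda>x. frechet_derivative g (at x) v"] Suc.prems
    by (subst higher_differentiable_on_cong[OF assms,
          of _ "\<lambda>x. frechet_derivative f (at x) v + frechet_derivative g (at x) v"])
      (auto simp: frechet_derivative_at[OF D, symmetric])
  with D show ?case
    unfolding higher_differentiable_on.simps differentiable_def by blast
qed

lemma higher_differentiable_on_bounded_bilinear:
  assumes "bounded_bilinear p" "open U"
  shows "higher_differentiable_on n U f \<Longrightarrow> higher_differentiable_on n U g \<Longrightarrow>
    higher_differentiable_on n U (\<lambda>x. p (f x) (g x))"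
proof (induction n arbitrary: f g)
  case 0
  then show ?case
    using assms by (auto intro: bounded_bilinear.continuous_on)
next
  case (Suc n)
  have D: "((\<lambda>x. p (f x) (g x)) has_derivative
      (\<lambda>v. p (f x) (frechet_derivative g (at x) v) + p (frechet_derivative f (at x) v) (g x))) (at x)"
    if "x \<in> U" for x
    using Suc.prems that
    by (auto intro!: bounded_bilinear.FDERIV[OF assms(1)] simp: frechet_derivative_works[symmetric])
  have "higher_differentiable_on n U (\<lambda>x. frechet_derivative (\<lambda>x. p (f x) (g x)) (at x) v)" for v
  proof (subst higher_differentiable_on_cong[OF assms(2),
          of _ "\<lambda>x. p (f x) (frechet_derivative g (at x) v) + p (frechet_derivative f (at x) v) (g x)"])
    show "higher_differentiable_on n U
       (\<lambda>x. p (f x) (frechet_derivative g (at x) v) + p (frechet_derivative f (at x) v) (g x))"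
      using Suc.prems higher_differentiable_on_Suc_imp[OF Suc.prems(1)]
        higher_differentiable_on_Suc_imp[OF Suc.prems(2)]
      by (intro higher_differentiable_on_add assms Suc.IH) auto
  qed (auto simp: frechet_derivative_at[OF D, symmetric])
  with D show ?case
    unfolding higher_differentiable_on.simps differentiable_def by blast
qed

lemma higher_differentiable_on_sum:
  assumes "open U" "\<And>i. i \<in> I \<Longrightarrow> higher_differentiable_on n U (f i)"
  shows "higher_differentiable_on n U (\<lambda>x. \<Sum>i\<in>I. f i x)"
  using assms(2)
  by (induction I rule: infinite_finite_induct)
    (auto intro!: higher_differentiable_on_const higher_differentiable_on_add assms(1))

lemma frechet_derivative_euclidean_sum:
  fixes f :: "'a::euclidean_space \<Rightarrow> 'b::real_normed_vector"
  assumes "f differentiable (at x)"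
  shows "frechet_derivative f (at x) v = (\<Sum>b\<in>Basis. (v \<bullet> b) *\<^sub>R frechet_derivative f (at x) b)"
proof -
  have "linear (frechet_derivative f (at x))"
    using assms by (rule linear_frechet_derivative)
  then have "frechet_derivative f (at x) (\<Sum>b\<in>Basis. (v \<bullet> b) *\<^sub>R b) =
      (\<Sum>b\<in>Basis. (v \<bullet> b) *\<^sub>R frechet_derivative f (at x) b)"
    by (simp add: linear_sum linear_scale)
  then show ?thesis by (simp add: euclidean_representation)
qed

text \<open>In the chain rule the direction \<open>frechet_derivative f (at x) v\<close> moves with
  \<open>x\<close>. Expanding it in the basis leaves derivatives of \<open>g\<close> in fixed
  directions, to which the induction hypothesis applies; this is why the middle space is Euclidean.
  The inner map keeps its role and is only weakened from order \<open>Suc n\<close> to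
  \<open>n\<close>.\<close>

lemma higher_differentiable_on_compose:
  fixes f :: "'a::real_normed_vector \<Rightarrow> 'b::euclidean_space" and g :: "'b \<Rightarrow> 'c::real_normed_vector"
  assumes "open U" "f ` U \<subseteq> V"
  shows "higher_differentiable_on n V g \<Longrightarrow> higher_differentiable_on n U f \<Longrightarrow>
    higher_differentiable_on n U (\<lambda>x. g (f x))"
proof (induction n arbitrary: g)
  case 0
  then show ?case
    using assms(2) by (auto intro: continuous_on_compose2)
next
  case (Suc n)
  have D: "((\<lambda>x. g (f x)) has_derivative
      (\<lambda>v. frechet_derivative g (at (f x)) (frechet_derivative f (at x) v))) (at x)"
    if "x \<in> U" for x
    using Suc.prems that assms(2)
    by (intro has_derivative_compose[of f _ x UNIV g]) (auto simp: frechet_derivative_works[symmetric])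
  have "higher_differentiable_on n U (\<lambda>x. frechet_derivative (\<lambda>x. g (f x)) (at x) v)" for v
  proof (subst higher_differentiable_on_cong[OF assms(1), of _
        "\<lambda>x. \<Sum>b\<in>Basis. (frechet_derivative f (at x) v \<bullet> b) *\<^sub>R frechet_derivative g (at (f x)) b"])
    show "higher_differentiable_on n U
       (\<lambda>x. \<Sum>b\<in>Basis. (frechet_derivative f (at x) v \<bullet> b) *\<^sub>R frechet_derivative g (at (f x)) b)"
      using Suc.prems higher_differentiable_on_Suc_imp[OF Suc.prems(2)]
      by (intro higher_differentiable_on_sum assms Suc.IH
          higher_differentiable_on_bounded_bilinear[OF bounded_bilinear_scaleR]
          higher_differentiable_on_bounded_linear_comp[OF bounded_linear_inner_left]) auto
    show "frechet_derivative (\<lambda>x. g (f x)) (at x) v =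
        (\<Sum>b\<in>Basis. (frechet_derivative f (at x) v \<bullet> b) *\<^sub>R frechet_derivative g (at (f x)) b)"
      if "x \<in> U" for x
      using frechet_derivative_at[OF D[OF that], symmetric] Suc.prems that assms(2)
      by (simp, subst frechet_derivative_euclidean_sum) auto
  qed
  with D show ?case
    unfolding higher_differentiable_on.simps differentiable_def by blast
qed

abbreviation infinitely_differentiable_on ::
  "'a::real_normed_vector set \<Rightarrow> ('a \<Rightarrow> 'b::real_normed_vector) \<Rightarrow> bool" where
  "infinitely_differentiable_on U f \<equiv> \<forall>n. higher_differentiable_on n U f"

lemma infinitely_differentiable_on_continuous:
  "infinitely_differentiable_on U f \<Longrightarrow> continuous_on U f"
  by (metis higher_differentiable_on.simps(1))

lemma infinitely_differentiable_on_differentiable: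
  "infinitely_differentiable_on U f \<Longrightarrow> x \<in> U \<Longrightarrow> f differentiable (at x)"
  by (metis higher_differentiable_on.simps(2))

lemma infinitely_differentiable_on_derivative:
  "infinitely_differentiable_on U f \<Longrightarrow> infinitely_differentiable_on U (\<lambda>x. frechet_derivative f (at x) v)"
  by (metis higher_differentiable_on.simps(2))

lemma infinitely_differentiable_on_has_derivative:
  "infinitely_differentiable_on U f \<Longrightarrow> x \<in> U \<Longrightarrow>
    (f has_derivative frechet_derivative f (at x)) (at x)"
  by (simp add: frechet_derivative_works[symmetric] infinitely_differentiable_on_differentiable)

lemma infinitely_differentiable_on_linear:
  assumes "bounded_linear A"
  shows "infinitely_differentiable_on U A"
proof
  fix n
  have D: "(A has_derivative A) (at x)" for x
    using assms by (rule bounded_linear_imp_has_derivative)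
  have "higher_differentiable_on n UNIV A"
  proof (cases n)
    case 0
    then show ?thesis using assms by (simp add: linear_continuous_on)
  next
    case (Suc m)
    have "frechet_derivative A (at x) = A" for x
      using frechet_derivative_at[OF D] by simp
    then show ?thesis
      using D Suc by (auto simp: higher_differentiable_on_const differentiable_def)
  qed
  then show "higher_differentiable_on n U A"
    by (rule higher_differentiable_on_subset) simp
qed

section \<open>Flat functions and bump functions\<close>

definition flat :: "nat \<Rightarrow> real \<Rightarrow> real" where
  "flat k t = (if t \<le> 0 then 0 else exp (- inverse t) * inverse t ^ k)"

lemma flat_tendsto_0: "(flat k \<longlongrightarrow> 0) (at 0)"
proof (rule filterlim_split_at)
  have "eventually (\<lambda>t. flat k t = 0) (at_left 0)"
    by (auto simp: flat_def eventually_at_filter)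
  then show "(flat k \<longlongrightarrow> 0) (at_left 0)"
    by (rule tendsto_eventually)
  have "((\<lambda>x. x ^ k / exp x) \<longlongrightarrow> (0::real)) at_top"
    by (rule tendsto_power_div_exp_0)
  then have "((\<lambda>t. inverse t ^ k / exp (inverse t)) \<longlongrightarrow> (0::real)) (at_right 0)"
    by (rule filterlim_compose) (rule filterlim_inverse_at_top_right)
  moreover have "eventually (\<lambda>t. inverse t ^ k / exp (inverse t) = flat k t) (at_right 0)"
    by (auto simp: flat_def eventually_at_filter exp_minus divide_inverse mult.commute)
  ultimately show "(flat k \<longlongrightarrow> 0) (at_right 0)"
    by (rule Lim_transform_eventually)
qed

text \<open>The powers \<open>inverse t ^ k\<close> are carried along because they make the family
  closed under differentiation up to linear combinations, so that one induction over all
  \<open>k\<close> yields smoothness.\<close>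

lemma flat_has_field_derivative:
  "(flat k has_real_derivative (flat (k + 2) t - k * flat (k + 1) t)) (at t)"
proof (cases "t = 0")
  case True
  \<comment> \<open>The difference quotient at 0 is again a member of the family, so the derivative
    there is a limit that is already known.\<close>
  have "flat (Suc k) h = flat k h / h" for h
    by (simp add: flat_def power_Suc2 divide_inverse mult.assoc del: power_Suc)
  then have "flat (Suc k) = (\<lambda>h. flat k h / h)"
    by blast
  with flat_tendsto_0[of "Suc k"] have "((\<lambda>h. flat k h / h) \<longlongrightarrow> 0) (at 0)"
    by metis
  then show ?thesis
    using True by (simp add: DERIV_def flat_def)
next
  case False
  show ?thesis
  proof (cases "t < 0")
    case True
    have "((\<lambda>t. 0) has_real_derivative (flat (k + 2) t - k * flat (k + 1) t)) (at t)"
      using True by (auto simp: flat_def)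
    then show ?thesis
      by (rule DERIV_cong_ev[THEN iffD1, rotated -1])
        (use True in \<open>auto simp: flat_def intro!: eventually_mono[OF eventually_nhds_in_open[of "{..<0}"]]\<close>)
  next
    case F: False
    then have t: "t > 0" using False by simp
    have 1: "(inverse has_real_derivative - (inverse t * inverse t)) (at t)"
      using DERIV_inverse[of t UNIV] False by (simp add: power2_eq_square)
    have 2: "(inverse t * inverse t) * exp (- inverse t) * inverse t ^ k +
        k * (- (inverse t * inverse t) * inverse t ^ (k - Suc 0)) * exp (- inverse t) =
        flat (k + 2) t - k * flat (k + 1) t"
      using t by (cases k) (simp_all add: flat_def algebra_simps)
    have "((\<lambda>t. exp (- inverse t) * inverse t ^ k) has_real_derivative
        (exp (- inverse t) * (- (- (inverse t * inverse t)))) * inverse t ^ k +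
        (real k * (- (inverse t * inverse t) * inverse t ^ (k - Suc 0))) * exp (- inverse t)) (at t)"
      by (rule DERIV_mult[OF DERIV_fun_exp[OF DERIV_minus[OF 1]] DERIV_power[OF 1]])
    then have "((\<lambda>t. exp (- inverse t) * inverse t ^ k) has_real_derivative
        flat (k + 2) t - k * flat (k + 1) t) (at t)"
      unfolding 2[symmetric] by (simp only: minus_minus mult.commute)
    then show ?thesis
      by (rule DERIV_cong_ev[THEN iffD1, rotated -1])
        (use t in \<open>auto simp: flat_def intro!: eventually_mono[OF eventually_nhds_in_open[of "{0<..}"]]\<close>)
  qed
qed

lemma infinitely_differentiable_on_flat: "infinitely_differentiable_on UNIV (flat k)"
proof
  fix n show "higher_differentiable_on n UNIV (flat k)"
  proof (induction n arbitrary: k)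
    case 0
    show ?case
      using flat_has_field_derivative
      by (auto intro!: continuous_at_imp_continuous_on DERIV_isCont)
  next
    case (Suc n)
    have D: "(flat k has_derivative (\<lambda>h. h * (flat (k + 2) t + (- real k) * flat (k + 1) t))) (at t)" for t
      using flat_has_field_derivative[of k t] unfolding has_field_derivative_def
      by (rule has_derivative_eq_rhs) (auto simp: fun_eq_iff algebra_simps)
    have "frechet_derivative (flat k) (at t) v = v * (flat (k + 2) t + (- real k) * flat (k + 1) t)" for t v
      using frechet_derivative_at[OF D] by metis
    moreover have "higher_differentiable_on n UNIV (\<lambda>t. v * (flat (k + 2) t + (- real k) * flat (k + 1) t))" for v
      by (intro higher_differentiable_on_bounded_bilinear[OF bounded_bilinear_mult]
          higher_differentiable_on_add Suc.IH higher_differentiable_on_const open_UNIV)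
    ultimately show ?case
      using differentiableI[OF D] by simp
  qed
qed

lemma infinitely_differentiable_on_inverse:
  "infinitely_differentiable_on {0<..} (inverse :: real \<Rightarrow> real)"
proof
  fix n show "higher_differentiable_on n {0<..} (inverse :: real \<Rightarrow> real)"
  proof (induction n)
    case 0
    have "continuous_on {0<..} (\<lambda>x::real. inverse x)"
      by (rule continuous_on_inverse[OF continuous_on_id]) auto
    then show ?case by simp
  next
    case (Suc n)
    have D: "((inverse :: real \<Rightarrow> real) has_derivative (\<lambda>h. h * (- (inverse t * inverse t)))) (at t)"
      if "t > 0" for t
    proof -
      have "(*) (- (inverse t ^ Suc (Suc 0))) = (\<lambda>h. h * (- (inverse t * inverse t)))"
        by (rule ext) (simp only: power_Suc power_0 mult_1_right mult.commute)
      then show ?thesis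
        using DERIV_inverse[of t UNIV] that by (simp add: has_field_derivative_def)
    qed
    have "higher_differentiable_on n {0<..} (\<lambda>t. v * ((-1) * (inverse t * inverse t)))" for v :: real
      by (intro higher_differentiable_on_bounded_bilinear[OF bounded_bilinear_mult]
          Suc.IH higher_differentiable_on_const open_greaterThan)
    then have "higher_differentiable_on n {0<..} (\<lambda>t. frechet_derivative inverse (at t) v)" for v :: real
      by (rule higher_differentiable_on_cong[OF open_greaterThan, THEN iffD1, rotated])
        (simp add: frechet_derivative_at[OF D, symmetric])
    then show ?case
      using differentiableI[OF D] by simp
  qed
qed

text \<open>The bump is \<open>flat 0 (s x)\<close> divided by
  \<open>N x = flat 0 (s x) + flat 0 (w x)\<close>. Inside radius \<open>r\<close> the second
  summand vanishes and the quotient is 1; beyond \<open>2 * r\<close> the numerator vanishes.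
  Squared distances keep everything smooth at the centre.\<close>

lemma infinitely_differentiable_bump:
  fixes a :: "'a::euclidean_space"
  assumes "r > 0"
  obtains \<beta> :: "'a \<Rightarrow> real" where "infinitely_differentiable_on UNIV \<beta>"
    "\<And>x. dist x a \<le> r \<Longrightarrow> \<beta> x = 1" "\<And>x. dist x a \<ge> 2 * r \<Longrightarrow> \<beta> x = 0"
proof -
  define q where "q x = (x - a) \<bullet> (x - a)" for x
  define s where "s x = 4 * r\<^sup>2 - q x" for x
  define w where "w x = q x - r\<^sup>2" for x
  define N where "N x = flat 0 (s x) + flat 0 (w x)" for x
  have q: "q x = (dist x a)\<^sup>2" for x
    by (simp add: q_def dist_norm power2_norm_eq_inner)
  have 1: "w x \<le> 0" if "dist x a \<le> r" for x
    using that by (simp add: w_def q power_mono)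
  have 2: "s x \<le> 0" if "dist x a \<ge> 2 * r" for x
    using that assms power_mono[of "2 * r" "dist x a" 2] by (simp add: s_def q power_mult_distrib)
  have pos: "N x > 0" for x
  proof -
    \<comment> \<open>The two arguments add up to \<open>3 * r\<^sup>2\<close>, so they cannot both
      be nonpositive.\<close>
    have "w x > 0 \<or> s x > 0"
      using zero_less_power2[of r] assms unfolding w_def s_def by linarith
    then show ?thesis by (auto simp: N_def flat_def add_pos_nonneg add_nonneg_pos)
  qed
  have idd: "higher_differentiable_on n UNIV (\<lambda>x. x + (- a))" for n
    by (rule higher_differentiable_on_add[OF open_UNIV
          infinitely_differentiable_on_linear[OF bounded_linear_ident, rule_format]
          higher_differentiable_on_const])
  have idq: "higher_differentiable_on n UNIV q" for n
    using higher_differentiable_on_bounded_bilinear[OF bounded_bilinear_inner open_UNIV idd idd]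
    by (simp add: q_def[abs_def])
  have ids: "higher_differentiable_on n UNIV s" for n
    using higher_differentiable_on_add[OF open_UNIV higher_differentiable_on_const[of _ _ "4 * r\<^sup>2"]
        higher_differentiable_on_bounded_linear_comp[OF bounded_linear_minus[OF bounded_linear_ident] open_UNIV idq]]
    by (simp add: s_def[abs_def])
  have idw: "higher_differentiable_on n UNIV w" for n
    using higher_differentiable_on_add[OF open_UNIV idq higher_differentiable_on_const[of _ _ "- r\<^sup>2"]]
    by (simp add: w_def[abs_def])
  note fs = higher_differentiable_on_compose[OF open_UNIV subset_UNIV
      infinitely_differentiable_on_flat[of 0, rule_format]]
  have "higher_differentiable_on n UNIV N" for n
    unfolding N_def[abs_def] by (rule higher_differentiable_on_add[OF open_UNIV fs[OF ids] fs[OF idw]])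
  then have "higher_differentiable_on n UNIV (\<lambda>x. inverse (N x))" for n
    using higher_differentiable_on_compose[OF open_UNIV _
        infinitely_differentiable_on_inverse[rule_format], of N] pos by auto
  then have "higher_differentiable_on n UNIV (\<lambda>x. flat 0 (s x) * inverse (N x))" for n
    by (rule higher_differentiable_on_bounded_bilinear[OF bounded_bilinear_mult open_UNIV fs[OF ids]])
  moreover have "flat 0 (s x) * inverse (N x) = 1" if "dist x a \<le> r" for x
  proof -
    have "flat 0 (w x) = 0" using 1[OF that] by (simp add: flat_def)
    then show ?thesis using pos[of x] by (simp add: N_def)
  qed
  moreover have "flat 0 (s x) * inverse (N x) = 0" if "dist x a \<ge> 2 * r" for x
    using 2[OF that] by (simp add: flat_def)
  ultimately show ?thesis using that by blast
qed

text \<open>Differentiation under the integral sign in direction \<open>v\<close> replaces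
  \<open>F\<close> by its derivative along \<open>v\<close> and produces one more factor
  \<open>t\<close>. The weight \<open>t ^ k\<close> and the arbitrary \<open>F\<close> make the
  claim stable under this step.\<close>

lemma higher_differentiable_on_segment_average:
  fixes F :: "'a::euclidean_space \<Rightarrow> real" and a :: 'a
  assumes "open U" "convex U" "a \<in> U"
  shows "infinitely_differentiable_on U F \<Longrightarrow>
    higher_differentiable_on n U (\<lambda>x. integral {0..1} (\<lambda>t. t ^ k * F (a + t *\<^sub>R (x - a))))"
proof (induction n arbitrary: k F)
  have seg: "a + t *\<^sub>R (x - a) \<in> U" if "x \<in> U" "0 \<le> t" "t \<le> 1" for x t
  proof -
    have "(1 - t) *\<^sub>R a + t *\<^sub>R x \<in> U"
      using assms that by (auto intro!: convexD)
    then show ?thesis by (simp add: algebra_simps)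
  qed
  have cont: "continuous_on (U \<times> {0..1}) (\<lambda>(x, t). t ^ k * F (a + t *\<^sub>R (x - a)))"
    if "continuous_on U F" for F :: "'a \<Rightarrow> real" and k
    unfolding split_beta
    by (intro continuous_intros continuous_on_compose2[OF that]) (auto intro: seg)
  {
    case 0
    show ?case
      using cont[OF infinitely_differentiable_on_continuous[OF 0]]
      by (simp, intro integral_continuous_on_param[where a=0 and b="1::real", unfolded cbox_interval])
  next
    case (Suc n)
    let ?f = "\<lambda>x t. t ^ k * F (a + t *\<^sub>R (x - a))"
    let ?dF = "\<lambda>b x. frechet_derivative F (at x) b"
    \<comment> \<open>The derivative of the integrand in \<open>x\<close>, packaged as a bounded
      linear map as the Leibniz rule for integrals demands. The basis expansion reduces its joint
      continuity to that of scalar partial derivatives.\<close>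
    define fx where "fx x t = (\<Sum>b\<in>Basis. (t ^ Suc k * ?dF b (a + t *\<^sub>R (x - a))) *\<^sub>R blinfun_inner_left b)"
      for x t
    have fx_apply: "blinfun_apply (fx x t) v = t ^ Suc k * ?dF v (a + t *\<^sub>R (x - a))"
      if "x \<in> U" "t \<in> {0..1}" for x t v
    proof -
      have "F differentiable (at (a + t *\<^sub>R (x - a)))"
        using infinitely_differentiable_on_differentiable[OF Suc.prems] seg that by auto
      then show ?thesis
        by (subst frechet_derivative_euclidean_sum)
          (auto simp: fx_def blinfun.sum_left blinfun.scaleR_left sum_distrib_left algebra_simps)
    qed
    have D: "((\<lambda>x. ?f x t) has_derivative blinfun_apply (fx x t)) (at x within U)"
      if "x \<in> U" "t \<in> cbox 0 1" for x t
    proof -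
      have FD: "(F has_derivative frechet_derivative F (at (a + t *\<^sub>R (x - a)))) (at (a + t *\<^sub>R (x - a)))"
        using infinitely_differentiable_on_has_derivative[OF Suc.prems] seg that by auto
      have "((\<lambda>x. t ^ k * F (a + t *\<^sub>R (x - a))) has_derivative
          (\<lambda>v. t ^ k * ?dF (t *\<^sub>R v) (a + t *\<^sub>R (x - a)))) (at x within U)"
        by (rule has_derivative_mult_right[OF has_derivative_compose[where f = "\<lambda>x. a + t *\<^sub>R (x - a)", OF _ FD]])
          (auto intro!: derivative_eq_intros)
      moreover have "linear (frechet_derivative F (at (a + t *\<^sub>R (x - a))))"
        using FD by (simp add: has_derivative_linear)
      moreover have "blinfun_apply (fx x t) = (\<lambda>v. t ^ Suc k * ?dF v (a + t *\<^sub>R (x - a)))"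
        using fx_apply that by auto
      ultimately show ?thesis
        by (simp add: linear_scale mult.assoc mult.left_commute)
    qed
    have cfx: "continuous_on (U \<times> cbox 0 1) (\<lambda>(x, t). fx x t)"
      unfolding fx_def split_beta cbox_interval
      using cont[OF infinitely_differentiable_on_continuous[OF
          infinitely_differentiable_on_derivative[OF Suc.prems]], of "Suc k", unfolded split_beta]
      by (intro continuous_on_sum continuous_on_scaleR continuous_on_const)
    have int: "?f x integrable_on cbox 0 1" if "x \<in> U" for x
      using cont[OF infinitely_differentiable_on_continuous[OF Suc.prems], of k] that
      by (intro integrable_continuous continuous_on_compose2[of "U \<times> {0..1}"
            "\<lambda>(x,t). ?f x t" _ "\<lambda>t. (x,t)", simplified])
        (auto intro!: continuous_intros)
    have DI: "((\<lambda>x. integral (cbox 0 1) (?f x)) has_derivative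
        blinfun_apply (integral (cbox 0 1) (fx x))) (at x)" if "x \<in> U" for x
      using leibniz_rule[OF D int cfx that assms(2)] at_within_open[OF that assms(1)] by simp
    have app: "blinfun_apply (integral (cbox 0 1) (fx x)) v =
        integral {0..1} (\<lambda>t. t ^ Suc k * ?dF v (a + t *\<^sub>R (x - a)))" if "x \<in> U" for x v
    proof -
      have "fx x integrable_on cbox 0 1"
        by (intro integrable_continuous continuous_on_compose2[OF cfx, of _ "\<lambda>t. (x,t)", simplified])
          (use that in \<open>auto intro!: continuous_intros\<close>)
      then have "integral (cbox 0 1) ((\<lambda>A. blinfun_apply A v) \<circ> fx x) =
          blinfun_apply (integral (cbox 0 1) (fx x)) v"
        by (rule integral_linear) (rule blinfun.bounded_linear_left)
      then have "blinfun_apply (integral (cbox 0 1) (fx x)) v = integral {0..1} (\<lambda>t. blinfun_apply (fx x t) v)"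
        by (simp add: comp_def)
      also have "\<dots> = integral {0..1} (\<lambda>t. t ^ Suc k * ?dF v (a + t *\<^sub>R (x - a)))"
        by (rule integral_cong) (rule fx_apply[OF that])
      finally show ?thesis .
    qed
    have "higher_differentiable_on n U (\<lambda>x. frechet_derivative (\<lambda>x. integral {0..1} (?f x)) (at x) v)" for v
    proof (subst higher_differentiable_on_cong[OF assms(1)])
      show "higher_differentiable_on n U (\<lambda>x. integral {0..1} (\<lambda>t. t ^ Suc k * ?dF v (a + t *\<^sub>R (x - a))))"
        by (rule Suc.IH) (rule infinitely_differentiable_on_derivative[OF Suc.prems])
      show "frechet_derivative (\<lambda>x. integral {0..1} (?f x)) (at x) v =
          integral {0..1} (\<lambda>t. t ^ Suc k * ?dF v (a + t *\<^sub>R (x - a)))" if "x \<in> U" for x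
        using frechet_derivative_at[OF DI[OF that], symmetric] app[OF that] by simp
    qed
    then show ?case
      using differentiableI[OF DI] by simp
  }
qed

text \<open>Integrate the derivative of \<open>F (a + t *\<^sub>R (x - a))\<close> over
  \<open>t\<close> from 0 to 1 and expand \<open>x - a\<close> in the basis: the coefficients are
  segment averages of the partial derivatives, hence smooth. Convexity keeps the segment inside
  \<open>U\<close>.\<close>

lemma hadamard:
  fixes F :: "'a::euclidean_space \<Rightarrow> real"
  assumes "open U" "convex U" "a \<in> U" "infinitely_differentiable_on U F"
  obtains h :: "'a \<Rightarrow> 'a \<Rightarrow> real" where
    "\<And>b. infinitely_differentiable_on U (h b)"
    "\<And>b. h b a = frechet_derivative F (at a) b"
    "\<And>x. x \<in> U \<Longrightarrow> F x = F a + (\<Sum>b\<in>Basis. ((x - a) \<bullet> b) * h b x)"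
proof
  let ?dF = "\<lambda>b x. frechet_derivative F (at x) b"
  let ?h = "\<lambda>b x. integral {0..1} (\<lambda>t. t ^ 0 * ?dF b (a + t *\<^sub>R (x - a)))"
  show "infinitely_differentiable_on U (?h b)" for b
    by (intro allI higher_differentiable_on_segment_average assms
        infinitely_differentiable_on_derivative)
  show "?h b a = frechet_derivative F (at a) b" for b
    by simp
  show "F x = F a + (\<Sum>b\<in>Basis. ((x - a) \<bullet> b) * ?h b x)" if "x \<in> U" for x
  proof -
    have seg: "a + t *\<^sub>R (x - a) \<in> U" if "t \<in> {0..1}" for t
    proof -
      have "(1 - t) *\<^sub>R a + t *\<^sub>R x \<in> U"
        using assms that \<open>x \<in> U\<close> by (auto intro!: convexD)
      then show ?thesis by (simp add: algebra_simps)
    qed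
    have "((\<lambda>t. F (a + t *\<^sub>R (x - a))) has_vector_derivative
        (\<Sum>b\<in>Basis. ((x - a) \<bullet> b) * ?dF b (a + t *\<^sub>R (x - a)))) (at t within {0..1})"
      if "t \<in> {0..1}" for t
    proof -
      have FD: "(F has_derivative frechet_derivative F (at (a + t *\<^sub>R (x - a)))) (at (a + t *\<^sub>R (x - a)))"
        by (rule infinitely_differentiable_on_has_derivative[OF assms(4) seg[OF that]])
      have "((\<lambda>t. F (a + t *\<^sub>R (x - a))) has_derivative
          (\<lambda>s. ?dF (s *\<^sub>R (x - a)) (a + t *\<^sub>R (x - a)))) (at t within {0..1})"
        by (rule has_derivative_compose[where f = "\<lambda>t. a + t *\<^sub>R (x - a)", OF _ FD]) (auto intro!: derivative_eq_intros)
      moreover have "linear (frechet_derivative F (at (a + t *\<^sub>R (x - a))))"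
        using FD by (simp add: has_derivative_linear)
      moreover have "?dF (x - a) (a + t *\<^sub>R (x - a)) =
          (\<Sum>b\<in>Basis. ((x - a) \<bullet> b) * ?dF b (a + t *\<^sub>R (x - a)))"
        using frechet_derivative_euclidean_sum[of F "a + t *\<^sub>R (x - a)" "x - a"] FD
        by (auto simp: differentiable_def)
      ultimately show ?thesis
        by (simp add: has_vector_derivative_def linear_scale)
    qed
    then have "((\<lambda>t. \<Sum>b\<in>Basis. ((x - a) \<bullet> b) * ?dF b (a + t *\<^sub>R (x - a))) has_integral
        (F (a + 1 *\<^sub>R (x - a)) - F (a + 0 *\<^sub>R (x - a)))) {0..1}"
      by (intro fundamental_theorem_of_calculus) auto
    then have "F x - F a = integral {0..1} (\<lambda>t. \<Sum>b\<in>Basis. ((x - a) \<bullet> b) * ?dF b (a + t *\<^sub>R (x - a)))"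
      by (simp add: integral_unique)
    also have "\<dots> = (\<Sum>b\<in>Basis. integral {0..1} (\<lambda>t. ((x - a) \<bullet> b) * ?dF b (a + t *\<^sub>R (x - a))))"
    proof (rule integral_sum)
      fix b :: 'a
      have "continuous_on {0..1} (\<lambda>t. ?dF b (a + t *\<^sub>R (x - a)))"
        by (intro continuous_on_compose2[OF infinitely_differentiable_on_continuous[OF
              infinitely_differentiable_on_derivative[OF assms(4)]]] continuous_intros)
          (auto intro!: seg)
      then show "(\<lambda>t. ((x - a) \<bullet> b) * ?dF b (a + t *\<^sub>R (x - a))) integrable_on {0..1}"
        by (intro integrable_continuous_interval continuous_intros)
    qed simp
    also have "\<dots> = (\<Sum>b\<in>Basis. ((x - a) \<bullet> b) * ?h b x)"
      by simp
    finally show ?thesis by simp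
  qed
qed

section \<open>Smooth functions and charts\<close>

lemma smooth_on_subset: "smooth_on A f \<Longrightarrow> B \<subseteq> A \<Longrightarrow> smooth_on B f"
  unfolding smooth_on_def by (meson Int_mono inf.orderE le_infE order_refl subsetD)

lemma smooth_on_cong:
  assumes "smooth_on A f" "\<And>x. x \<in> A \<Longrightarrow> f x = g x"
  shows "smooth_on A g"
  using assms unfolding smooth_on_def by (metis IntD1)

lemma smooth_on_local:
  assumes "\<And>x. x \<in> A \<Longrightarrow> \<exists>T. open T \<and> x \<in> T \<and> smooth_on (A \<inter> T) f"
  shows "smooth_on A f"
  unfolding smooth_on_def
proof
  fix x assume "x \<in> A"
  then obtain T where T: "open T" "x \<in> T" "smooth_on (A \<inter> T) f"
    using assms by blast
  then obtain V g where V: "open V" "x \<in> V" "infinitely_differentiable_on V g"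
    "\<forall>y\<in>A \<inter> T \<inter> V. g y = f y"
    unfolding smooth_on_def using \<open>x \<in> A\<close> by blast
  show "\<exists>U g. open U \<and> x \<in> U \<and> infinitely_differentiable_on U g \<and> (\<forall>y\<in>A \<inter> U. g y = f y)"
    using T V
    by (intro exI[of _ "T \<inter> V"] exI[of _ g]) (auto intro: higher_differentiable_on_subset)
qed

lemma smooth_on_const: "smooth_on A (\<lambda>x. c)"
  unfolding smooth_on_def
  by (intro ballI exI[of _ UNIV] exI[of _ "\<lambda>x. c"]) (simp add: higher_differentiable_on_const)

lemma smooth_on_add:
  assumes "smooth_on A f" "smooth_on A g"
  shows "smooth_on A (\<lambda>x. f x + g x)"
  unfolding smooth_on_def
proof
  fix x assume x: "x \<in> A"
  obtain U f' where U: "open U" "x \<in> U" "infinitely_differentiable_on U f'" "\<forall>y\<in>A \<inter> U. f' y = f y"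
    using assms(1) x unfolding smooth_on_def by metis
  obtain V g' where V: "open V" "x \<in> V" "infinitely_differentiable_on V g'" "\<forall>y\<in>A \<inter> V. g' y = g y"
    using assms(2) x unfolding smooth_on_def by metis
  have "higher_differentiable_on n (U \<inter> V) (\<lambda>x. f' x + g' x)" for n
    using U V by (intro higher_differentiable_on_add) (auto intro: higher_differentiable_on_subset)
  then show "\<exists>U h. open U \<and> x \<in> U \<and> infinitely_differentiable_on U h \<and> (\<forall>y\<in>A \<inter> U. h y = f y + g y)"
    using U V by (intro exI[of _ "U \<inter> V"] exI[of _ "\<lambda>x. f' x + g' x"]) auto
qed

lemma smooth_on_mult:
  fixes f g :: "'a::real_normed_vector \<Rightarrow> real"
  assumes "smooth_on A f" "smooth_on A g"
  shows "smooth_on A (\<lambda>x. f x * g x)"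
  unfolding smooth_on_def
proof
  fix x assume x: "x \<in> A"
  obtain U f' where U: "open U" "x \<in> U" "infinitely_differentiable_on U f'" "\<forall>y\<in>A \<inter> U. f' y = f y"
    using assms(1) x unfolding smooth_on_def by metis
  obtain V g' where V: "open V" "x \<in> V" "infinitely_differentiable_on V g'" "\<forall>y\<in>A \<inter> V. g' y = g y"
    using assms(2) x unfolding smooth_on_def by metis
  have "higher_differentiable_on n (U \<inter> V) (\<lambda>x. f' x * g' x)" for n
    using U V by (intro higher_differentiable_on_bounded_bilinear[OF bounded_bilinear_mult])
      (auto intro: higher_differentiable_on_subset)
  then show "\<exists>U h. open U \<and> x \<in> U \<and> infinitely_differentiable_on U h \<and> (\<forall>y\<in>A \<inter> U. h y = f y * g y)"
    using U V by (intro exI[of _ "U \<inter> V"] exI[of _ "\<lambda>x. f' x * g' x"]) auto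
qed

lemma smooth_funs_const: "(\<lambda>x. c) \<in> smooth_funs M A"
  by (auto simp: smooth_funs_def comp_def smooth_on_const)

lemma smooth_funs_add:
  "f \<in> smooth_funs M A \<Longrightarrow> g \<in> smooth_funs M A \<Longrightarrow> (\<lambda>x. f x + g x) \<in> smooth_funs M A"
  by (auto simp: smooth_funs_def comp_def intro!: smooth_on_add)

lemma smooth_funs_mult:
  "f \<in> smooth_funs M A \<Longrightarrow> g \<in> smooth_funs M A \<Longrightarrow> (\<lambda>x. f x * g x) \<in> smooth_funs M A"
  by (auto simp: smooth_funs_def comp_def intro!: smooth_on_mult)

lemma smooth_funs_scale: "f \<in> smooth_funs M A \<Longrightarrow> (\<lambda>x. c * f x) \<in> smooth_funs M A"
  by (rule smooth_funs_mult[OF smooth_funs_const])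

lemma smooth_funs_diff:
  assumes "f \<in> smooth_funs M A" "g \<in> smooth_funs M A"
  shows "(\<lambda>x. f x - g x) \<in> smooth_funs M A"
  using smooth_funs_add[OF assms(1) smooth_funs_scale[OF assms(2), of "-1"]] by simp

lemma smooth_funs_sum:
  "(\<And>i. i \<in> I \<Longrightarrow> f i \<in> smooth_funs M A) \<Longrightarrow> (\<lambda>x. \<Sum>i\<in>I. f i x) \<in> smooth_funs M A"
  by (induction I rule: infinite_finite_induct) (auto intro: smooth_funs_const smooth_funs_add)

lemma smooth_funs_power2: "f \<in> smooth_funs M A \<Longrightarrow> (\<lambda>x. (f x)\<^sup>2) \<in> smooth_funs M A"
  by (simp add: power2_eq_square smooth_funs_mult)

lemma smooth_funs_subset: "f \<in> smooth_funs M A \<Longrightarrow> B \<subseteq> A \<Longrightarrow> f \<in> smooth_funs M B"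
  by (force simp: smooth_funs_def intro: smooth_on_subset)

lemma C_inf_subset_smooth_funs: "openin (man_top M) A \<Longrightarrow> f \<in> C_inf M \<Longrightarrow> f \<in> smooth_funs M A"
  by (meson openin_subset smooth_funs_subset)

section \<open>Charts as parametrisations by open sets of the ambient space\<close>

locale manifold_chart =
  fixes M :: "('a, 'e::euclidean_space) manifold" and U :: "'a set" and \<phi> :: "'a \<Rightarrow> 'e"
  assumes manifold: "smooth_manifold M" and chart: "(U, \<phi>) \<in> man_charts M"
begin

lemma openin_chart: "openin (man_top M) U"
  and openin_image: "openin (top_of_set (man_model M)) (\<phi> ` U)"
  and homeomorphic_chart: "homeomorphic_map (subtopology (man_top M) U) (top_of_set (\<phi> ` U)) \<phi>"
  and subspace_model: "subspace (man_model M)"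
  and Hausdorff: "Hausdorff_space (man_top M)"
  using manifold chart by (fastforce simp: smooth_manifold_def)+

lemma chart_subset_points: "U \<subseteq> points M"
  using openin_chart by (rule openin_subset)

lemma inj_on_chart: "inj_on \<phi> U"
  using homeomorphic_imp_injective_map[OF homeomorphic_chart] chart_subset_points
  by (simp add: inf.absorb2)

text \<open>The linear projection \<open>P\<close> onto the model space makes \<open>psi\<close> an inverse of the chart defined on an
  open subset of the ambient Euclidean space, so that ordinary derivatives can be used.\<close>

definition P :: "'e \<Rightarrow> 'e" where
  "P = (SOME P. linear P \<and> range P \<subseteq> man_model M \<and> (\<forall>x\<in>man_model M. P x = x))"

lemma linear_P: "linear P" and P_in_model: "P x \<in> man_model M"
  and P_ident: "x \<in> man_model M \<Longrightarrow> P x = x"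
proof -
  have "\<exists>P. range P \<subseteq> man_model M \<and> linear P \<and> (\<forall>x\<in>man_model M. P (id x) = x)"
    by (rule linear_exists_left_inverse_on[OF linear_id subspace_model]) simp
  then have "\<exists>P. linear P \<and> range P \<subseteq> man_model M \<and> (\<forall>x\<in>man_model M. P x = x)"
    by auto
  then have "linear P \<and> range P \<subseteq> man_model M \<and> (\<forall>x\<in>man_model M. P x = x)"
    unfolding P_def by (rule someI_ex)
  then show "linear P" "P x \<in> man_model M" "x \<in> man_model M \<Longrightarrow> P x = x"
    by auto
qed

lemma bounded_linear_P: "bounded_linear P"
  using linear_P by (simp add: linear_conv_bounded_linear)

lemma P_idem: "P (P x) = P x"
  by (simp add: P_ident P_in_model)

definition psi :: "'e \<Rightarrow> 'a" where "psi y = inv_into U \<phi> (P y)"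

text \<open>The cylinder over the chart image of \<open>A\<close> along the fibres of
  \<open>P\<close>. It is open in the ambient space when \<open>A\<close> is an open subset of
  \<open>U\<close>, whereas the chart image itself is only relatively open in the model.\<close>

definition coord :: "'a set \<Rightarrow> 'e set" where "coord A = {y. P y \<in> \<phi> ` A}"

lemma psi_P: "psi (P y) = psi y"
  by (simp add: psi_def P_idem)

lemma chart_in_model: "x \<in> U \<Longrightarrow> \<phi> x \<in> man_model M"
  using openin_image openin_imp_subset by fastforce

lemma P_chart: "x \<in> U \<Longrightarrow> P (\<phi> x) = \<phi> x"
  by (simp add: P_ident chart_in_model)

lemma psi_chart: "x \<in> U \<Longrightarrow> psi (\<phi> x) = x"
  by (simp add: psi_def P_chart inj_on_chart)

lemma chart_in_coord: "x \<in> A \<Longrightarrow> A \<subseteq> U \<Longrightarrow> \<phi> x \<in> coord A"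
  by (auto simp: coord_def P_chart)

lemma psi_in: "y \<in> coord A \<Longrightarrow> A \<subseteq> U \<Longrightarrow> psi y \<in> A"
  using inj_on_chart by (auto simp: coord_def psi_def inv_into_f_f subsetD)

lemma chart_psi: "y \<in> coord U \<Longrightarrow> \<phi> (psi y) = P y"
  by (auto simp: coord_def psi_def f_inv_into_f)

lemma coord_mono: "A \<subseteq> B \<Longrightarrow> coord A \<subseteq> coord B"
  by (auto simp: coord_def)

lemma P_in_coord: "P y \<in> coord A \<longleftrightarrow> y \<in> coord A"
  by (simp add: coord_def P_idem)

lemma coord_Int: "A \<subseteq> U \<Longrightarrow> coord (A \<inter> W) = {y \<in> coord A. psi y \<in> W}"
  using inj_on_chart by (auto simp: coord_def psi_def inv_into_f_f subsetD)

lemma openin_chart_image: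
  assumes "openin (man_top M) A" "A \<subseteq> U"
  shows "openin (top_of_set (man_model M)) (\<phi> ` A)"
proof -
  have "openin (subtopology (man_top M) U) A"
    using assms openin_chart by (simp add: openin_open_subtopology)
  then have "openin (top_of_set (\<phi> ` U)) (\<phi> ` A)"
    using homeomorphic_map_openness_eq[OF homeomorphic_chart] by blast
  then show ?thesis
    using openin_image openin_trans by blast
qed

lemma open_coord:
  assumes "openin (man_top M) A" "A \<subseteq> U"
  shows "open (coord A)"
proof -
  obtain T where T: "open T" "\<phi> ` A = man_model M \<inter> T"
    using openin_chart_image[OF assms] by (metis openin_open)
  then have "coord A = P -` T"
    by (auto simp: coord_def P_in_model)
  then show ?thesis
    using T(1) by (simp add: continuous_open_vimage linear_continuous_at bounded_linear_P)
qed

lemma continuous_map_chart: "continuous_map (subtopology (man_top M) U) euclidean \<phi>"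
  using homeomorphic_imp_continuous_map[OF homeomorphic_chart]
  by (simp add: continuous_map_in_subtopology)

lemma openin_chart_preimage:
  assumes "open T" shows "openin (man_top M) {x \<in> U. \<phi> x \<in> T}"
proof -
  have "openin (subtopology (man_top M) U) {x \<in> topspace (subtopology (man_top M) U). \<phi> x \<in> T}"
    using continuous_map_chart assms by (intro openin_continuous_map_preimage) auto
  then show ?thesis
    using openin_chart chart_subset_points
    by (simp add: openin_open_subtopology inf.absorb2)
qed

lemma continuous_map_psi: "continuous_map (top_of_set (coord U)) (man_top M) psi"
  unfolding continuous_map_def
proof (intro conjI allI impI)
  show "psi \<in> topspace (top_of_set (coord U)) \<rightarrow> points M"
    using psi_in chart_subset_points by auto
  fix W assume W: "openin (man_top M) W"
  have "{x \<in> topspace (top_of_set (coord U)). psi x \<in> W} = coord (U \<inter> W)"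
    by (simp add: coord_Int)
  moreover have "open (coord (U \<inter> W))"
    using W openin_chart by (intro open_coord) auto
  ultimately show "openin (top_of_set (coord U)) {x \<in> topspace (top_of_set (coord U)). psi x \<in> W}"
    by (simp add: coord_mono open_coord openin_chart openin_open_eq)
qed

text \<open>Smoothness only provides local extensions \<open>g\<close> that agree with
  \<open>f\<close> on the chart image. Composed with \<open>P\<close>, such a \<open>g\<close>
  agrees with \<open>f \<circ> psi\<close> on a full neighbourhood in the cylinder, so its
  derivatives are those of \<open>f \<circ> psi\<close>.\<close>

lemma smooth_funs_imp_infinitely_differentiable:
  assumes "openin (man_top M) A" "f \<in> smooth_funs M A"
  shows "infinitely_differentiable_on (coord (A \<inter> U)) (f \<circ> psi)"
proof
  fix n show "higher_differentiable_on n (coord (A \<inter> U)) (f \<circ> psi)"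
  proof (rule higher_differentiable_on_local)
    fix y assume y: "y \<in> coord (A \<inter> U)"
    have "smooth_on (\<phi> ` (A \<inter> U)) (f \<circ> inv_into U \<phi>)"
      using assms(2) chart by (auto simp: smooth_funs_def)
    moreover have "P y \<in> \<phi> ` (A \<inter> U)"
      using y by (simp add: coord_def)
    ultimately obtain T g where T: "open T" "P y \<in> T" "infinitely_differentiable_on T g"
      "\<forall>w\<in>\<phi> ` (A \<inter> U) \<inter> T. g w = (f \<circ> inv_into U \<phi>) w"
      unfolding smooth_on_def by blast
    define V where "V = coord (A \<inter> U) \<inter> P -` T"
    have "open V"
      unfolding V_def using assms(1) openin_chart T(1)
      by (intro open_Int open_coord continuous_open_vimage)
        (auto simp: linear_continuous_at bounded_linear_P)
    have "higher_differentiable_on n V (\<lambda>y. g (P y))"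
      by (rule higher_differentiable_on_compose[OF \<open>open V\<close> _ T(3)[rule_format]
            infinitely_differentiable_on_linear[OF bounded_linear_P, rule_format]])
        (auto simp: V_def)
    moreover have "g (P w) = (f \<circ> psi) w" if "w \<in> V" for w
      using that T(4) by (auto simp: V_def coord_def psi_def)
    ultimately have "higher_differentiable_on n V (f \<circ> psi)"
      by (rule higher_differentiable_on_transform) (use \<open>open V\<close> in auto)
    then show "\<exists>V. open V \<and> y \<in> V \<and> higher_differentiable_on n V (f \<circ> psi)"
      using \<open>open V\<close> y T(2) by (auto simp: V_def)
  qed
qed

text \<open>One chart decides smoothness on \<open>A\<close>: in another chart, \<open>f\<close> is
  locally \<open>f \<circ> psi\<close> composed with an extension \<open>g\<close> of the transition
  map, restricted to the open set where \<open>g\<close> takes values in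
  \<open>coord A\<close>.\<close>

lemma smooth_fun_in_chart:
  assumes "openin (man_top M) A" "A \<subseteq> U"
  shows "f \<in> smooth_funs M A \<longleftrightarrow> infinitely_differentiable_on (coord A) (f \<circ> psi)"
proof
  assume "f \<in> smooth_funs M A"
  then show "infinitely_differentiable_on (coord A) (f \<circ> psi)"
    using smooth_funs_imp_infinitely_differentiable[OF assms(1)] assms(2)
    by (simp add: inf.absorb1)
next
  assume f: "infinitely_differentiable_on (coord A) (f \<circ> psi)"
  show "f \<in> smooth_funs M A"
    unfolding smooth_funs_def
  proof (clarify)
    fix V \<eta> assume V: "(V, \<eta>) \<in> man_charts M"
    interpret V: manifold_chart M V \<eta>
      using V manifold by unfold_locales
    have tr: "smooth_on (\<eta> ` (V \<inter> U)) (\<phi> \<circ> inv_into V \<eta>)"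
      using manifold V chart by (fastforce simp: smooth_manifold_def)
    show "smooth_on (\<eta> ` (A \<inter> V)) (f \<circ> inv_into V \<eta>)"
      unfolding smooth_on_def
    proof
      fix p assume p: "p \<in> \<eta> ` (A \<inter> V)"
      then have "p \<in> \<eta> ` (V \<inter> U)" using assms(2) by auto
      then obtain T g where T: "open T" "p \<in> T" "infinitely_differentiable_on T g"
        "\<forall>y\<in>\<eta> ` (V \<inter> U) \<inter> T. g y = (\<phi> \<circ> inv_into V \<eta>) y"
        using tr unfolding smooth_on_def by metis
      define O' where "O' = T \<inter> g -` coord A"
      have gx: "g (\<eta> x) = \<phi> x" if "x \<in> A" "x \<in> V" "\<eta> x \<in> T" for x
        using T(4) that assms(2) V.inj_on_chart by (auto simp: inv_into_f_f)
      have "open O'"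
        unfolding O'_def
        using continuous_open_preimage[OF infinitely_differentiable_on_continuous[OF T(3)] T(1)
            open_coord[OF assms]] .
      have "higher_differentiable_on n O' (\<lambda>y. (f \<circ> psi) (g y))" for n
        by (rule higher_differentiable_on_compose[OF \<open>open O'\<close> _ f[rule_format]
              higher_differentiable_on_subset[OF T(3)[rule_format]]]) (auto simp: O'_def)
      moreover have "p \<in> O'"
        using p gx T(2) assms(2) by (auto simp: O'_def chart_in_coord)
      moreover have "(f \<circ> psi) (g y) = (f \<circ> inv_into V \<eta>) y" if "y \<in> \<eta> ` (A \<inter> V) \<inter> O'" for y
        using that gx assms(2) V.inj_on_chart by (auto simp: O'_def psi_chart subsetD inv_into_f_f)
      ultimately show "\<exists>S h. open S \<and> p \<in> S \<and> infinitely_differentiable_on S h \<and>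
          (\<forall>y\<in>\<eta> ` (A \<inter> V) \<inter> S. h y = (f \<circ> inv_into V \<eta>) y)"
        using \<open>open O'\<close> by blast
    qed
  qed
qed

end

lemma manifold_chart_at:
  assumes "smooth_manifold M" "x \<in> points M"
  obtains U \<phi> where "manifold_chart M U \<phi>" "x \<in> U"
proof -
  have "(\<Union>(U, \<phi>)\<in>man_charts M. U) = points M"
    using assms(1) by (simp add: smooth_manifold_def)
  then obtain U \<phi> where "(U, \<phi>) \<in> man_charts M" "x \<in> U"
    using assms(2) by blast
  then show ?thesis
    using that assms(1) by (simp add: manifold_chart_def)
qed

lemma smooth_funs_local:
  assumes M: "smooth_manifold M"
    and loc: "\<And>x. x \<in> A \<Longrightarrow> \<exists>B. openin (man_top M) B \<and> x \<in> B \<and> f \<in> smooth_funs M B"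
  shows "f \<in> smooth_funs M A"
  unfolding smooth_funs_def
proof clarify
  fix V \<eta> assume V: "(V, \<eta>) \<in> man_charts M"
  interpret V: manifold_chart M V \<eta>
    using V M by unfold_locales
  show "smooth_on (\<eta> ` (A \<inter> V)) (f \<circ> inv_into V \<eta>)"
  proof (rule smooth_on_local)
    fix p assume "p \<in> \<eta> ` (A \<inter> V)"
    then obtain x where x: "x \<in> A" "x \<in> V" "p = \<eta> x" by auto
    then obtain B where B: "openin (man_top M) B" "x \<in> B" "f \<in> smooth_funs M B"
      using loc by blast
    have "smooth_on (\<eta> ` (B \<inter> V)) (f \<circ> inv_into V \<eta>)"
      using B(3) V by (auto simp: smooth_funs_def)
    moreover obtain T where "open T" "\<eta> ` (B \<inter> V) = man_model M \<inter> T"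
      using V.openin_chart_image[of "B \<inter> V"] B(1) V.openin_chart by (metis inf_le2 openin_Int openin_open)
    moreover from this have "\<eta> ` (A \<inter> V) \<inter> T \<subseteq> \<eta> ` (B \<inter> V)"
      using V.chart_in_model by auto
    ultimately show "\<exists>T. open T \<and> p \<in> T \<and> smooth_on (\<eta> ` (A \<inter> V) \<inter> T) (f \<circ> inv_into V \<eta>)"
      using x B(2) by (metis (mono_tags, lifting) Int_iff image_eqI smooth_on_subset)
  qed
qed

lemma smooth_funs_cong:
  assumes M: "smooth_manifold M" and f: "f \<in> smooth_funs M A" and eq: "\<And>x. x \<in> A \<Longrightarrow> f x = g x"
  shows "g \<in> smooth_funs M A"
  unfolding smooth_funs_def
proof clarify
  fix V \<eta> assume V: "(V, \<eta>) \<in> man_charts M"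
  interpret V: manifold_chart M V \<eta>
    using V M by unfold_locales
  have "smooth_on (\<eta> ` (A \<inter> V)) (f \<circ> inv_into V \<eta>)"
    using f V by (auto simp: smooth_funs_def)
  then show "smooth_on (\<eta> ` (A \<inter> V)) (g \<circ> inv_into V \<eta>)"
    by (rule smooth_on_cong) (use eq V.inj_on_chart in \<open>auto simp: inv_into_f_f\<close>)
qed

text \<open>The function is multiplied by a bump in the chart and extended by zero. This is smooth
  on all of \<open>M\<close> because the image \<open>K\<close> of the closed ball of radius
  \<open>2 * r\<close> is compact, hence closed in a Hausdorff space, so \<open>A\<close> and the
  complement of \<open>K\<close> form an open cover. The vanishing off \<open>A\<close> also covers
  arguments outside \<open>points M\<close>.\<close>

lemma (in manifold_chart) smooth_extension:
  assumes A: "openin (man_top M) A" "A \<subseteq> U" and a: "a \<in> A" and f: "f \<in> smooth_funs M A"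
  obtains g B where "g \<in> C_inf M" "openin (man_top M) B" "a \<in> B" "B \<subseteq> A"
    "\<And>x. x \<in> B \<Longrightarrow> g x = f x" "\<And>x. x \<notin> A \<Longrightarrow> g x = 0"
proof -
  have oA: "open (coord A)" by (rule open_coord[OF A])
  then obtain r where r: "r > 0" "cball (\<phi> a) (2 * r) \<subseteq> coord A"
  proof -
    obtain e where "e > 0" "cball (\<phi> a) e \<subseteq> coord A"
      using oA chart_in_coord[OF a A(2)] by (meson open_contains_cball)
    then show ?thesis using that[of "e / 2"] by simp
  qed
  obtain \<beta> :: "'e \<Rightarrow> real" where \<beta>: "infinitely_differentiable_on UNIV \<beta>"
    "\<And>x. dist x (\<phi> a) \<le> r \<Longrightarrow> \<beta> x = 1" "\<And>x. dist x (\<phi> a) \<ge> 2 * r \<Longrightarrow> \<beta> x = 0"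
    using infinitely_differentiable_bump[OF r(1)] by blast
  define g where "g x = (if x \<in> A then \<beta> (\<phi> x) * f x else 0)" for x
  define B where "B = {x \<in> U. \<phi> x \<in> ball (\<phi> a) r}"
  define K where "K = psi ` (cball (\<phi> a) (2 * r))"
  have KA: "K \<subseteq> A"
    using r(2) A(2) psi_in by (auto simp: K_def)
  have "compactin (man_top M) K"
    unfolding K_def
    by (rule image_compactin[OF _ continuous_map_psi])
      (use r(2) coord_mono[OF A(2)] in \<open>auto simp: compactin_subtopology\<close>)
  then have "closedin (man_top M) K"
    using Hausdorff by (simp add: compactin_imp_closedin)
  have inK: "x \<in> K" if "x \<in> U" "dist (\<phi> x) (\<phi> a) \<le> 2 * r" for x
    using that by (auto simp: K_def psi_chart image_iff dist_commute intro!: bexI[of _ "\<phi> x"])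
  have "g \<in> C_inf M"
  proof (rule smooth_funs_local[OF manifold])
    fix x assume x: "x \<in> points M"
    show "\<exists>B. openin (man_top M) B \<and> x \<in> B \<and> g \<in> smooth_funs M B"
    proof (cases "x \<in> A")
      case True
      have "higher_differentiable_on n (coord A) (\<lambda>y. \<beta> (P y) * (f \<circ> psi) y)" for n
        using smooth_fun_in_chart[OF A] f
        by (intro higher_differentiable_on_bounded_bilinear[OF bounded_bilinear_mult oA
            higher_differentiable_on_compose[OF oA subset_UNIV \<beta>(1)[rule_format]
            infinitely_differentiable_on_linear[OF bounded_linear_P, rule_format]]]) blast
      moreover have "\<beta> (P y) * (f \<circ> psi) y = (g \<circ> psi) y" if "y \<in> coord A" for y
        using that psi_in[OF that A(2)] chart_psi coord_mono[OF A(2)] by (auto simp: g_def)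
      ultimately have "higher_differentiable_on n (coord A) (g \<circ> psi)" for n
        by (rule higher_differentiable_on_transform) (use oA in auto)
      then show ?thesis
        using smooth_fun_in_chart[OF A] A(1) True by blast
    next
      case False
      have "openin (man_top M) (points M - K)"
        using \<open>closedin (man_top M) K\<close> by blast
      moreover have "g y = 0" if "y \<in> points M - K" for y
        using that inK[of y] \<beta>(3)[of "\<phi> y"] A(2) by (force simp: g_def)
      then have "g \<in> smooth_funs M (points M - K)"
        by (metis smooth_funs_cong[OF manifold smooth_funs_const])
      ultimately show ?thesis
        using False KA x by blast
    qed
  qed
  moreover have "openin (man_top M) B"
    unfolding B_def by (rule openin_chart_preimage) simp
  moreover have "a \<in> B"
    using a A r(1) by (auto simp: B_def)
  moreover have "B \<subseteq> A"
  proof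
    fix x assume x: "x \<in> B"
    then have "x \<in> K" using r(1) inK[of x] by (simp add: B_def dist_commute)
    then show "x \<in> A" using KA by auto
  qed
  moreover have "g x = f x" if "x \<in> B" for x
    using that \<open>B \<subseteq> A\<close> \<beta>(2)[of "\<phi> x"] by (auto simp: g_def B_def dist_commute)
  moreover have "g x = 0" if "x \<notin> A" for x
    using that by (simp add: g_def)
  ultimately show ?thesis using that by blast
qed

section \<open>Ordinary differential equations in Euclidean space\<close>

text \<open>On a compact convex ball the sum of the norms of the partial derivatives is bounded and
  dominates the operator norm of the derivative, so the mean value inequality applies.\<close>

lemma infinitely_differentiable_on_locally_Lipschitz:
  fixes f :: "'a::euclidean_space \<Rightarrow> 'b::real_normed_vector"
  assumes "open U" "p \<in> U" "infinitely_differentiable_on U f"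
  obtains r L where "r > 0" "L > 0" "cball p r \<subseteq> U"
    "\<And>x y. x \<in> cball p r \<Longrightarrow> y \<in> cball p r \<Longrightarrow> norm (f x - f y) \<le> L * norm (x - y)"
proof -
  obtain r where r: "r > 0" "cball p r \<subseteq> U"
    using assms by (meson open_contains_cball)
  define \<sigma> where "\<sigma> x = (\<Sum>b\<in>Basis. norm (frechet_derivative f (at x) b))" for x
  have "continuous_on (cball p r) \<sigma>"
    unfolding \<sigma>_def
    by (intro continuous_on_sum continuous_on_norm continuous_on_subset[OF
          infinitely_differentiable_on_continuous[OF infinitely_differentiable_on_derivative[OF assms(3)]] r(2)])
  then have "compact (\<sigma> ` cball p r)"
    by (rule compact_continuous_image) simp
  then obtain L where L: "\<And>x. x \<in> cball p r \<Longrightarrow> norm (\<sigma> x) \<le> L"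
    by (metis bounded_iff compact_imp_bounded imageI)
  show thesis
  proof (rule that[of r "max L 1"])
    show "max L 1 > 0" by simp
    fix x y assume xy: "x \<in> cball p r" "y \<in> cball p r"
    show "norm (f x - f y) \<le> max L 1 * norm (x - y)"
    proof (rule differentiable_bound[OF convex_cball _ _ xy])
      fix w assume w: "w \<in> cball p r"
      have D: "(f has_derivative frechet_derivative f (at w)) (at w)"
        using infinitely_differentiable_on_has_derivative[OF assms(3)] w r(2) by blast
      then show "(f has_derivative frechet_derivative f (at w)) (at w within cball p r)"
        by (rule has_derivative_at_withinI)
      have "onorm (frechet_derivative f (at w)) \<le> \<sigma> w"
        unfolding \<sigma>_def by (rule onorm_componentwise) (rule has_derivative_bounded_linear[OF D])
      then show "onorm (frechet_derivative f (at w)) \<le> max L 1"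
        using L[OF w] by simp
    qed
  qed (use r in auto)
qed

text \<open>The Picard operator is a contraction on all of \<open>{0..T}\<close> for the norm weighted by \<open>exp (- 2 L t)\<close>.\<close>

lemma Lipschitz_ode_solution:
  fixes g :: "'a::euclidean_space \<Rightarrow> 'a"
  assumes L: "L > 0" "\<And>x y. norm (g x - g y) \<le> L * norm (x - y)" and T: "T \<ge> 0"
  obtains y where "y 0 = y0"
    "\<And>t. t \<in> {0..T} \<Longrightarrow> (y has_vector_derivative g (y t)) (at t within {0..T})"
proof -
  \<comment> \<open>A retraction of the line onto \<open>{0..T}\<close>: the fixed point is sought
    in the complete space of bounded continuous functions on the whole line.\<close>
  define cl where "cl t = max 0 (min T t)" for t :: real
  have cl: "cl t \<in> {0..T}" for t using T by (auto simp: cl_def)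
  have cg: "continuous_on UNIV g"
  proof (rule continuous_at_imp_continuous_on, rule ballI)
    have "L-lipschitz_on UNIV g"
      using L by (auto simp: lipschitz_on_def dist_norm)
    then show "isCont g x" for x
      using lipschitz_on_continuous_on continuous_on_eq_continuous_at open_UNIV by blast
  qed
  \<comment> \<open>The unknown \<open>u\<close> is the solution multiplied by
    \<open>exp (- 2 * L * t)\<close>, so the plain supremum metric on \<open>u\<close> is the
    weighted one on solutions.\<close>
  define I where "I u t = y0 + integral {0..t} (\<lambda>s. g (exp (2 * L * s) *\<^sub>R apply_bcontfun u s))" for u t
  have cI0: "continuous_on {0..T} (\<lambda>s. g (exp (2 * L * s) *\<^sub>R apply_bcontfun u s))" for u
    by (intro continuous_on_compose2[OF cg] continuous_intros) auto
  have cI: "continuous_on {0..T} (I u)" for u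
    unfolding I_def
    by (intro continuous_intros indefinite_integral_continuous_1 integrable_continuous_real cI0)
  define J where "J u t = exp (- (2 * L * cl t)) *\<^sub>R I u (cl t)" for u t
  have J: "J u \<in> bcontfun" for u
  proof -
    have c: "continuous_on {0..T} (\<lambda>t. exp (- (2 * L * t)) *\<^sub>R I u t)"
      by (intro continuous_intros cI)
    have "bounded ((\<lambda>t. exp (- (2 * L * t)) *\<^sub>R I u t) ` {0..T})"
      by (rule compact_imp_bounded[OF compact_continuous_image[OF c compact_Icc]])
    then obtain B where B: "\<And>t. t \<in> {0..T} \<Longrightarrow> norm (exp (- (2 * L * t)) *\<^sub>R I u t) \<le> B"
      unfolding bounded_iff by blast
    have "continuous_on UNIV (J u)"
      unfolding J_def
      by (rule continuous_on_compose2[OF c, of UNIV cl])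
        (auto simp: cl_def[abs_def] T intro!: continuous_intros)
    then show ?thesis
      by (rule bcontfun_normI) (use B cl in \<open>auto simp: J_def\<close>)
  qed
  define \<Gamma> where "\<Gamma> u = Bcontfun (J u)" for u
  have \<Gamma>: "apply_bcontfun (\<Gamma> u) t = J u t" for u t
    using J by (simp add: \<Gamma>_def Bcontfun_inverse)
  have "dist (\<Gamma> u) (\<Gamma> v) \<le> 1/2 * dist u v" for u v
  proof (rule dist_bound)
    fix t
    let ?f = "\<lambda>u s. g (exp (2 * L * s) *\<^sub>R apply_bcontfun u s)"
    define \<tau> where "\<tau> = cl t"
    have \<tau>: "0 \<le> \<tau>" "\<tau> \<le> T" using cl[of t] by (auto simp: \<tau>_def)
    have int: "?f u integrable_on {0..\<tau>}" for u
      using \<tau> by (intro integrable_continuous_real continuous_on_subset[OF cI0]) auto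
    define d where "d = dist u v"
    \<comment> \<open>The weight exponent \<open>2 * L\<close> is twice the Lipschitz constant;
      integration divides by it, which is the origin of the contraction factor 1/2.\<close>
    have E: "((\<lambda>s. L * exp (2 * L * s) * d) has_integral
        (exp (2 * L * \<tau>) * d / 2 - exp (2 * L * 0) * d / 2)) {0..\<tau>}"
      using \<tau>
      by (intro fundamental_theorem_of_calculus)
        (auto intro!: derivative_eq_intros simp flip: has_real_derivative_iff_has_vector_derivative)
    have "norm (integral {0..\<tau>} (?f u) - integral {0..\<tau>} (?f v)) =
        norm (integral {0..\<tau>} (\<lambda>s. ?f u s - ?f v s))"
      using int by (simp add: integral_diff)
    also have "\<dots> \<le> integral {0..\<tau>} (\<lambda>s. L * exp (2 * L * s) * d)"
    proof (rule integral_norm_bound_integral)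
      fix s
      have "norm (?f u s - ?f v s) \<le> L * norm (exp (2 * L * s) *\<^sub>R apply_bcontfun u s - exp (2 * L * s) *\<^sub>R apply_bcontfun v s)"
        by (rule L)
      also have "\<dots> = L * (exp (2 * L * s) * dist (apply_bcontfun u s) (apply_bcontfun v s))"
        by (simp add: dist_norm flip: scaleR_diff_right)
      also have "\<dots> \<le> L * (exp (2 * L * s) * d)"
        using L(1) dist_bounded[of u s v] by (simp add: d_def)
      finally show "norm (?f u s - ?f v s) \<le> L * exp (2 * L * s) * d"
        by (simp add: mult.assoc)
    qed (use int E in \<open>auto intro: integrable_diff\<close>)
    also have "\<dots> = exp (2 * L * \<tau>) * d / 2 - d / 2"
      unfolding integral_unique[OF E] by simp
    also have "\<dots> \<le> exp (2 * L * \<tau>) * d / 2"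
      by (simp add: d_def)
    finally have *: "norm (integral {0..\<tau>} (?f u) - integral {0..\<tau>} (?f v)) \<le> exp (2 * L * \<tau>) * d / 2" .
    have "dist (J u t) (J v t) = exp (- (2 * L * \<tau>)) * norm (integral {0..\<tau>} (?f u) - integral {0..\<tau>} (?f v))"
      by (simp add: J_def I_def dist_norm \<tau>_def flip: scaleR_diff_right)
    also have "\<dots> \<le> exp (- (2 * L * \<tau>)) * (exp (2 * L * \<tau>) * d / 2)"
      by (rule mult_left_mono[OF *]) simp
    also have "\<dots> = d / 2"
      by (simp flip: exp_add mult.assoc)
    finally show "dist (apply_bcontfun (\<Gamma> u) t) (apply_bcontfun (\<Gamma> v) t) \<le> 1/2 * dist u v"
      by (simp add: \<Gamma> d_def)
  qed
  then obtain u where u: "\<Gamma> u = u"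
    using banach_fix_type[of "1/2" \<Gamma>] by auto
  define y where "y t = exp (2 * L * t) *\<^sub>R apply_bcontfun u t" for t
  have y: "y t = y0 + integral {0..t} (\<lambda>s. g (y s))" if "t \<in> {0..T}" for t
  proof -
    have "cl t = t" using that by (auto simp: cl_def)
    then have "apply_bcontfun u t = exp (- (2 * L * t)) *\<^sub>R I u t"
      using \<Gamma>[of u t] u by (simp add: J_def)
    then show ?thesis
      by (simp add: y_def I_def flip: exp_add)
  qed
  show thesis
  proof
    show "y 0 = y0" using y[of 0] T by simp
    fix t assume t: "t \<in> {0..T}"
    have "((\<lambda>t. y0 + integral {0..t} (\<lambda>s. g (y s))) has_vector_derivative g (y t)) (at t within {0..T})"
      using integral_has_vector_derivative[OF cI0[of u, folded y_def] t]
      by (auto intro!: derivative_eq_intros)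
    then show "(y has_vector_derivative g (y t)) (at t within {0..T})"
      by (rule has_vector_derivative_transform[OF t, rotated]) (rule y)
  qed
qed

section \<open>Derivations\<close>

text \<open>Covers at once tangent vectors, values of vector fields, and Hamiltonian vector fields; they
  differ in the space \<open>S\<close> of functions on which they act.\<close>

definition derivation_at ::
  "('a, 'e::euclidean_space) manifold \<Rightarrow> 'a \<Rightarrow> ('a \<Rightarrow> real) set \<Rightarrow> (('a \<Rightarrow> real) \<Rightarrow> real) \<Rightarrow> bool" where
  "derivation_at M a S D \<longleftrightarrow> smooth_manifold M \<and> a \<in> points M \<and> C_inf M \<subseteq> S \<and> S \<subseteq> smooth_near M a \<and>
     (\<forall>f\<in>S. \<forall>g\<in>S. (\<lambda>x. f x + g x) \<in> S \<and> D (\<lambda>x. f x + g x) = D f + D g) \<and>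
     (\<forall>c. \<forall>f\<in>S. D (\<lambda>x. c * f x) = c * D f) \<and>
     (\<forall>f\<in>S. \<forall>g\<in>S. (\<lambda>x. f x * g x) \<in> S \<and> D (\<lambda>x. f x * g x) = f a * D g + D f * g a)"

lemma C_inf_subset_smooth_near: "a \<in> points M \<Longrightarrow> C_inf M \<subseteq> smooth_near M a"
  by (auto simp: smooth_near_def)

lemma smooth_near_common:
  assumes "f \<in> smooth_near M a" "g \<in> smooth_near M a"
  obtains A where "openin (man_top M) A" "a \<in> A" "f \<in> smooth_funs M A" "g \<in> smooth_funs M A"
proof -
  obtain A B where "openin (man_top M) A" "a \<in> A" "f \<in> smooth_funs M A"
    "openin (man_top M) B" "a \<in> B" "g \<in> smooth_funs M B"
    using assms by (auto simp: smooth_near_def)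
  then show thesis
    by (intro that[of "A \<inter> B"]) (auto intro: smooth_funs_subset)
qed

lemma smooth_near_add:
  "f \<in> smooth_near M a \<Longrightarrow> g \<in> smooth_near M a \<Longrightarrow> (\<lambda>x. f x + g x) \<in> smooth_near M a"
  by (erule (1) smooth_near_common) (auto simp: smooth_near_def intro: smooth_funs_add)

lemma smooth_near_mult:
  "f \<in> smooth_near M a \<Longrightarrow> g \<in> smooth_near M a \<Longrightarrow> (\<lambda>x. f x * g x) \<in> smooth_near M a"
  by (erule (1) smooth_near_common) (auto simp: smooth_near_def intro: smooth_funs_mult)

lemma tangent_space_derivation:
  assumes "smooth_manifold M" "a \<in> points M" "v \<in> tangent_space M a"
  shows "derivation_at M a (smooth_near M a) v"
  using assms C_inf_subset_smooth_near[OF assms(2)]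
  by (auto simp: derivation_at_def tangent_space_def smooth_near_add smooth_near_mult)

lemma vector_field_derivation:
  assumes "smooth_manifold M" "vector_field_on M A X" "a \<in> A"
  shows "derivation_at M a (smooth_funs M A) (\<lambda>f. X f a)"
proof -
  have "openin (man_top M) A" using assms(2) by (simp add: vector_field_on_def)
  then show ?thesis
    using assms openin_subset[of "man_top M" A] C_inf_subset_smooth_funs[of M A]
    by (auto simp: derivation_at_def vector_field_on_def smooth_funs_add smooth_funs_mult smooth_near_def)
qed

lemma (in poisson_manifold) hamiltonian_vector_field:
  "H \<in> C_inf M \<Longrightarrow> vector_field_on M (points M) (hamiltonian_vf br H)"
  by (simp add: vector_field_on_def hamiltonian_vf_def br_smooth br_add br_scale br_leibniz)

context
  fixes M :: "('a, 'e::euclidean_space) manifold" and a S D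
  assumes der: "derivation_at M a S D"
begin

lemma derivation_add: "f \<in> S \<Longrightarrow> g \<in> S \<Longrightarrow> D (\<lambda>x. f x + g x) = D f + D g"
  and derivation_scale: "f \<in> S \<Longrightarrow> D (\<lambda>x. c * f x) = c * D f"
  and derivation_mult: "f \<in> S \<Longrightarrow> g \<in> S \<Longrightarrow> D (\<lambda>x. f x * g x) = f a * D g + D f * g a"
  and derivation_C_inf: "f \<in> C_inf M \<Longrightarrow> f \<in> S"
  and derivation_closed_add: "f \<in> S \<Longrightarrow> g \<in> S \<Longrightarrow> (\<lambda>x. f x + g x) \<in> S"
  and derivation_closed_mult: "f \<in> S \<Longrightarrow> g \<in> S \<Longrightarrow> (\<lambda>x. f x * g x) \<in> S"
  using der by (auto simp: derivation_at_def)

lemma derivation_const: "D (\<lambda>x. c) = 0"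
proof -
  have 1: "(\<lambda>x. 1) \<in> S" by (intro derivation_C_inf smooth_funs_const)
  have "D (\<lambda>x. 1) = 0"
    using derivation_mult[OF 1 1] by simp
  then show ?thesis
    using derivation_scale[OF 1, of c] by simp
qed

lemma derivation_diff:
  assumes "f \<in> S" "g \<in> S"
  shows "(\<lambda>x. f x - g x) \<in> S" "D (\<lambda>x. f x - g x) = D f - D g"
proof -
  have "(\<lambda>x. (-1) * g x) \<in> S"
    by (intro derivation_closed_mult derivation_C_inf smooth_funs_const assms)
  then show "(\<lambda>x. f x - g x) \<in> S" "D (\<lambda>x. f x - g x) = D f - D g"
    using derivation_closed_add[OF assms(1), of "\<lambda>x. (-1) * g x"]
      derivation_add[OF assms(1), of "\<lambda>x. (-1) * g x"] derivation_scale[OF assms(2), of "-1"] by auto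
qed

lemma derivation_sum:
  assumes "finite I"
  shows "(\<And>i. i \<in> I \<Longrightarrow> f i \<in> S) \<Longrightarrow> (\<lambda>x. \<Sum>i\<in>I. f i x) \<in> S \<and> D (\<lambda>x. \<Sum>i\<in>I. f i x) = (\<Sum>i\<in>I. D (f i))"
  using assms
  by (induction I rule: finite_induct)
    (auto simp: derivation_const derivation_add derivation_closed_add intro: derivation_C_inf smooth_funs_const)

text \<open>Take a bump \<open>c\<close> that is 1 near \<open>a\<close> and vanishes off the set
  where \<open>f\<close> and \<open>g\<close> agree. Then \<open>d = f - g\<close> equals
  \<open>d * (1 - c)\<close>, both factors vanish at \<open>a\<close>, and the Leibniz rule gives
  \<open>D d = 0\<close>.\<close>

lemma derivation_local:
  assumes "f \<in> S" "g \<in> S" "openin (man_top M) B" "a \<in> B" "\<And>x. x \<in> B \<Longrightarrow> f x = g x"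
  shows "D f = D g"
proof -
  have M: "smooth_manifold M" "a \<in> points M"
    using der by (auto simp: derivation_at_def)
  obtain U \<phi> where "manifold_chart M U \<phi>" and aU: "a \<in> U"
    using manifold_chart_at[OF M] by blast
  then interpret manifold_chart M U \<phi> by simp
  have "openin (man_top M) (B \<inter> U)" "B \<inter> U \<subseteq> U" "a \<in> B \<inter> U"
    using assms openin_chart aU by auto
  then obtain c W where c: "c \<in> C_inf M" "a \<in> W" "\<And>x. x \<in> W \<Longrightarrow> c x = (1::real)"
    "\<And>x. x \<notin> B \<inter> U \<Longrightarrow> c x = 0"
    by (rule smooth_extension[OF _ _ _ smooth_funs_const[of "1::real"]]) blast
  define d where "d x = f x - g x" for x
  define e where "e x = 1 - c x" for x
  have S: "d \<in> S" "e \<in> S" and Dd: "D d = D f - D g"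
    using derivation_diff[OF assms(1,2)] derivation_diff[OF derivation_C_inf[OF smooth_funs_const[of 1]] derivation_C_inf[OF c(1)]]
    by (simp_all add: d_def[abs_def] e_def[abs_def])
  \<comment> \<open>An identity of total functions: \<open>D\<close> is not known to ignore values outside \<open>points M\<close>.\<close>
  have "d x = d x * e x" for x
    using c(4)[of x] assms(5)[of x] by (cases "x \<in> B \<inter> U") (auto simp: d_def e_def)
  then have "d = (\<lambda>x. d x * e x)" by blast
  then have "D d = d a * D e + D d * e a"
    using derivation_mult[OF S] by metis
  also have "\<dots> = 0"
    using c(2,3) assms(4,5) by (simp add: d_def e_def)
  finally show ?thesis using Dd by simp
qed

end

context manifold_chart
begin

lemma open_coord_chart: "open (coord U)"
  by (rule open_coord[OF openin_chart order_refl])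

lemma smooth_coordinate: "(\<lambda>x. \<phi> x \<bullet> b) \<in> smooth_funs M U"
proof -
  have "higher_differentiable_on n (coord U) (\<lambda>y. P y \<bullet> b)" for n
    by (rule infinitely_differentiable_on_linear[rule_format])
      (intro bounded_linear_intros bounded_linear_compose[OF bounded_linear_inner_left bounded_linear_P])
  then have "higher_differentiable_on n (coord U) ((\<lambda>x. \<phi> x \<bullet> b) \<circ> psi)" for n
    by (rule higher_differentiable_on_transform) (auto simp: chart_psi open_coord_chart)
  then show ?thesis
    by (simp add: smooth_fun_in_chart[OF openin_chart order_refl])
qed

text \<open>A derivation is guaranteed to act on \<open>C_inf M\<close> only, so the chart
  coordinates are replaced by global functions that coincide with them on \<open>B\<close>.\<close>

definition local_coordinates :: "('e \<Rightarrow> 'a \<Rightarrow> real) \<Rightarrow> 'a set \<Rightarrow> bool" where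
  "local_coordinates \<xi> B \<longleftrightarrow> openin (man_top M) B \<and> B \<subseteq> U \<and>
     (\<forall>b\<in>Basis. \<xi> b \<in> C_inf M \<and> (\<forall>x\<in>B. \<xi> b x = \<phi> x \<bullet> b))"

lemma local_extensions:
  assumes "finite I" and A: "openin (man_top M) A" "A \<subseteq> U" "a \<in> A"
    and f: "\<And>i. i \<in> I \<Longrightarrow> f i \<in> smooth_funs M A"
  obtains g B where "openin (man_top M) B" "a \<in> B" "B \<subseteq> A"
    "\<And>i. i \<in> I \<Longrightarrow> g i \<in> C_inf M" "\<And>i x. i \<in> I \<Longrightarrow> x \<in> B \<Longrightarrow> g i x = f i x"
proof -
  have "\<forall>i\<in>I. \<exists>g B. g \<in> C_inf M \<and> openin (man_top M) B \<and> a \<in> B \<and> (\<forall>x\<in>B. g x = f i x)"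
  proof
    fix i assume i: "i \<in> I"
    show "\<exists>g B. g \<in> C_inf M \<and> openin (man_top M) B \<and> a \<in> B \<and> (\<forall>x\<in>B. g x = f i x)"
      by (rule smooth_extension[OF A f[OF i]]) blast
  qed
  then obtain g B where gB: "\<And>i. i \<in> I \<Longrightarrow> g i \<in> C_inf M \<and> openin (man_top M) (B i) \<and> a \<in> B i \<and>
      (\<forall>x\<in>B i. g i x = f i x)"
    by metis
  show thesis
  proof (rule that[of "A \<inter> (\<Inter>i\<in>I. B i)" g])
    show "openin (man_top M) (A \<inter> (\<Inter>i\<in>I. B i))"
      using assms(1) A(1) gB
      by (cases "I = {}") (auto intro!: openin_Int openin_INT2)
  qed (use gB A(3) in auto)
qed

lemma local_coordinates_exist:
  assumes "a \<in> U"
  obtains \<xi> B where "local_coordinates \<xi> B" "a \<in> B"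
proof (rule local_extensions[OF finite_Basis openin_chart order_refl assms, of "\<lambda>b x. \<phi> x \<bullet> b"])
  fix \<xi> B
  assume "openin (man_top M) B" "a \<in> B" "B \<subseteq> U" "\<And>b. b \<in> Basis \<Longrightarrow> \<xi> b \<in> C_inf M"
    "\<And>b x. b \<in> Basis \<Longrightarrow> x \<in> B \<Longrightarrow> \<xi> b x = \<phi> x \<bullet> b"
  then show thesis
    by (intro that[of \<xi> B]) (auto simp: local_coordinates_def)
qed (rule smooth_coordinate)

text \<open>By Hadamard's lemma \<open>f\<close> is near \<open>a\<close> a constant plus the sum of
  \<open>(\<xi> b x - \<xi> b a) * k b x\<close>, where \<open>k b\<close> extends a Hadamard
  coefficient to a global function. The first factor vanishes at \<open>a\<close>, so the Leibniz
  rule leaves \<open>D (\<xi> b)\<close> times \<open>k b a\<close>, which is the partial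
  derivative.\<close>

lemma derivation_formula:
  assumes der: "derivation_at M a S D" and \<xi>: "local_coordinates \<xi> B" and a: "a \<in> B" and f: "f \<in> S"
  shows "D f = (\<Sum>b\<in>Basis. D (\<xi> b) * frechet_derivative (f \<circ> psi) (at (\<phi> a)) b)"
proof -
  have B: "openin (man_top M) B" "B \<subseteq> U" using \<xi> by (auto simp: local_coordinates_def)
  have aU: "a \<in> U" using a B by auto
  have "f \<in> smooth_near M a"
    using f der by (auto simp: derivation_at_def)
  then obtain A0 where A0: "openin (man_top M) A0" "a \<in> A0" "f \<in> smooth_funs M A0"
    by (auto simp: smooth_near_def)
  define A where "A = A0 \<inter> B"
  have A: "openin (man_top M) A" "A \<subseteq> U" "a \<in> A"
    using A0 B a by (auto simp: A_def)
  have smF: "infinitely_differentiable_on (coord A) (f \<circ> psi)"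
    using smooth_fun_in_chart[OF A(1,2)] A0(3) smooth_funs_subset[of f M A0 A] by (auto simp: A_def)
  obtain r where r: "r > 0" "ball (\<phi> a) r \<subseteq> coord A"
    using open_coord[OF A(1,2)] chart_in_coord[OF A(3,2)] by (meson open_contains_ball)
  have ctr: "\<phi> a \<in> ball (\<phi> a) r" using r(1) by simp
  have smB: "infinitely_differentiable_on (ball (\<phi> a) r) (f \<circ> psi)"
    using higher_differentiable_on_subset[OF smF[rule_format] r(2)] by blast
  obtain h :: "'e \<Rightarrow> 'e \<Rightarrow> real" where h:
    "\<And>b. infinitely_differentiable_on (ball (\<phi> a) r) (h b)"
    "\<And>b. h b (\<phi> a) = frechet_derivative (f \<circ> psi) (at (\<phi> a)) b"
    "\<And>y. y \<in> ball (\<phi> a) r \<Longrightarrow> (f \<circ> psi) y = (f \<circ> psi) (\<phi> a) + (\<Sum>b\<in>Basis. ((y - \<phi> a) \<bullet> b) * h b y)"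
    by (rule hadamard[OF open_ball convex_ball ctr smB], rule that) blast+
  define C where "C = {x \<in> U. \<phi> x \<in> ball (\<phi> a) r}"
  have C: "openin (man_top M) C" "C \<subseteq> U" "a \<in> C"
    using openin_chart_preimage[OF open_ball] aU r(1) by (auto simp: C_def)
  have "(\<lambda>x. h b (\<phi> x)) \<in> smooth_funs M C" for b
  proof -
    have PC: "P ` coord C \<subseteq> ball (\<phi> a) r"
      by (auto simp: coord_def C_def)
    have "higher_differentiable_on n (coord C) (\<lambda>y. h b (P y))" for n
      by (rule higher_differentiable_on_compose[OF open_coord[OF C(1,2)] PC h(1)[rule_format]
            infinitely_differentiable_on_linear[OF bounded_linear_P, rule_format]])
    then have "higher_differentiable_on n (coord C) ((\<lambda>x. h b (\<phi> x)) \<circ> psi)" for n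
      by (rule higher_differentiable_on_transform)
        (use chart_psi coord_mono[OF C(2)] open_coord[OF C(1,2)] in auto)
    then show ?thesis
      by (simp add: smooth_fun_in_chart[OF C(1,2)])
  qed
  then obtain k N where N: "openin (man_top M) N" "a \<in> N" "N \<subseteq> C"
    "\<And>b. b \<in> Basis \<Longrightarrow> k b \<in> C_inf M" "\<And>b x. b \<in> Basis \<Longrightarrow> x \<in> N \<Longrightarrow> k b x = h b (\<phi> x)"
    using local_extensions[OF finite_Basis C, of "\<lambda>b x. h b (\<phi> x)"] by metis
  note [simp] = derivation_C_inf[OF der]
  define q where "q b x = (\<xi> b x - \<xi> b a) * k b x" for b x
  have \<xi>C: "\<xi> b \<in> C_inf M" "x \<in> B \<Longrightarrow> \<xi> b x = \<phi> x \<bullet> b" if "b \<in> Basis" for b x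
    using \<xi> that by (auto simp: local_coordinates_def)
  have q: "q b \<in> S" "D (q b) = D (\<xi> b) * h b (\<phi> a)" if b: "b \<in> Basis" for b
  proof -
    have 1: "(\<lambda>x. \<xi> b x - \<xi> b a) \<in> S" "D (\<lambda>x. \<xi> b x - \<xi> b a) = D (\<xi> b)"
      using derivation_diff[OF der, of "\<xi> b" "\<lambda>x. \<xi> b a"] \<xi>C(1)[OF b]
      by (simp_all add: smooth_funs_const derivation_const[OF der])
    have 2: "k b \<in> S" using N(4)[OF b] by simp
    show "q b \<in> S" "D (q b) = D (\<xi> b) * h b (\<phi> a)"
      using derivation_closed_mult[OF der 1(1) 2] derivation_mult[OF der 1(1) 2] 1(2) N(2,5) b
      by (auto simp: q_def[abs_def])
  qed
  have sq: "(\<lambda>x. \<Sum>b\<in>Basis. q b x) \<in> S" "D (\<lambda>x. \<Sum>b\<in>Basis. q b x) = (\<Sum>b\<in>Basis. D (q b))"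
    using derivation_sum[OF der finite_Basis, of q] q by auto
  have "D f = D (\<lambda>x. f a + (\<Sum>b\<in>Basis. q b x))"
  proof (rule derivation_local[OF der f _ openin_Int[OF N(1) B(1)]])
    show "(\<lambda>x. f a + (\<Sum>b\<in>Basis. q b x)) \<in> S"
      by (rule derivation_closed_add[OF der _ sq(1)]) (simp add: smooth_funs_const)
    show "f x = f a + (\<Sum>b\<in>Basis. q b x)" if "x \<in> N \<inter> B" for x
    proof -
      have x: "x \<in> U" "\<phi> x \<in> ball (\<phi> a) r" using that N(3) by (auto simp: C_def)
      then have "f x = f a + (\<Sum>b\<in>Basis. ((\<phi> x - \<phi> a) \<bullet> b) * h b (\<phi> x))"
        using h(3)[OF x(2)] aU by (simp add: psi_chart)
      also have "(\<Sum>b\<in>Basis. ((\<phi> x - \<phi> a) \<bullet> b) * h b (\<phi> x)) = (\<Sum>b\<in>Basis. q b x)"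
        using that a by (intro sum.cong) (simp_all add: q_def \<xi>C N(5) inner_diff_left)
      finally show ?thesis .
    qed
  qed (use N a in auto)
  also have "\<dots> = (\<Sum>b\<in>Basis. D (q b))"
    using derivation_add[OF der _ sq(1), of "\<lambda>x. f a"] sq(2)
    by (simp add: smooth_funs_const derivation_const[OF der])
  also have "\<dots> = (\<Sum>b\<in>Basis. D (\<xi> b) * frechet_derivative (f \<circ> psi) (at (\<phi> a)) b)"
    by (intro sum.cong) (auto simp: q h(2))
  finally show ?thesis .
qed

end

section \<open>Integral curves and flows\<close>

locale flow_field =
  fixes M :: "('a, 'e::euclidean_space) manifold" and X :: "('a \<Rightarrow> real) \<Rightarrow> 'a \<Rightarrow> real"
  assumes manifold: "smooth_manifold M" and field: "vector_field_on M (points M) X"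
begin

lemma field_derivation: "x \<in> points M \<Longrightarrow> derivation_at M x (C_inf M) (\<lambda>f. X f x)"
  using vector_field_derivation[OF manifold field] .

lemma field_C_inf: "f \<in> C_inf M \<Longrightarrow> X f \<in> C_inf M"
  using field by (simp add: vector_field_on_def)

lemma integral_curve_in_points: "integral_curve M X c I \<Longrightarrow> t \<in> I \<Longrightarrow> c t \<in> points M"
  by (auto simp: integral_curve_def continuous_map_def)

lemma integral_curve_has_derivative:
  "integral_curve M X c I \<Longrightarrow> t \<in> I \<Longrightarrow> f \<in> C_inf M \<Longrightarrow>
    ((\<lambda>s. f (c s)) has_real_derivative X f (c t)) (at t within I)"
  by (simp add: integral_curve_def)

lemma integral_curve_subset: "integral_curve M X c I \<Longrightarrow> J \<subseteq> I \<Longrightarrow> integral_curve M X c J"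
  unfolding integral_curve_def
  by (meson DERIV_subset continuous_map_from_subtopology_mono subsetD)

lemma integral_curve_shift:
  assumes "integral_curve M X c {p..q}"
  shows "integral_curve M X (\<lambda>t. c (t + a)) {p - a..q - a}"
  unfolding integral_curve_def
proof (intro conjI ballI)
  have "continuous_map (top_of_set {p - a..q - a}) (top_of_set {p..q}) (\<lambda>t. t + a)"
    by (auto simp: continuous_map_in_subtopology intro!: continuous_intros)
  moreover have "continuous_map (top_of_set {p..q}) (man_top M) c"
    using assms by (simp add: integral_curve_def)
  ultimately have "continuous_map (top_of_set {p - a..q - a}) (man_top M) (c \<circ> (\<lambda>t. t + a))"
    by (rule continuous_map_compose)
  then show "continuous_map (top_of_set {p - a..q - a}) (man_top M) (\<lambda>t. c (t + a))"
    by (simp add: comp_def)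
next
  fix t f assume t: "t \<in> {p - a..q - a}" and f: "f \<in> C_inf M"
  have img: "(\<lambda>t. t + a) ` {p - a..q - a} \<subseteq> {p..q}" by auto
  have "((\<lambda>s. f (c s)) has_real_derivative X f (c (t + a))) (at (t + a) within (\<lambda>t. t + a) ` {p - a..q - a})"
    using integral_curve_has_derivative[OF assms _ f, of "t + a"] t
    by (intro DERIV_subset[OF _ img]) auto
  then have "((\<lambda>s. f (c s)) \<circ> (\<lambda>t. t + a) has_real_derivative X f (c (t + a)) * 1) (at t within {p - a..q - a})"
    by (rule DERIV_image_chain) (auto intro!: derivative_eq_intros)
  then show "((\<lambda>s. f (c (s + a))) has_real_derivative X f (c (t + a))) (at t within {p - a..q - a})"
    by (simp add: comp_def)
qed

text \<open>At the junction both one-sided derivatives equal \<open>X f (c q)\<close>, so the limit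
  within the union of the intervals exists. At other points the filter of one of the intervals is
  trivial.\<close>

lemma integral_curve_concat:
  assumes c: "integral_curve M X c {p..q}" and d: "integral_curve M X d {q..r}"
    and pqr: "p \<le> q" "q \<le> r" and eq: "c q = d q"
  shows "integral_curve M X (\<lambda>t. if t \<le> q then c t else d t) {p..r}"
    (is "integral_curve M X ?e _")
  unfolding integral_curve_def
proof (intro conjI ballI)
  have 1: "{x \<in> {p..r}. x \<le> q} = {p..q}" "{x \<in> {p..r}. q \<le> x} = {q..r}"
    using pqr by auto
  show "continuous_map (top_of_set {p..r}) (man_top M) ?e"
    using c d eq 1 pqr
    by (intro continuous_map_cases_le)
      (auto simp: subtopology_subtopology integral_curve_def Int_absorb1 intro!: continuous_map_into_fulltopology)
next
  fix t f assume t: "t \<in> {p..r}" and f: "f \<in> C_inf M"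
  have un: "{p..r} = {p..q} \<union> {q..r}" using pqr by auto
  have A: "((\<lambda>y. (f (?e y) - f (?e t)) / (y - t)) \<longlongrightarrow> X f (?e t)) (at t within {p..q})"
  proof (cases "t \<le> q")
    case True
    have "((\<lambda>s. f (?e s)) has_real_derivative X f (c t)) (at t within {p..q})"
      using integral_curve_has_derivative[OF c _ f, of t] True t
      by (rule_tac has_field_derivative_transform_within[where d = 1]) auto
    then show ?thesis using True by (simp add: has_field_derivative_iff)
  next
    case False
    then have "at t within {p..q} = bot"
      by (simp add: at_within_eq_bot_iff)
    then show ?thesis by simp
  qed
  have B: "((\<lambda>y. (f (?e y) - f (?e t)) / (y - t)) \<longlongrightarrow> X f (?e t)) (at t within {q..r})"
  proof (cases "q \<le> t")
    case True
    have ed: "?e s = d s" if "q \<le> s" for s using that eq by auto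
    have "((\<lambda>s. f (?e s)) has_real_derivative X f (d t)) (at t within {q..r})"
    proof (rule has_field_derivative_transform_within[where d = 1])
      show "((\<lambda>s. f (d s)) has_real_derivative X f (d t)) (at t within {q..r})"
        using integral_curve_has_derivative[OF d _ f, of t] True t by auto
      show "f (d s) = f (?e s)" if "s \<in> {q..r}" for s
      proof -
        have "?e s = d s" using that by (intro ed) simp
        then show ?thesis by (simp only:)
      qed
    qed (use True t in auto)
    then show ?thesis by (simp only: has_field_derivative_iff ed[OF True])
  next
    case False
    then have "at t within {q..r} = bot"
      by (simp add: at_within_eq_bot_iff)
    then show ?thesis by simp
  qed
  show "((\<lambda>s. f (?e s)) has_real_derivative X f (?e t)) (at t within {p..r})"
    unfolding has_field_derivative_iff un Lim_within_Un using A B by blast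
qed

end

locale flow_chart = flow_field M X + manifold_chart M U \<phi>
  for M :: "('a, 'e::euclidean_space) manifold" and X U \<phi>
begin

text \<open>Since the components use the globally extended coordinates, this represents
  \<open>X\<close> over \<open>B\<close> only; over the rest of \<open>U\<close> it is merely some
  smooth map. Evaluation at \<open>psi y\<close> makes it depend on \<open>P y\<close>
  alone.\<close>

definition chart_field :: "('e \<Rightarrow> 'a \<Rightarrow> real) \<Rightarrow> 'e \<Rightarrow> 'e" where
  "chart_field \<xi> y = (\<Sum>b\<in>Basis. X (\<xi> b) (psi y) *\<^sub>R b)"

lemma infinitely_differentiable_chart_field:
  assumes "local_coordinates \<xi> B"
  shows "infinitely_differentiable_on (coord U) (chart_field \<xi>)"
proof
  fix n
  have "higher_differentiable_on n (coord U) (\<lambda>y. \<Sum>b\<in>Basis. (X (\<xi> b) \<circ> psi) y *\<^sub>R b)"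
  proof (rule higher_differentiable_on_sum[OF open_coord_chart])
    fix b :: 'e assume "b \<in> Basis"
    then have "X (\<xi> b) \<in> C_inf M"
      using assms field_C_inf by (simp add: local_coordinates_def)
    then have "X (\<xi> b) \<in> smooth_funs M U"
      by (rule smooth_funs_subset[OF _ chart_subset_points])
    then have "higher_differentiable_on n (coord U) (X (\<xi> b) \<circ> psi)"
      using smooth_fun_in_chart[OF openin_chart order_refl] by blast
    then show "higher_differentiable_on n (coord U) (\<lambda>y. (X (\<xi> b) \<circ> psi) y *\<^sub>R b)"
      by (rule higher_differentiable_on_bounded_linear_comp[OF bounded_linear_scaleR_left open_coord_chart])
  qed
  then show "higher_differentiable_on n (coord U) (chart_field \<xi>)"
    by (simp add: chart_field_def[abs_def])
qed

lemma differentiable_in_chart: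
  assumes "f \<in> C_inf M" "y \<in> coord U"
  shows "(f \<circ> psi) differentiable (at y)"
  using smooth_fun_in_chart[OF openin_chart order_refl] smooth_funs_subset[OF assms(1) chart_subset_points]
    infinitely_differentiable_on_differentiable assms(2) by blast

lemma field_in_chart:
  assumes "local_coordinates \<xi> B" "x \<in> B" "f \<in> C_inf M"
  shows "X f x = frechet_derivative (f \<circ> psi) (at (\<phi> x)) (chart_field \<xi> (\<phi> x))"
proof -
  have x: "x \<in> U" "x \<in> points M"
    using assms(1,2) chart_subset_points by (auto simp: local_coordinates_def)
  have "X f x = (\<Sum>b\<in>Basis. X (\<xi> b) x * frechet_derivative (f \<circ> psi) (at (\<phi> x)) b)"
    by (rule derivation_formula[OF field_derivation[OF x(2)] assms])
  also have "\<dots> = frechet_derivative (f \<circ> psi) (at (\<phi> x)) (chart_field \<xi> (\<phi> x))"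
    using differentiable_in_chart[OF assms(3) chart_in_coord[OF x(1) order_refl]]
    by (subst frechet_derivative_euclidean_sum) (simp_all add: chart_field_def psi_chart[OF x(1)])
  finally show ?thesis .
qed

text \<open>An integral curve is known only through global functions; on \<open>B\<close> the
  functions \<open>\<xi> b\<close> recover its coordinates.\<close>

lemma integral_curve_in_chart:
  assumes \<xi>: "local_coordinates \<xi> B" and c: "integral_curve M X c I" and cB: "c ` I \<subseteq> B" and t: "t \<in> I"
  shows "((\<lambda>s. \<phi> (c s)) has_vector_derivative chart_field \<xi> (\<phi> (c t))) (at t within I)"
proof -
  have eq: "\<phi> (c s) = (\<Sum>b\<in>Basis. \<xi> b (c s) *\<^sub>R b)" if "s \<in> I" for s
  proof -
    have "(\<Sum>b\<in>Basis. \<xi> b (c s) *\<^sub>R b) = (\<Sum>b\<in>Basis. (\<phi> (c s) \<bullet> b) *\<^sub>R b)"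
      using \<xi> cB that by (intro sum.cong) (auto simp: local_coordinates_def)
    then show ?thesis by (simp add: euclidean_representation)
  qed
  have "((\<lambda>s. \<Sum>b\<in>Basis. \<xi> b (c s) *\<^sub>R b) has_vector_derivative (\<Sum>b\<in>Basis. X (\<xi> b) (c t) *\<^sub>R b)) (at t within I)"
  proof (rule has_vector_derivative_sum)
    fix b :: 'e assume "b \<in> Basis"
    then have "((\<lambda>s. \<xi> b (c s)) has_real_derivative X (\<xi> b) (c t)) (at t within I)"
      using \<xi> by (intro integral_curve_has_derivative[OF c t]) (auto simp: local_coordinates_def)
    from has_vector_derivative_scaleR[OF this has_vector_derivative_const]
    show "((\<lambda>s. \<xi> b (c s) *\<^sub>R b) has_vector_derivative X (\<xi> b) (c t) *\<^sub>R b) (at t within I)"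
      by simp
  qed
  moreover have "(\<Sum>b\<in>Basis. X (\<xi> b) (c t) *\<^sub>R b) = chart_field \<xi> (\<phi> (c t))"
  proof -
    have "c t \<in> U" using \<xi> cB t by (auto simp: local_coordinates_def)
    then show ?thesis by (simp add: chart_field_def psi_chart)
  qed
  ultimately show ?thesis
    by (metis (no_types, lifting) has_vector_derivative_transform[OF t] eq)
qed

end

lemma vector_derivative_bound:
  fixes f :: "real \<Rightarrow> 'a::real_normed_vector"
  assumes "convex S" "\<And>t. t \<in> S \<Longrightarrow> (f has_vector_derivative f' t) (at t within S)"
    "\<And>t. t \<in> S \<Longrightarrow> norm (f' t) \<le> B" "s \<in> S" "t \<in> S"
  shows "norm (f s - f t) \<le> B * \<bar>s - t\<bar>"
proof -
  have "onorm (\<lambda>h. h *\<^sub>R f' t) \<le> B" if "t \<in> S" for t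
  proof (rule onorm_le)
    fix h show "norm (h *\<^sub>R f' t) \<le> B * norm h"
      using mult_right_mono[OF assms(3)[OF that], of "\<bar>h\<bar>"] by (simp add: mult.commute)
  qed
  then show ?thesis
    using differentiable_bound[OF assms(1), of f "\<lambda>t h. h *\<^sub>R f' t"] assms
    by (simp add: has_vector_derivative_def)
qed

section \<open>Uniqueness of integral curves and semigroup property of the flow\<close>

context flow_field
begin

text \<open>Near \<open>t0\<close> both curves lie in a coordinate ball where the field is
  Lipschitz. The mean value inequality bounds the largest coordinate difference on a short interval
  by half of itself, so it is zero.\<close>

lemma integral_curve_locally_unique:
  assumes c: "integral_curve M X c {p..q}" and d: "integral_curve M X d {p..q}"
    and t0: "t0 \<in> {p..q}" and eq: "c t0 = d t0"
  obtains e where "e > 0" "\<And>t. t \<in> {p..q} \<Longrightarrow> \<bar>t - t0\<bar> < e \<Longrightarrow> c t = d t"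
proof -
  define a where "a = c t0"
  have "a \<in> points M" using integral_curve_in_points[OF c t0] by (simp add: a_def)
  then obtain U \<phi> where ch: "manifold_chart M U \<phi>" and aU: "a \<in> U"
    using manifold_chart_at[OF manifold] by metis
  interpret flow_chart M X U \<phi>
    by (intro flow_chart.intro ch flow_field_axioms)
  obtain \<xi> B where \<xi>: "local_coordinates \<xi> B" and aB: "a \<in> B"
    using local_coordinates_exist[OF aU] by metis
  have B: "openin (man_top M) B" "B \<subseteq> U" using \<xi> by (auto simp: local_coordinates_def)
  obtain r L where rL: "r > 0" "L > 0" "cball (\<phi> a) r \<subseteq> coord U"
    "\<And>x y. x \<in> cball (\<phi> a) r \<Longrightarrow> y \<in> cball (\<phi> a) r \<Longrightarrow>
      norm (chart_field \<xi> x - chart_field \<xi> y) \<le> L * norm (x - y)"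
    by (rule infinitely_differentiable_on_locally_Lipschitz[OF open_coord_chart
          chart_in_coord[OF aU order_refl] infinitely_differentiable_chart_field[OF \<xi>]]) blast
  define N where "N = B \<inter> {x \<in> U. \<phi> x \<in> ball (\<phi> a) r}"
  have N: "openin (man_top M) N"
    unfolding N_def by (intro openin_Int B openin_chart_preimage open_ball)
  define T where "T = {t \<in> {p..q}. c t \<in> N} \<inter> {t \<in> {p..q}. d t \<in> N}"
  have "openin (top_of_set {p..q}) T"
    unfolding T_def
    using openin_continuous_map_preimage[of "top_of_set {p..q}" "man_top M" c N]
      openin_continuous_map_preimage[of "top_of_set {p..q}" "man_top M" d N] c d N
    by (auto simp: integral_curve_def)
  moreover have "t0 \<in> T"
    using t0 eq aB aU rL(1) by (auto simp: T_def N_def a_def)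
  ultimately obtain e0 where e0: "e0 > 0" "cball t0 e0 \<inter> {p..q} \<subseteq> T"
    unfolding openin_contains_cball by blast
  \<comment> \<open>The second bound gives \<open>L * e \<le> 1 / 2\<close>, the factor that defeats
    the maximum of \<open>norm (w t)\<close>.\<close>
  define e where "e = min e0 (1 / (2 * L))"
  have e: "e > 0" "e \<le> e0" "L * e \<le> 1 / 2"
    using e0(1) rL(2) by (auto simp: e_def min_def field_simps)
  define J where "J = {max p (t0 - e)..min q (t0 + e)}"
  have J: "J = cball t0 e \<inter> {p..q}"
    by (auto simp: J_def dist_real_def)
  have JT: "J \<subseteq> T" using e0(2) e(2) by (auto simp: J)
  have Jpq: "J \<subseteq> {p..q}" by (auto simp: J)
  have t0J: "t0 \<in> J" using t0 e(1) by (simp add: J)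
  have cd: "c t \<in> N" "d t \<in> N" if "t \<in> J" for t
    using JT that by (auto simp: T_def)
  define w where "w t = \<phi> (c t) - \<phi> (d t)" for t
  have D: "(w has_vector_derivative (chart_field \<xi> (\<phi> (c t)) - chart_field \<xi> (\<phi> (d t)))) (at t within J)"
    if "t \<in> J" for t
    unfolding w_def[abs_def]
    using cd that
    by (intro has_vector_derivative_diff
        integral_curve_in_chart[OF \<xi> integral_curve_subset[OF c Jpq]]
        integral_curve_in_chart[OF \<xi> integral_curve_subset[OF d Jpq]]) (auto simp: N_def)
  have "continuous_on J w"
    unfolding continuous_on_eq_continuous_within
    using D has_vector_derivative_continuous by blast
  then have "continuous_on J (\<lambda>t. norm (w t))"
    by (rule continuous_on_norm)
  then obtain ts where ts: "ts \<in> J" "\<And>t. t \<in> J \<Longrightarrow> norm (w t) \<le> norm (w ts)"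
    using continuous_attains_sup[of J "\<lambda>t. norm (w t)"] t0J by (auto simp: J_def)
  have "norm (w ts - w t0) \<le> (L * norm (w ts)) * \<bar>ts - t0\<bar>"
  proof (rule vector_derivative_bound[OF _ D _ ts(1) t0J])
    fix t assume t: "t \<in> J"
    have "norm (chart_field \<xi> (\<phi> (c t)) - chart_field \<xi> (\<phi> (d t))) \<le> L * norm (w t)"
      unfolding w_def using cd[OF t] by (intro rL(4)) (auto simp: N_def)
    also have "\<dots> \<le> L * norm (w ts)"
      using ts(2)[OF t] rL(2) by simp
    finally show "norm (chart_field \<xi> (\<phi> (c t)) - chart_field \<xi> (\<phi> (d t))) \<le> L * norm (w ts)" .
  qed (simp add: J_def)
  also have "\<dots> \<le> (L * norm (w ts)) * e"
    using ts(1) rL(2) by (intro mult_left_mono) (auto simp: J dist_real_def)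
  also have "\<dots> = (L * e) * norm (w ts)" by simp
  also have "\<dots> \<le> 1 / 2 * norm (w ts)"
    by (rule mult_right_mono[OF e(3)]) simp
  finally have "norm (w ts) \<le> 0"
    using eq by (simp add: w_def)
  then have w0: "w t = 0" if "t \<in> J" for t
    using ts(2)[OF that] by simp
  show thesis
  proof (rule that[OF e(1)])
    fix t assume "t \<in> {p..q}" "\<bar>t - t0\<bar> < e"
    then have t: "t \<in> J" by (auto simp: J dist_real_def)
    then show "c t = d t"
      using w0[OF t] cd[OF t] inj_on_chart by (auto simp: w_def N_def inj_on_def)
  qed
qed

text \<open>The coincidence set is open by local uniqueness and closed because \<open>M\<close> is
  Hausdorff, so on a connected interval it is everything.\<close>

lemma integral_curve_unique:
  assumes c: "integral_curve M X c {p..q}" and d: "integral_curve M X d {p..q}"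
    and t0: "t0 \<in> {p..q}" and eq: "c t0 = d t0" and t: "t \<in> {p..q}"
  shows "c t = d t"
proof -
  define S where "S = {t \<in> {p..q}. c t = d t}"
  have "openin (top_of_set {p..q}) S"
    unfolding openin_contains_ball
  proof (intro conjI ballI)
    fix x assume "x \<in> S"
    then obtain e where "e > 0" "\<And>t. t \<in> {p..q} \<Longrightarrow> \<bar>t - x\<bar> < e \<Longrightarrow> c t = d t"
      using integral_curve_locally_unique[OF c d, of x] by (auto simp: S_def)
    then show "\<exists>e>0. ball x e \<inter> {p..q} \<subseteq> S"
      by (intro exI[of _ e]) (auto simp: S_def dist_real_def)
  qed (auto simp: S_def)
  moreover have "closedin (top_of_set {p..q}) S"
  proof -
    have "Hausdorff_space (man_top M)" using manifold by (simp add: smooth_manifold_def)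
    then show ?thesis
      using closedin_continuous_maps_eq[of "man_top M" "top_of_set {p..q}" c d] c d
      by (simp add: integral_curve_def S_def)
  qed
  moreover have "connected {p..q}" by simp
  ultimately have "S = {} \<or> S = {p..q}"
    unfolding connected_clopen by blast
  moreover have "t0 \<in> S"
    unfolding S_def using t0 eq by blast
  ultimately have "t \<in> S" using t by blast
  then show ?thesis
    unfolding S_def by blast
qed

text \<open>Uniqueness turns the definite description in \<open>flow\<close> into evaluation of any
  integral curve at hand. The interval may extend to both sides of 0, which covers negative
  times.\<close>

lemma flow_eq:
  assumes c: "integral_curve M X c {p..q}" and "0 \<in> {p..q}" and t: "t \<in> {p..q}"
  shows "t \<in> flow_dom M X (c 0)" "flow M X t (c 0) = c t"
proof -
  let ?I = "closed_segment 0 t"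
  have I: "?I = {min 0 t..max 0 t}" by (auto simp: closed_segment_eq_real_ivl)
  have cI: "integral_curve M X c ?I"
    by (rule integral_curve_subset[OF c]) (use assms in \<open>auto simp: I\<close>)
  then show "t \<in> flow_dom M X (c 0)"
    by (auto simp: flow_dom_def)
  show "flow M X t (c 0) = c t"
    unfolding flow_def
  proof (rule the_equality)
    fix w assume "\<exists>d. integral_curve M X d ?I \<and> d 0 = c 0 \<and> d t = w"
    then obtain d where d: "integral_curve M X d ?I" "d 0 = c 0" "d t = w" by auto
    have "d t = c t"
      by (rule integral_curve_unique[OF d(1)[unfolded I] cI[unfolded I], of 0]) (use d(2) in auto)
    then show "w = c t" using d(3) by simp
  qed (use cI in blast)
qed

text \<open>This is \<open>F\<^sub>t = F\<^sub>s \<circ> F\<^sub>t\<^sub>-\<^sub>s\<close> on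
  \<open>V\<close>, where the inner map sends \<open>V\<close> into itself because
  \<open>t - s > 0\<close>. As \<open>s\<close> and \<open>t\<close> may be negative and the flow
  incomplete, the identity is realised by a single curve through \<open>z\<close> whose shift starts
  at \<open>c (t - s)\<close> and reaches \<open>w\<close> at time \<open>s\<close>.\<close>

lemma flow_contracts_forward_invariant:
  assumes inv: "\<And>x T. x \<in> V \<Longrightarrow> T \<ge> 0 \<Longrightarrow>
    \<exists>c. integral_curve M X c {0..T} \<and> c 0 = x \<and> c ` {0..T} \<subseteq> V"
  shows "flow_contracts M X V"
  unfolding flow_contracts_def
proof (intro conjI ballI allI impI)
  fix x t assume x: "x \<in> V" and t: "0 \<le> (t::real)"
  then obtain c where "integral_curve M X c {0..t}" "c 0 = x" using inv by metis
  then show "t \<in> flow_dom M X x" using flow_eq(1)[of c 0 t t] t by auto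
next
  fix s t :: real assume st: "s < t"
  show "flow_image M X t V \<subseteq> flow_image M X s V"
  proof
    fix w assume "w \<in> flow_image M X t V"
    then obtain z where z: "z \<in> V" "t \<in> flow_dom M X z" "w = flow M X t z"
      by (auto simp: flow_image_def)
    \<comment> \<open>The curve has to contain both the new starting time \<open>t - s\<close> and
      the final time \<open>t\<close>; the former is the larger one when
      \<open>s < 0\<close>.\<close>
    define T where "T = max t (t - s)"
    have T: "T \<ge> 0" "t \<le> T" "t - s \<le> T" using st by (auto simp: T_def)
    obtain e where e: "integral_curve M X e {0..T}" "e 0 = z" "e ` {0..T} \<subseteq> V"
      using inv[OF z(1) T(1)] by blast
    obtain p c where p: "p \<le> 0" "p \<le> t" and c: "integral_curve M X c {p..T}" "c 0 = z" "c (t - s) \<in> V"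
    proof (cases "t \<ge> 0")
      case True
      have "e (t - s) \<in> V" using e(3) st T(3) by auto
      then show thesis using that[of 0 e] e True by auto
    next
      case False
      \<comment> \<open>For negative \<open>t\<close> the backward piece exists since
        \<open>t\<close> lies in the flow domain of \<open>z\<close>; it is glued at time 0 to the
        forward curve inside \<open>V\<close>.\<close>
      obtain d where d: "integral_curve M X d (closed_segment 0 t)" "d 0 = z"
        using z(2) by (auto simp: flow_dom_def)
      have "integral_curve M X d {t..0}"
        using d(1) False by (simp add: closed_segment_eq_real_ivl)
      then have "integral_curve M X (\<lambda>x. if x \<le> 0 then d x else e x) {t..T}"
        by (rule integral_curve_concat[OF _ e(1)]) (use False T(1) d(2) e(2) in auto)
      moreover have "(if t - s \<le> 0 then d (t - s) else e (t - s)) \<in> V"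
        using e(3) st T(3) by auto
      ultimately show thesis
        by (intro that[of t "\<lambda>x. if x \<le> 0 then d x else e x"]) (use False d(2) in auto)
    qed
    have ct: "c t = w"
      using flow_eq(2)[OF c(1), of t] p T c(2) z(3) by auto
    have "integral_curve M X (\<lambda>\<tau>. c (\<tau> + (t - s))) {p - (t - s)..T - (t - s)}"
      by (rule integral_curve_shift[OF c(1)])
    from flow_eq[OF this, of s] have "s \<in> flow_dom M X (c (t - s))" "flow M X s (c (t - s)) = w"
      using p T st ct by auto
    then show "w \<in> flow_image M X s V"
      using c(3) by (auto simp: flow_image_def)
  qed
qed

end

section \<open>Existence of forward orbits by trapping\<close>

context flow_chart
begin

text \<open>The map \<open>f \<circ> psi\<close> is unchanged by composition with \<open>P\<close>,
  hence its derivative at a model point sees only the projected direction.\<close>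

lemma frechet_derivative_P:
  assumes "f \<in> C_inf M" "y \<in> coord U" "P y = y"
  shows "frechet_derivative (f \<circ> psi) (at y) (P v) = frechet_derivative (f \<circ> psi) (at y) v"
proof -
  have "((f \<circ> psi) has_derivative frechet_derivative (f \<circ> psi) (at y)) (at y)"
    using differentiable_in_chart[OF assms(1,2)] by (simp add: frechet_derivative_works[symmetric])
  then have D: "((f \<circ> psi) has_derivative frechet_derivative (f \<circ> psi) (at y)) (at (P y))"
    using assms(3) by simp
  have "((\<lambda>y. (f \<circ> psi) (P y)) has_derivative (\<lambda>v. frechet_derivative (f \<circ> psi) (at y) (P v))) (at y)"
    by (rule has_derivative_compose[where f = P, OF bounded_linear_imp_has_derivative[OF bounded_linear_P] D])
  moreover have "(\<lambda>y. (f \<circ> psi) (P y)) = f \<circ> psi"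
    by (simp add: fun_eq_iff psi_P)
  ultimately show ?thesis
    using frechet_derivative_at by metis
qed

text \<open>The equation is posed with the projected field so that solutions can stay in the model
  space; the projection does not change the derivative of any \<open>f \<circ> psi\<close>.\<close>

lemma integral_curve_of_chart_solution:
  assumes \<xi>: "local_coordinates \<xi> B"
    and w: "\<And>t. t \<in> I \<Longrightarrow> (w has_vector_derivative P (chart_field \<xi> (w t))) (at t within I)"
    and wB: "\<And>t. t \<in> I \<Longrightarrow> w t \<in> coord B" and wP: "\<And>t. t \<in> I \<Longrightarrow> P (w t) = w t"
  shows "integral_curve M X (\<lambda>t. psi (w t)) I"
  unfolding integral_curve_def
proof (intro conjI ballI)
  have BU: "B \<subseteq> U" using \<xi> by (auto simp: local_coordinates_def)
  have wU: "w t \<in> coord U" if "t \<in> I" for t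
    using wB[OF that] coord_mono[OF BU] by auto
  have "continuous_on I w"
    unfolding continuous_on_eq_continuous_within
    using w has_vector_derivative_continuous by blast
  then have "continuous_map (top_of_set I) (top_of_set (coord U)) w"
    using wU by (auto simp: continuous_map_in_subtopology)
  then have "continuous_map (top_of_set I) (man_top M) (psi \<circ> w)"
    using continuous_map_psi by (rule continuous_map_compose)
  then show "continuous_map (top_of_set I) (man_top M) (\<lambda>t. psi (w t))"
    by (simp add: comp_def)
  fix t f assume t: "t \<in> I" and f: "f \<in> C_inf M"
  have FD: "((f \<circ> psi) has_derivative frechet_derivative (f \<circ> psi) (at (w t))) (at (w t))"
    using differentiable_in_chart[OF f wU[OF t]] by (simp add: frechet_derivative_works[symmetric])
  have phi: "\<phi> (psi (w t)) = w t"
    using chart_psi[OF wU[OF t]] wP[OF t] by simp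
  have "((\<lambda>s. (f \<circ> psi) (w s)) has_derivative
      (\<lambda>h. frechet_derivative (f \<circ> psi) (at (w t)) (h *\<^sub>R P (chart_field \<xi> (w t))))) (at t within I)"
    by (rule has_derivative_compose[where f = w, OF w[OF t, unfolded has_vector_derivative_def] FD])
  moreover have "frechet_derivative (f \<circ> psi) (at (w t)) (h *\<^sub>R P (chart_field \<xi> (w t))) =
      h * X f (psi (w t))" for h
  proof -
    have "X f (psi (w t)) = frechet_derivative (f \<circ> psi) (at (w t)) (chart_field \<xi> (w t))"
      using field_in_chart[OF \<xi> psi_in[OF wB[OF t] BU] f] phi by simp
    moreover have "linear (frechet_derivative (f \<circ> psi) (at (w t)))"
      using FD by (rule has_derivative_linear)
    ultimately show ?thesis
      using frechet_derivative_P[OF f wU[OF t] wP[OF t]] by (simp add: linear_scale)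
  qed
  ultimately show "((\<lambda>s. f (psi (w s))) has_real_derivative X f (psi (w t))) (at t within I)"
    by (simp add: has_field_derivative_def mult_commute_abs)
qed

end

context flow_field
begin

text \<open>On the boundary of a small coordinate ball \<open>\<Phi>\<close> has a positive lower
  bound \<open>m\<close>. A curve that starts inside with \<open>\<Phi> < m\<close> cannot reach the
  boundary, so it stays where the vector field is Lipschitz and exists for as long as desired. The
  set \<open>V\<close> is this ball cut down to \<open>\<Phi> < m\<close>.\<close>

lemma lyapunov_trapping:
  assumes z: "z \<in> points M"
    and \<Phi>: "continuous_map (man_top M) euclideanreal \<Phi>"
    and mono: "\<And>c T. T \<ge> 0 \<Longrightarrow> integral_curve M X c {0..T} \<Longrightarrow> \<Phi> (c T) \<le> \<Phi> (c 0)"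
    and \<Phi>0: "\<Phi> z = 0" and N: "openin (man_top M) N" "z \<in> N" "\<And>x. x \<in> N - {z} \<Longrightarrow> \<Phi> x > 0"
  obtains V where "openin (man_top M) V" "z \<in> V" "V \<subseteq> N"
    "\<And>x T. x \<in> V \<Longrightarrow> T \<ge> 0 \<Longrightarrow> \<exists>c. integral_curve M X c {0..T} \<and> c 0 = x \<and> c ` {0..T} \<subseteq> V"
    "\<And>x. x \<in> V \<Longrightarrow> compactin (man_top M) {y \<in> V. \<Phi> y \<le> \<Phi> x}"
proof -
  obtain U \<phi> where ch: "manifold_chart M U \<phi>" and zU: "z \<in> U"
    using manifold_chart_at[OF manifold z] by metis
  interpret flow_chart M X U \<phi>
    by (intro flow_chart.intro ch flow_field_axioms)
  obtain \<xi> B where \<xi>: "local_coordinates \<xi> B" and zB: "z \<in> B"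
    using local_coordinates_exist[OF zU] by metis
  have B: "openin (man_top M) B" "B \<subseteq> U" using \<xi> by (auto simp: local_coordinates_def)
  define p where "p = \<phi> z"
  define A where "A = B \<inter> N"
  have A: "openin (man_top M) A" "A \<subseteq> U" "z \<in> A" "A \<subseteq> B"
    using B N zB by (auto simp: A_def)
  define \<eta> where "\<eta> y = P (chart_field \<xi> y)" for y
  have "infinitely_differentiable_on (coord A) \<eta>"
    unfolding \<eta>_def[abs_def]
    using higher_differentiable_on_bounded_linear_comp[OF bounded_linear_P open_coord[OF A(1,2)]
        higher_differentiable_on_subset[OF infinitely_differentiable_chart_field[OF \<xi>, rule_format] coord_mono[OF A(2)]]]
    by blast
  then obtain r L where rL: "r > 0" "L > 0" "cball p r \<subseteq> coord A"
    "\<And>x y. x \<in> cball p r \<Longrightarrow> y \<in> cball p r \<Longrightarrow> norm (\<eta> x - \<eta> y) \<le> L * norm (x - y)"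
    by (rule infinitely_differentiable_on_locally_Lipschitz[OF open_coord[OF A(1,2)]
          chart_in_coord[OF A(3,2), folded p_def]]) blast
  have coordA: "y \<in> coord B" "y \<in> coord U" "psi y \<in> A" if "y \<in> cball p r" for y
  proof -
    have "y \<in> coord A" using that rL(3) by auto
    then show "y \<in> coord B" "y \<in> coord U" "psi y \<in> A"
      using coord_mono[OF A(4)] coord_mono[OF A(2)] psi_in[OF _ A(2)] by auto
  qed
  have closed_model: "closed (man_model M)"
    by (rule closed_subspace[OF subspace_model])
  have cont: "continuous_on (coord U) (\<Phi> \<circ> psi)"
    using continuous_map_compose[OF continuous_map_psi \<Phi>] by simp
  \<comment> \<open>Off the model space a point of the sphere may project to \<open>p\<close> and
    represent \<open>z\<close>, where \<open>\<Phi>\<close> is 0. In dimension zero \<open>S\<close>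
    is empty, hence the default \<open>m = 1\<close>.\<close>
  define S where "S = sphere p r \<inter> man_model M"
  have pos: "\<Phi> (psi y) > 0" if "y \<in> S" for y
  proof -
    have y: "y \<in> cball p r" "P y = y" "y \<noteq> p"
      using that rL(1) by (auto simp: S_def P_ident)
    then have "psi y \<noteq> z"
      using chart_psi[OF coordA(2)[OF y(1)]] by (auto simp: p_def)
    then show ?thesis
      using N(3)[of "psi y"] coordA(3)[OF y(1)] by (auto simp: A_def)
  qed
  obtain m where m: "m > 0" "\<And>y. y \<in> S \<Longrightarrow> m \<le> \<Phi> (psi y)"
  proof (cases "S = {}")
    case True
    then show thesis using that[of 1] by simp
  next
    case False
    have "compact S" unfolding S_def by (intro compact_Int_closed closed_model) simp
    moreover have "continuous_on S (\<Phi> \<circ> psi)"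
      using coordA(2) by (intro continuous_on_subset[OF cont]) (auto simp: S_def)
    ultimately obtain y where "y \<in> S" "\<And>w. w \<in> S \<Longrightarrow> (\<Phi> \<circ> psi) y \<le> (\<Phi> \<circ> psi) w"
      using continuous_attains_inf[OF _ False, of "\<Phi> \<circ> psi"] by blast
    then show thesis using that[of "\<Phi> (psi y)"] pos by simp
  qed
  define V where "V = {x \<in> U. \<phi> x \<in> ball p r} \<inter> {x \<in> points M. \<Phi> x \<in> {..<m}}"
  have V1: "openin (man_top M) V"
    unfolding V_def
    by (intro openin_Int openin_chart_preimage openin_continuous_map_preimage[OF \<Phi>]) auto
  have V2: "z \<in> V"
    using zU z \<Phi>0 m(1) rL(1) by (auto simp: V_def p_def)
  have VA: "x \<in> A" if "x \<in> V" for x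
  proof -
    have "\<phi> x \<in> cball p r" "x \<in> U" using that by (auto simp: V_def)
    then show ?thesis using coordA(3)[of "\<phi> x"] psi_chart[of x] by simp
  qed
  have V3: "V \<subseteq> N" using VA by (auto simp: A_def)
  \<comment> \<open>Composing with the closest point map of the ball makes the vector field globally Lipschitz.\<close>
  define cp where "cp = closest_point (cball p r)"
  have cp_in: "cp y \<in> cball p r" for y
    unfolding cp_def by (rule closest_point_in_set) (use rL(1) in auto)
  \<comment> \<open>The inner \<open>P\<close> makes \<open>g\<close> depend on the model component
    alone, and the one inside \<open>\<eta>\<close> keeps its values in the model. Hence the
    projection \<open>w\<close> of a solution is again a solution and lies in the model.\<close>
  define g where "g y = \<eta> (cp (P y))" for y
  obtain KP where KP: "KP > 0" "\<And>y. norm (P y) \<le> norm y * KP"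
    using bounded_linear.pos_bounded[OF bounded_linear_P] by blast
  have g_Lip: "norm (g x - g y) \<le> (L * KP) * norm (x - y)" for x y
  proof -
    have "norm (g x - g y) \<le> L * norm (cp (P x) - cp (P y))"
      unfolding g_def by (rule rL(4)[OF cp_in cp_in])
    also have "norm (cp (P x) - cp (P y)) \<le> norm (P x - P y)"
      using closest_point_lipschitz[of "cball p r" "P x" "P y"] rL(1) by (simp add: cp_def dist_norm)
    also have "norm (P x - P y) \<le> norm (x - y) * KP"
      using KP(2)[of "x - y"] linear_diff[OF linear_P] by simp
    finally show ?thesis using rL(2) by (simp add: mult_left_mono mult_ac)
  qed
  have V4: "\<exists>c. integral_curve M X c {0..T} \<and> c 0 = x \<and> c ` {0..T} \<subseteq> V" if x: "x \<in> V" and T: "T \<ge> 0" for x T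
  proof -
    have xU: "x \<in> U" and xb: "\<phi> x \<in> ball p r" and x\<Phi>: "\<Phi> x < m"
      using x by (auto simp: V_def)
    obtain y where y: "y 0 = \<phi> x"
      "\<And>t. t \<in> {0..T} \<Longrightarrow> (y has_vector_derivative g (y t)) (at t within {0..T})"
      using Lipschitz_ode_solution[OF _ g_Lip T, of "\<phi> x"] rL(2) KP(1) by auto
    define w where "w t = P (y t)" for t
    have w0: "w 0 = \<phi> x" by (simp add: w_def y(1) P_chart[OF xU])
    have wP: "P (w t) = w t" for t by (simp add: w_def P_idem)
    have wD: "(w has_vector_derivative g (w t)) (at t within {0..T})" if "t \<in> {0..T}" for t
    proof -
      have "g (w t) = P (g (y t))"
        by (simp add: g_def w_def P_idem \<eta>_def)
      then show ?thesis
        using bounded_linear.has_vector_derivative[OF bounded_linear_P y(2)[OF that]]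
        by (simp add: w_def[abs_def])
    qed
    have cw: "continuous_on {0..T} w"
      unfolding continuous_on_eq_continuous_within
      using wD has_vector_derivative_continuous by blast
    have curve: "integral_curve M X (\<lambda>t. psi (w t)) {0..t1}"
      if t1: "t1 \<in> {0..T}" and inb: "\<And>t. t \<in> {0..t1} \<Longrightarrow> w t \<in> cball p r" for t1
    proof (rule integral_curve_of_chart_solution[OF \<xi>])
      fix t assume t: "t \<in> {0..t1}"
      have "cp (P (w t)) = w t"
        using inb[OF t] wP by (simp add: cp_def closest_point_self)
      then have "g (w t) = P (chart_field \<xi> (w t))"
        by (simp add: g_def \<eta>_def)
      then show "(w has_vector_derivative P (chart_field \<xi> (w t))) (at t within {0..t1})"
        using wD[of t] t t1 by (auto intro!: has_vector_derivative_within_subset[of w _ t "{0..T}"])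
      show "w t \<in> coord B" by (rule coordA(1)[OF inb[OF t]])
      show "P (w t) = w t" by (rule wP)
    qed
    have \<Phi>w: "\<Phi> (psi (w t1)) < m"
      if t1: "t1 \<in> {0..T}" and inb: "\<And>t. t \<in> {0..t1} \<Longrightarrow> w t \<in> cball p r" for t1
      using mono[OF _ curve[OF t1 inb]] t1 x\<Phi> w0 psi_chart[OF xU] by auto
    have cdist: "continuous_on {0..T} (\<lambda>t. dist p (w t))"
      by (intro continuous_intros cw)
    have d0: "dist p (w 0) < r" using xb w0 by simp
    \<comment> \<open>Up to the first time \<open>t1\<close> on the sphere the modified field is the
      true one, so \<open>w\<close> is a genuine integral curve and \<open>\<Phi> < m\<close> holds
      at \<open>t1\<close>, against the choice of \<open>m\<close>.\<close>
    have never: "dist p (w t) \<noteq> r" if t: "t \<in> {0..T}" for t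
    proof
      assume "dist p (w t) = r"
      define Z where "Z = {t \<in> {0..T}. dist p (w t) = r}"
      have "closed Z"
        unfolding Z_def using continuous_closed_preimage_constant[OF cdist closed_atLeastAtMost] by simp
      moreover have "Z \<subseteq> {0..T}" "Z \<noteq> {}"
        using t \<open>dist p (w t) = r\<close> by (auto simp: Z_def)
      ultimately obtain t1 where t1: "t1 \<in> Z" "\<And>s. s \<in> Z \<Longrightarrow> t1 \<le> s"
        using compact_attains_inf[of Z] compact_Icc closed_subset
        by (metis compact_Int_closed inf.absorb2)
      have t1T: "t1 \<in> {0..T}" "dist p (w t1) = r" using t1(1) by (auto simp: Z_def)
      have inb: "w s \<in> cball p r" if s: "s \<in> {0..t1}" for s
      proof (rule ccontr)
        assume "w s \<notin> cball p r"
        then have "dist p (w 0) \<le> r" "r \<le> dist p (w s)" "0 \<le> s" using d0 s by auto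
        moreover have "continuous_on {0..s} (\<lambda>t. dist p (w t))"
          by (rule continuous_on_subset[OF cdist]) (use s t1T in auto)
        ultimately obtain q where q: "0 \<le> q" "q \<le> s" "dist p (w q) = r"
          using IVT'[of "\<lambda>t. dist p (w t)" 0 r s] by auto
        then have "q \<in> Z" using s t1T(1) by (auto simp: Z_def)
        then have "s = t1" using t1(2)[of q] q(2) s by auto
        then show False using \<open>w s \<notin> cball p r\<close> t1T(2) by simp
      qed
      have "w t1 \<in> S"
        using t1T(2) wP[of t1] P_in_model[of "w t1"] by (simp add: S_def)
      then show False using \<Phi>w[OF t1T(1) inb] m(2) by force
    qed
    have inball: "w t \<in> ball p r" if t: "t \<in> {0..T}" for t
    proof (rule ccontr)
      assume "w t \<notin> ball p r"
      then have "dist p (w 0) \<le> r" "r \<le> dist p (w t)" "0 \<le> t" using d0 t by auto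
      moreover have "continuous_on {0..t} (\<lambda>t. dist p (w t))"
        by (rule continuous_on_subset[OF cdist]) (use t in auto)
      ultimately obtain q where "0 \<le> q" "q \<le> t" "dist p (w q) = r"
        using IVT'[of "\<lambda>t. dist p (w t)" 0 r t] by auto
      then show False using never[of q] t by auto
    qed
    show ?thesis
    proof (intro exI[of _ "\<lambda>t. psi (w t)"] conjI)
      show "integral_curve M X (\<lambda>t. psi (w t)) {0..T}"
        using inball T by (intro curve) force+
      show "psi (w 0) = x" by (simp add: w0 psi_chart[OF xU])
      show "(\<lambda>t. psi (w t)) ` {0..T} \<subseteq> V"
      proof clarify
        fix t assume t: "t \<in> {0..T}"
        have cb: "w t \<in> cball p r" using inball[OF t] by (simp add: less_imp_le)
        have "\<Phi> (psi (w t)) < m"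
          by (rule \<Phi>w[OF t]) (use inball t in \<open>force\<close>)
        moreover have "psi (w t) \<in> U" using coordA(3)[OF cb] A(2) by auto
        moreover have "\<phi> (psi (w t)) \<in> ball p r"
          using chart_psi[OF coordA(2)[OF cb]] wP inball[OF t] by simp
        ultimately show "psi (w t) \<in> V"
          using chart_subset_points by (auto simp: V_def)
      qed
    qed
  qed
  \<comment> \<open>Replacing the open ball by the closed one adds no points: on the sphere
    \<open>\<Phi>\<close> is at least \<open>m\<close>, whereas here it is at most
    \<open>\<Phi> x < m\<close>. So the set is a closed part of a compact one.\<close>
  have V5: "compactin (man_top M) {y \<in> V. \<Phi> y \<le> \<Phi> x}" if x: "x \<in> V" for x
  proof -
    define K where "K = psi ` (cball p r \<inter> man_model M)"
    have "compactin (man_top M) K"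
      unfolding K_def
      by (rule image_compactin[OF _ continuous_map_psi])
        (auto simp: compactin_subtopology coordA(2) intro!: compact_Int_closed closed_model)
    moreover have "closedin (man_top M) {y \<in> points M. \<Phi> y \<in> {..\<Phi> x}}"
      by (rule closedin_continuous_map_preimage[OF \<Phi>]) simp
    ultimately have "compactin (man_top M) ({y \<in> points M. \<Phi> y \<in> {..\<Phi> x}} \<inter> K)"
      by (simp add: closed_Int_compactin)
    moreover have "{y \<in> points M. \<Phi> y \<in> {..\<Phi> x}} \<inter> K = {y \<in> V. \<Phi> y \<le> \<Phi> x}"
    proof (intro set_eqI iffI)
      fix y assume y: "y \<in> {y \<in> points M. \<Phi> y \<in> {..\<Phi> x}} \<inter> K"
      then obtain u where u: "u \<in> cball p r" "u \<in> man_model M" "y = psi u" by (auto simp: K_def)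
      have "\<Phi> y < m" using y x by (auto simp: V_def)
      then have "u \<notin> S" using m(2)[of u] u(3) by auto
      then have "u \<in> ball p r" using u by (auto simp: S_def)
      moreover have "\<phi> y = u" using chart_psi[OF coordA(2)[OF u(1)]] u by (simp add: P_ident)
      moreover have "y \<in> U" using coordA(3)[OF u(1)] A(2) u(3) by auto
      ultimately show "y \<in> {y \<in> V. \<Phi> y \<le> \<Phi> x}"
        using y \<open>\<Phi> y < m\<close> by (auto simp: V_def)
    next
      fix y assume y: "y \<in> {y \<in> V. \<Phi> y \<le> \<Phi> x}"
      then have "y \<in> U" "\<phi> y \<in> cball p r" by (auto simp: V_def)
      then have "y \<in> K"
        unfolding K_def using chart_in_model psi_chart by (metis IntI imageI)
      then show "y \<in> {y \<in> points M. \<Phi> y \<in> {..\<Phi> x}} \<inter> K"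
        using y by (auto simp: V_def)
    qed
    ultimately show ?thesis by simp
  qed
  show thesis
    by (rule that[OF V1 V2 V3 V4 V5])
qed

end

section \<open>Second derivatives and Hessians\<close>

text \<open>The quadratic form of the second derivative, written with partial derivatives along
  fixed basis vectors so that limits in \<open>v\<close> and \<open>y\<close> together can be taken
  termwise.\<close>

definition second_derivative :: "('a::euclidean_space \<Rightarrow> real) \<Rightarrow> 'a \<Rightarrow> 'a \<Rightarrow> real" where
  "second_derivative f v y = (\<Sum>b\<in>Basis. (v \<bullet> b) *
     (\<Sum>b'\<in>Basis. (v \<bullet> b') * frechet_derivative (\<lambda>y. frechet_derivative f (at y) b) (at y) b'))"

lemma second_derivative_eq:
  fixes f :: "'a::euclidean_space \<Rightarrow> real"
  assumes D: "open D" "p \<in> D" and f: "infinitely_differentiable_on D f"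
  shows "frechet_derivative (\<lambda>y. frechet_derivative f (at y) e) (at p) e = second_derivative f e p"
proof -
  let ?d = "\<lambda>b y. frechet_derivative f (at y) b"
  have db: "(?d b has_derivative frechet_derivative (?d b) (at p)) (at p)" for b
    by (rule infinitely_differentiable_on_has_derivative[OF infinitely_differentiable_on_derivative[OF f] D(2)])
  have "frechet_derivative (?d e) (at p) = frechet_derivative (\<lambda>y. \<Sum>b\<in>Basis. (e \<bullet> b) * ?d b y) (at p)"
    using frechet_derivative_euclidean_sum[OF infinitely_differentiable_on_differentiable[OF f]]
    by (intro frechet_derivative_cong_on[OF D]) simp
  also have "\<dots> = (\<lambda>v. \<Sum>b\<in>Basis. (e \<bullet> b) * frechet_derivative (?d b) (at p) v)"
    by (intro frechet_derivative_at[symmetric] has_derivative_sum has_derivative_mult_right db)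
  finally show ?thesis
    using frechet_derivative_euclidean_sum[OF infinitely_differentiable_on_differentiable[OF
          infinitely_differentiable_on_derivative[OF f] D(2)], of _ e]
    by (simp add: second_derivative_def)
qed

lemma second_derivative_scale: "second_derivative f (c *\<^sub>R v) y = c\<^sup>2 * second_derivative f v y"
  by (simp add: second_derivative_def sum_distrib_left power2_eq_square mult_ac)

text \<open>Maclaurin's formula with Lagrange remainder for \<open>f\<close> along the segment; the
  linear term disappears by \<open>crit\<close>.\<close>

lemma taylor_second_order:
  fixes f :: "'a::euclidean_space \<Rightarrow> real"
  assumes f: "infinitely_differentiable_on D f"
    and seg: "\<And>t. 0 \<le> t \<Longrightarrow> t \<le> 1 \<Longrightarrow> p + t *\<^sub>R v \<in> D"
    and crit: "frechet_derivative f (at p) v = 0"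
  obtains t where "0 < t" "t < 1" "f (p + v) = f p + second_derivative f v (p + t *\<^sub>R v) / 2"
proof -
  define g where "g t = f (p + t *\<^sub>R v)" for t
  define g1 where "g1 t = (\<Sum>b\<in>Basis. (v \<bullet> b) * frechet_derivative f (at (p + t *\<^sub>R v)) b)" for t
  define g2 where "g2 t = second_derivative f v (p + t *\<^sub>R v)" for t
  have chain: "((\<lambda>t. h (p + t *\<^sub>R v)) has_real_derivative
      (\<Sum>b\<in>Basis. (v \<bullet> b) * frechet_derivative h (at (p + t *\<^sub>R v)) b)) (at t)"
    if t: "0 \<le> t" "t \<le> 1" and h: "infinitely_differentiable_on D h" for t and h :: "'a \<Rightarrow> real"
  proof -
    have HD: "(h has_derivative frechet_derivative h (at (p + t *\<^sub>R v))) (at (p + t *\<^sub>R v))"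
      by (rule infinitely_differentiable_on_has_derivative[OF h seg[OF t]])
    have "((\<lambda>t. h (p + t *\<^sub>R v)) has_derivative (\<lambda>s. frechet_derivative h (at (p + t *\<^sub>R v)) (s *\<^sub>R v))) (at t)"
      by (rule has_derivative_compose[where f = "\<lambda>t. p + t *\<^sub>R v", OF _ HD])
        (auto intro!: derivative_eq_intros)
    moreover have "frechet_derivative h (at (p + t *\<^sub>R v)) (s *\<^sub>R v) =
        s * (\<Sum>b\<in>Basis. (v \<bullet> b) * frechet_derivative h (at (p + t *\<^sub>R v)) b)" for s
      using has_derivative_linear[OF HD]
        frechet_derivative_euclidean_sum[OF infinitely_differentiable_on_differentiable[OF h seg[OF t]], of v]
      by (simp add: linear_scale)
    ultimately show ?thesis
      by (simp add: has_field_derivative_def mult_commute_abs)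
  qed
  have d1: "(g has_real_derivative g1 t) (at t)" if "0 \<le> t" "t \<le> 1" for t
    unfolding g_def g1_def by (rule chain[OF that f])
  have d2: "(g1 has_real_derivative g2 t) (at t)" if "0 \<le> t" "t \<le> 1" for t
    unfolding g1_def g2_def second_derivative_def
    by (intro DERIV_sum DERIV_cmult chain that infinitely_differentiable_on_derivative[OF f])
  define diff where "diff n = (if n = 0 then g else if n = 1 then g1 else g2)" for n :: nat
  have "\<exists>t>0. t < 1 \<and> g 1 = (\<Sum>m<2. diff m 0 / fact m * 1 ^ m) + diff 2 t / fact 2 * 1 ^ 2"
    by (rule Maclaurin) (use d1 d2 in \<open>auto simp: diff_def less_2_cases_iff\<close>)
  then obtain t where t: "0 < t" "t < 1" "g 1 = g 0 + g1 0 + g2 t / 2"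
    by (auto simp: diff_def numeral_2_eq_2)
  moreover have "g1 0 = 0"
    using frechet_derivative_euclidean_sum[OF infinitely_differentiable_on_differentiable[OF f], of p v]
      seg[of 0] crit by (simp add: g1_def)
  ultimately show thesis
    using that[of t] by (simp add: g_def g2_def)
qed

text \<open>Finsler's lemma and the second derivative test in one: a failure for every \<open>K\<close> produces
  points \<open>x n\<close> tending to \<open>p\<close> whose directions from \<open>p\<close> accumulate at a unit vector that contradicts
  \<open>definite\<close>.\<close>

lemma augmented_second_derivative_test:
  fixes f :: "'a::euclidean_space \<Rightarrow> real" and c :: "'i \<Rightarrow> 'a \<Rightarrow> real"
  assumes D: "open D" "p \<in> D" and E: "subspace E" and J: "finite J"
    and f: "infinitely_differentiable_on D f" and c: "\<And>j. j \<in> J \<Longrightarrow> infinitely_differentiable_on D (c j)"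
    and crit: "\<And>v. frechet_derivative f (at p) v = 0"
    and definite: "\<And>e. e \<in> E \<Longrightarrow> e \<noteq> 0 \<Longrightarrow> (\<And>j. j \<in> J \<Longrightarrow> frechet_derivative (c j) (at p) e = 0) \<Longrightarrow>
      second_derivative f e p > 0"
  obtains K r where "K \<ge> 0" "r > 0" "ball p r \<subseteq> D"
    "\<And>x. x \<in> ball p r \<Longrightarrow> x - p \<in> E \<Longrightarrow> x \<noteq> p \<Longrightarrow> f x - f p + K * (\<Sum>j\<in>J. (c j x - c j p)\<^sup>2) > 0"
proof -
  obtain r where r: "r > 0" "ball p r \<subseteq> D"
    using D by (meson open_contains_ball)
  have "\<exists>K r'. K \<ge> 0 \<and> r' > 0 \<and> r' \<le> r \<and> (\<forall>x. x \<in> ball p r' \<longrightarrow> x - p \<in> E \<longrightarrow> x \<noteq> p \<longrightarrow>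
      f x - f p + K * (\<Sum>j\<in>J. (c j x - c j p)\<^sup>2) > 0)"
  proof (rule ccontr)
    assume neg: "\<not> ?thesis"
    \<comment> \<open>Failure is exploited with penalty \<open>Suc n\<close> on the ball of radius
      \<open>r / Suc n\<close>, so penalty and proximity to \<open>p\<close> grow together.\<close>
    have ex: "\<forall>n. \<exists>x. x \<in> ball p (r / Suc n) \<and> x - p \<in> E \<and> x \<noteq> p \<and>
        f x - f p + real (Suc n) * (\<Sum>j\<in>J. (c j x - c j p)\<^sup>2) \<le> 0"
    proof (rule allI, rule ccontr)
      fix n
      assume "\<nexists>x. x \<in> ball p (r / Suc n) \<and> x - p \<in> E \<and> x \<noteq> p \<and>
        f x - f p + real (Suc n) * (\<Sum>j\<in>J. (c j x - c j p)\<^sup>2) \<le> 0"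
      then have "real (Suc n) \<ge> 0 \<and> r / Suc n > 0 \<and> r / Suc n \<le> r \<and>
          (\<forall>x. x \<in> ball p (r / Suc n) \<longrightarrow> x - p \<in> E \<longrightarrow> x \<noteq> p \<longrightarrow>
            f x - f p + real (Suc n) * (\<Sum>j\<in>J. (c j x - c j p)\<^sup>2) > 0)"
        using r(1) by (auto simp: not_le field_simps)
      then show False using neg by blast
    qed
    obtain x where x: "\<And>n. x n \<in> ball p (r / Suc n)" "\<And>n. x n - p \<in> E" "\<And>n. x n \<noteq> p"
      "\<And>n. f (x n) - f p + real (Suc n) * (\<Sum>j\<in>J. (c j (x n) - c j p)\<^sup>2) \<le> 0"
      using choice[OF ex] by blast
    define d where "d n = norm (x n - p)" for n
    have d: "d n > 0" for n using x(3) by (simp add: d_def)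
    define e where "e n = (x n - p) /\<^sub>R d n" for n
    have xe: "x n = p + d n *\<^sub>R e n" for n using d[of n] by (simp add: e_def)
    have eS: "\<forall>n. e n \<in> sphere 0 1 \<inter> E"
      using x(2,3) subspace_mul[OF E] by (auto simp: e_def d_def)
    have "compact (sphere 0 1 \<inter> E)"
      by (intro compact_Int_closed closed_subspace E) simp
    from seq_compactE[OF compact_imp_seq_compact[OF this] eS]
    obtain u \<sigma> where u: "u \<in> sphere 0 1 \<inter> E" and \<sigma>: "strict_mono \<sigma>" "(e \<circ> \<sigma>) \<longlonglongrightarrow> u"
      by blast
    have xr: "dist p (x n) < r / Suc n" for n using x(1)[of n] by simp
    have rn: "(\<lambda>n. r / Suc n) \<longlonglongrightarrow> 0"
      by (rule LIMSEQ_Suc[OF lim_const_over_n])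
    have xb: "x n \<in> ball p r" for n
    proof -
      have "r / Suc n \<le> r" using r(1) by (simp add: field_simps)
      then show ?thesis using xr[of n] by simp
    qed
    have near: "(\<lambda>n. y (\<sigma> n)) \<longlonglongrightarrow> p" if y: "\<And>n. dist (y n) p \<le> dist p (x n)" for y
    proof -
      have "norm (dist (y n) p) \<le> r / Suc n" for n
        using y[of n] xr[of n] by simp
      then have "(\<lambda>n. dist (y n) p) \<longlonglongrightarrow> 0"
        by (intro Lim_null_comparison[OF always_eventually rn] allI)
      then have "y \<longlonglongrightarrow> p" by (rule tendsto_dist_iff[THEN iffD2])
      then show ?thesis using LIMSEQ_subseq_LIMSEQ[OF _ \<sigma>(1), of y p] by (simp add: comp_def)
    qed
    have el: "(\<lambda>n. e (\<sigma> n)) \<longlonglongrightarrow> u" using \<sigma>(2) by (simp add: comp_def)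
    have lim_at: "(\<lambda>n. h (y (\<sigma> n))) \<longlonglongrightarrow> h p"
      if "infinitely_differentiable_on (ball p r) h" "\<And>n. dist (y n) p \<le> dist p (x n)"
      for h :: "'a \<Rightarrow> real" and y
    proof -
      have "isCont h p"
        using infinitely_differentiable_on_continuous[OF that(1)] r(1)
        by (simp add: continuous_on_eq_continuous_at)
      then show ?thesis by (rule isCont_tendsto_compose[OF _ near[OF that(2)]])
    qed
    have sub: "infinitely_differentiable_on (ball p r) h" if "infinitely_differentiable_on D h" for h :: "'a \<Rightarrow> real"
      using higher_differentiable_on_subset[OF that[rule_format] r(2)] by blast
    have "\<exists>t. 0 < t \<and> t < 1 \<and> f (x n) = f p + second_derivative f (x n - p) (p + t *\<^sub>R (x n - p)) / 2" for n
    proof -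
      have seg: "p + t *\<^sub>R (x n - p) \<in> D" if t: "0 \<le> t" "t \<le> 1" for t
      proof -
        have "dist p (p + t *\<^sub>R (x n - p)) \<le> dist p (x n)"
          using t mult_right_mono[of t 1 "norm (x n - p)"] by (simp add: dist_norm norm_minus_commute)
        then have "p + t *\<^sub>R (x n - p) \<in> ball p r" using xb[of n] by simp
        then show ?thesis using r(2) by blast
      qed
      show ?thesis
        by (rule taylor_second_order[OF f seg crit]) auto
    qed
    then obtain \<theta> where \<theta>: "\<And>n. 0 < \<theta> n" "\<And>n. \<theta> n < 1"
      "\<And>n. f (x n) = f p + second_derivative f (x n - p) (p + \<theta> n *\<^sub>R (x n - p)) / 2"
      by metis
    define y where "y n = p + \<theta> n *\<^sub>R (x n - p)" for n
    have y: "dist (y n) p \<le> dist p (x n)" for n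
      using \<theta>(1,2)[of n] mult_right_mono[of "\<theta> n" 1 "norm (x n - p)"]
      by (simp add: y_def dist_norm norm_minus_commute)
    have f2: "f (x n) - f p = (d n)\<^sup>2 * (second_derivative f (e n) (y n) / 2)" for n
    proof -
      have "x n - p = d n *\<^sub>R e n" using xe[of n] by simp
      then show ?thesis using \<theta>(3)[of n] by (simp add: y_def second_derivative_scale)
    qed
    have lim2: "(\<lambda>n. second_derivative f (e (\<sigma> n)) (y (\<sigma> n))) \<longlonglongrightarrow> second_derivative f u p"
      unfolding second_derivative_def
      by (intro tendsto_sum tendsto_mult tendsto_inner el tendsto_const
          lim_at[where y = y] sub infinitely_differentiable_on_derivative f y)
    \<comment> \<open>Difference quotients along varying directions; Hadamard's lemma makes them
      linear in \<open>e n\<close> with continuous coefficients, so they converge to the derivative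
      along \<open>u\<close>.\<close>
    define k where "k j n = (c j (x n) - c j p) / d n" for j n
    have limk: "(\<lambda>n. k j (\<sigma> n)) \<longlonglongrightarrow> frechet_derivative (c j) (at p) u" if j: "j \<in> J" for j
    proof -
      have ctr: "p \<in> ball p r" using r(1) by simp
      obtain h :: "'a \<Rightarrow> 'a \<Rightarrow> real" where h: "\<And>b. infinitely_differentiable_on (ball p r) (h b)"
        "\<And>b. h b p = frechet_derivative (c j) (at p) b"
        "\<And>w. w \<in> ball p r \<Longrightarrow> c j w = c j p + (\<Sum>b\<in>Basis. ((w - p) \<bullet> b) * h b w)"
        by (rule hadamard[OF open_ball convex_ball ctr sub[OF c[OF j]]], rule that) blast+
      have "k j n = (\<Sum>b\<in>Basis. (e n \<bullet> b) * h b (x n))" for n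
      proof -
        have "c j (x n) - c j p = d n * (\<Sum>b\<in>Basis. (e n \<bullet> b) * h b (x n))"
          using h(3)[OF xb[of n]] xe[of n] by (simp add: sum_distrib_left mult.assoc)
        then show ?thesis using d[of n] by (simp add: k_def)
      qed
      moreover have "(\<lambda>n. \<Sum>b\<in>Basis. (e (\<sigma> n) \<bullet> b) * h b (x (\<sigma> n))) \<longlonglongrightarrow> (\<Sum>b\<in>Basis. (u \<bullet> b) * h b p)"
        by (intro tendsto_sum tendsto_mult tendsto_inner el tendsto_const lim_at[where y = x] h(1))
          (simp add: dist_commute)
      moreover have "(\<Sum>b\<in>Basis. (u \<bullet> b) * h b p) = frechet_derivative (c j) (at p) u"
        using frechet_derivative_euclidean_sum[OF infinitely_differentiable_on_differentiable[OF c[OF j] D(2)], of u]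
        by (simp add: h(2))
      ultimately show ?thesis by simp
    qed
    define s where "s n = (\<Sum>j\<in>J. (k j n)\<^sup>2)" for n
    have lims: "(\<lambda>n. s (\<sigma> n)) \<longlonglongrightarrow> (\<Sum>j\<in>J. (frechet_derivative (c j) (at p) u)\<^sup>2)"
      unfolding s_def by (intro tendsto_sum tendsto_power limk)
    have s0: "s n \<ge> 0" for n by (simp add: s_def sum_nonneg)
    \<comment> \<open>Used twice: dropping the nonnegative penalty gives
      \<open>second_derivative f u p \<le> 0\<close> in the limit, and dividing by
      \<open>Suc n\<close> forces the penalty \<open>s\<close> to tend to 0, so every constraint
      derivative vanishes at \<open>u\<close>.\<close>
    have key: "second_derivative f (e n) (y n) / 2 + real (Suc n) * s n \<le> 0" for n
    proof -
      have "(\<Sum>j\<in>J. (c j (x n) - c j p)\<^sup>2) = (d n)\<^sup>2 * s n"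
        using d[of n] by (simp add: s_def k_def sum_distrib_left power_divide)
      then have "(d n)\<^sup>2 * (second_derivative f (e n) (y n) / 2 + real (Suc n) * s n) \<le> 0"
        using x(4)[of n] unfolding f2 by (simp add: algebra_simps)
      then show ?thesis using d[of n] by (simp add: mult_le_0_iff)
    qed
    have "second_derivative f u p \<le> 0"
    proof (rule LIMSEQ_le_const2[OF lim2], intro exI allI impI)
      fix n
      have "0 \<le> real (Suc (\<sigma> n)) * s (\<sigma> n)" using s0 by simp
      then show "second_derivative f (e (\<sigma> n)) (y (\<sigma> n)) \<le> 0" using key[of "\<sigma> n"] by linarith
    qed
    moreover have "frechet_derivative (c j) (at p) u = 0" if j: "j \<in> J" for j
    proof -
      have l2: "(\<lambda>n. - second_derivative f (e (\<sigma> n)) (y (\<sigma> n)) / 2 * (1 / Suc (\<sigma> n))) \<longlonglongrightarrow>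
          - second_derivative f u p / 2 * 0"
        using LIMSEQ_subseq_LIMSEQ[OF LIMSEQ_Suc[OF lim_const_over_n[of 1]] \<sigma>(1)]
        by (intro tendsto_mult tendsto_divide tendsto_minus lim2 tendsto_const) (simp_all add: comp_def)
      have le: "s (\<sigma> n) \<le> - second_derivative f (e (\<sigma> n)) (y (\<sigma> n)) / 2 * (1 / Suc (\<sigma> n))" for n
        using key[of "\<sigma> n"] by (simp add: field_simps)
      have "(\<Sum>j\<in>J. (frechet_derivative (c j) (at p) u)\<^sup>2) \<le> - second_derivative f u p / 2 * 0"
        by (rule LIMSEQ_le[OF lims l2]) (use le in blast)
      then have "(\<Sum>j\<in>J. (frechet_derivative (c j) (at p) u)\<^sup>2) = 0"
        by (intro order_antisym sum_nonneg) simp_all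
      then show ?thesis using J j by (simp add: sum_nonneg_eq_0_iff)
    qed
    ultimately show False using definite[of u] u by force
  qed
  then obtain K r' where Kr: "K \<ge> 0" "r' > 0" "r' \<le> r" "\<And>x. x \<in> ball p r' \<Longrightarrow> x - p \<in> E \<Longrightarrow> x \<noteq> p \<Longrightarrow>
      f x - f p + K * (\<Sum>j\<in>J. (c j x - c j p)\<^sup>2) > 0"
    by blast
  show thesis
    by (rule that[OF Kr(1,2) _ Kr(4)]) (use r(2) Kr(3) in auto)
qed

section \<open>The Hessian in coordinates\<close>

context manifold_chart
begin

lemma differentiable_near:
  assumes "f \<in> smooth_near M a" "a \<in> U"
  shows "((f \<circ> psi) has_derivative frechet_derivative (f \<circ> psi) (at (\<phi> a))) (at (\<phi> a))"
proof -
  obtain A where A: "openin (man_top M) A" "a \<in> A" "f \<in> smooth_funs M A"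
    using assms(1) by (auto simp: smooth_near_def)
  have "\<phi> a \<in> coord (A \<inter> U)"
    using A(2) assms(2) by (intro chart_in_coord) auto
  then show ?thesis
    using infinitely_differentiable_on_has_derivative[OF smooth_funs_imp_infinitely_differentiable[OF A(1,3)]]
    by blast
qed

text \<open>The partial derivative along \<open>e\<close> as an element of the tangent space, whose
  definition demands the default value 0. The companion \<open>coordinate_field\<close> has no
  default, since a vector field is constrained only on functions smooth on its domain.\<close>

definition coordinate_vector :: "'a \<Rightarrow> 'e \<Rightarrow> ('a \<Rightarrow> real) \<Rightarrow> real" where
  "coordinate_vector a e f = (if f \<in> smooth_near M a then frechet_derivative (f \<circ> psi) (at (\<phi> a)) e else 0)"

definition coordinate_field :: "'e \<Rightarrow> ('a \<Rightarrow> real) \<Rightarrow> 'a \<Rightarrow> real" where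
  "coordinate_field e f x = frechet_derivative (f \<circ> psi) (at (\<phi> x)) e"

lemma coordinate_derivative_rules:
  assumes a: "a \<in> U" and f: "f \<in> smooth_near M a" and g: "g \<in> smooth_near M a"
  shows "coordinate_field e (\<lambda>x. f x + g x) a = coordinate_field e f a + coordinate_field e g a"
    and "coordinate_field e (\<lambda>x. f x * g x) a = f a * coordinate_field e g a + coordinate_field e f a * g a"
proof -
  note df = differentiable_near[OF f a] and dg = differentiable_near[OF g a]
  have "frechet_derivative (\<lambda>y. (f \<circ> psi) y + (g \<circ> psi) y) (at (\<phi> a)) =
      (\<lambda>e. frechet_derivative (f \<circ> psi) (at (\<phi> a)) e + frechet_derivative (g \<circ> psi) (at (\<phi> a)) e)"
    by (rule frechet_derivative_at[symmetric]) (rule has_derivative_add[OF df dg])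
  then show "coordinate_field e (\<lambda>x. f x + g x) a = coordinate_field e f a + coordinate_field e g a"
    by (simp add: coordinate_field_def comp_def)
  have "frechet_derivative (\<lambda>y. (f \<circ> psi) y * (g \<circ> psi) y) (at (\<phi> a)) =
      (\<lambda>e. (f \<circ> psi) (\<phi> a) * frechet_derivative (g \<circ> psi) (at (\<phi> a)) e +
        frechet_derivative (f \<circ> psi) (at (\<phi> a)) e * (g \<circ> psi) (\<phi> a))"
    by (rule frechet_derivative_at[symmetric]) (rule has_derivative_mult[OF df dg])
  then show "coordinate_field e (\<lambda>x. f x * g x) a = f a * coordinate_field e g a + coordinate_field e f a * g a"
    by (simp add: coordinate_field_def comp_def psi_chart[OF a])
qed

lemma coordinate_derivative_scale:
  assumes a: "a \<in> U" and f: "f \<in> smooth_near M a"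
  shows "coordinate_field e (\<lambda>x. c * f x) a = c * coordinate_field e f a"
proof -
  have "frechet_derivative (\<lambda>y. c * (f \<circ> psi) y) (at (\<phi> a)) =
      (\<lambda>e. c * frechet_derivative (f \<circ> psi) (at (\<phi> a)) e)"
    by (rule frechet_derivative_at[symmetric]) (rule has_derivative_mult_right[OF differentiable_near[OF f a]])
  then show "coordinate_field e (\<lambda>x. c * f x) a = c * coordinate_field e f a"
    by (simp add: coordinate_field_def comp_def)
qed

lemma coordinate_vector_eq: "f \<in> smooth_near M a \<Longrightarrow> coordinate_vector a e f = coordinate_field e f a"
  by (simp add: coordinate_vector_def coordinate_field_def)

lemma coordinate_vector_in_tangent_space:
  assumes a: "a \<in> U"
  shows "coordinate_vector a e \<in> tangent_space M a"
proof -
  have aM: "a \<in> points M" using a chart_subset_points by auto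
  have c: "(\<lambda>x. c) \<in> smooth_near M a" for c
    using C_inf_subset_smooth_near[OF aM] smooth_funs_const by blast
  show ?thesis
    unfolding tangent_space_def
    by (auto simp: coordinate_vector_eq smooth_near_add smooth_near_mult[OF c] smooth_near_mult
        coordinate_derivative_rules[OF a] coordinate_derivative_scale[OF a]) (simp add: coordinate_vector_def)
qed

lemma smooth_funs_subset_smooth_near:
  "openin (man_top M) A \<Longrightarrow> a \<in> A \<Longrightarrow> f \<in> smooth_funs M A \<Longrightarrow> f \<in> smooth_near M a"
  by (auto simp: smooth_near_def)

lemma coordinate_field_psi: "y \<in> coord U \<Longrightarrow> (coordinate_field e f \<circ> psi) y = frechet_derivative (f \<circ> psi) (at (P y)) e"
  by (simp add: coordinate_field_def chart_psi)

lemma coordinate_field_smooth: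
  assumes "f \<in> smooth_funs M U"
  shows "coordinate_field e f \<in> smooth_funs M U"
proof -
  have f: "infinitely_differentiable_on (coord U) (f \<circ> psi)"
    using assms smooth_fun_in_chart[OF openin_chart order_refl] by blast
  have PU: "P ` coord U \<subseteq> coord U" using P_in_coord by auto
  have "higher_differentiable_on n (coord U) (\<lambda>y. frechet_derivative (f \<circ> psi) (at (P y)) e)" for n
    by (rule higher_differentiable_on_compose[OF open_coord_chart PU
          infinitely_differentiable_on_derivative[OF f, rule_format]
          infinitely_differentiable_on_linear[OF bounded_linear_P, rule_format]])
  then have "higher_differentiable_on n (coord U) (coordinate_field e f \<circ> psi)" for n
    by (rule higher_differentiable_on_transform) (simp_all add: coordinate_field_psi open_coord_chart del: comp_apply)
  then show ?thesis
    using smooth_fun_in_chart[OF openin_chart order_refl] by blast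
qed

lemma coordinate_vector_field: "vector_field_on M U (coordinate_field e)"
  using coordinate_field_smooth coordinate_derivative_rules coordinate_derivative_scale smooth_funs_subset_smooth_near[OF openin_chart]
  by (auto simp: vector_field_on_def openin_chart)

text \<open>The definite description needs independence of the extension \<open>X\<close>. Near
  \<open>a\<close>, \<open>X L\<close> is the sum of \<open>X (\<xi> b)\<close> times the partial
  derivatives of \<open>L\<close>; these vanish at \<open>a\<close>, so \<open>v (X L)\<close>
  involves only the values \<open>v (\<xi> b)\<close> of \<open>X (\<xi> b)\<close> at
  \<open>a\<close>. The coordinate field then serves as extension.\<close>

lemma hessian_eq:
  assumes a: "a \<in> U" and L: "L \<in> C_inf M" and crit: "\<forall>v\<in>tangent_space M a. v L = 0"
    and e: "e \<in> man_model M"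
  shows "hessian M L a (coordinate_vector a e) (coordinate_vector a e) = second_derivative (L \<circ> psi) e (\<phi> a)"
proof -
  define v where "v = coordinate_vector a e"
  have aM: "a \<in> points M" using a chart_subset_points by auto
  have LU: "L \<in> smooth_funs M U" by (rule smooth_funs_subset[OF L chart_subset_points])
  have vder: "derivation_at M a (smooth_near M a) v"
    unfolding v_def by (rule tangent_space_derivation[OF manifold aM coordinate_vector_in_tangent_space[OF a]])
  obtain \<xi> B where \<xi>: "local_coordinates \<xi> B" and aB: "a \<in> B"
    using local_coordinates_exist[OF a] by metis
  have B: "openin (man_top M) B" "B \<subseteq> U" "\<And>b. b \<in> Basis \<Longrightarrow> \<xi> b \<in> C_inf M"
    using \<xi> by (auto simp: local_coordinates_def)
  have crit': "coordinate_field b L a = 0" for b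
    using bspec[OF crit coordinate_vector_in_tangent_space[OF a]] coordinate_vector_eq[of L a b]
      C_inf_subset_smooth_near[OF aM] L by auto
  have indep: "v (X L) = (\<Sum>b\<in>Basis. v (\<xi> b) * v (coordinate_field b L))"
    if aA: "a \<in> A" and X: "vector_field_on M A X" and Xv: "\<forall>g\<in>smooth_funs M A. X g a = v g" for A X
  proof -
    have A: "openin (man_top M) A" using X by (simp add: vector_field_on_def)
    have CA: "f \<in> smooth_funs M A" if "f \<in> C_inf M" for f
      by (rule C_inf_subset_smooth_funs[OF A that])
    have near: "f \<in> smooth_near M a" if "f \<in> smooth_funs M A \<or> f \<in> smooth_funs M U" for f
      using that aA A a openin_chart by (auto simp: smooth_near_def)
    have XS: "X f \<in> smooth_funs M A" if "f \<in> smooth_funs M A" for f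
      using X that by (simp add: vector_field_on_def)
    define q where "q b x = X (\<xi> b) x * coordinate_field b L x" for b x
    have q: "q b \<in> smooth_near M a" "v (q b) = v (\<xi> b) * v (coordinate_field b L)" if b: "b \<in> Basis" for b
    proof -
      have 1: "X (\<xi> b) \<in> smooth_near M a" "coordinate_field b L \<in> smooth_near M a"
        using near XS[OF CA[OF B(3)[OF b]]] coordinate_field_smooth[OF LU] by auto
      show "q b \<in> smooth_near M a"
        unfolding q_def by (rule smooth_near_mult[OF 1])
      have "v (q b) = X (\<xi> b) a * v (coordinate_field b L) + v (X (\<xi> b)) * coordinate_field b L a"
        unfolding q_def by (rule derivation_mult[OF vder 1])
      then show "v (q b) = v (\<xi> b) * v (coordinate_field b L)"
        using Xv CA[OF B(3)[OF b]] crit' by simp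
    qed
    have "v (X L) = v (\<lambda>x. \<Sum>b\<in>Basis. q b x)"
    proof (rule derivation_local[OF vder _ _ openin_Int[OF A B(1)]])
      show "X L \<in> smooth_near M a" using near XS[OF CA[OF L]] by blast
      show "(\<lambda>x. \<Sum>b\<in>Basis. q b x) \<in> smooth_near M a"
        using derivation_sum[OF vder finite_Basis, of q] q(1) by blast
      show "X L x = (\<Sum>b\<in>Basis. q b x)" if x: "x \<in> A \<inter> B" for x
        using derivation_formula[OF vector_field_derivation[OF manifold X] \<xi>, of x L] x CA[OF L]
        by (simp add: q_def coordinate_field_def)
    qed (use aA aB in auto)
    also have "\<dots> = (\<Sum>b\<in>Basis. v (q b))"
      using derivation_sum[OF vder finite_Basis, of q] q(1) by blast
    also have "\<dots> = (\<Sum>b\<in>Basis. v (\<xi> b) * v (coordinate_field b L))"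
      by (intro sum.cong refl q(2))
    finally show ?thesis .
  qed
  have ex: "a \<in> U \<and> vector_field_on M U (coordinate_field e) \<and>
      (\<forall>g\<in>smooth_funs M U. coordinate_field e g a = v g)"
    using a coordinate_vector_field coordinate_vector_eq smooth_funs_subset_smooth_near[OF openin_chart a]
    by (simp add: v_def)
  have "hessian M L a v v = v (coordinate_field e L)"
    unfolding hessian_def
  proof (rule the_equality)
    show "\<exists>A X. a \<in> A \<and> vector_field_on M A X \<and> (\<forall>g\<in>smooth_funs M A. X g a = v g) \<and>
        v (coordinate_field e L) = v (X L)"
      using ex by blast
    fix r assume "\<exists>A X. a \<in> A \<and> vector_field_on M A X \<and> (\<forall>g\<in>smooth_funs M A. X g a = v g) \<and> r = v (X L)"
    then obtain A X where AX: "a \<in> A" "vector_field_on M A X" "\<forall>g\<in>smooth_funs M A. X g a = v g" "r = v (X L)"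
      by blast
    show "r = v (coordinate_field e L)"
      using indep[OF AX(1-3)] indep[of U "coordinate_field e"] ex AX(4) by simp
  qed
  also have "\<dots> = frechet_derivative (coordinate_field e L \<circ> psi) (at (\<phi> a)) e"
    using smooth_funs_subset_smooth_near[OF openin_chart a coordinate_field_smooth[OF LU]]
    by (simp add: v_def coordinate_vector_def)
  \<comment> \<open>In the cylinder the coordinate field is the partial derivative at
    \<open>P y\<close>, so the chain rule replaces the outer \<open>e\<close> by \<open>P e\<close>,
    which is \<open>e\<close> for a model vector.\<close>
  also have "\<dots> = frechet_derivative (\<lambda>y. frechet_derivative (L \<circ> psi) (at y) e) (at (\<phi> a)) e"
  proof -
    let ?Q = "\<lambda>y. frechet_derivative (L \<circ> psi) (at y) e"
    have pa: "\<phi> a \<in> coord U" "P (\<phi> a) = \<phi> a"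
      using chart_in_coord[OF a order_refl] P_chart[OF a] by auto
    have Li: "infinitely_differentiable_on (coord U) (L \<circ> psi)"
      using LU smooth_fun_in_chart[OF openin_chart order_refl] by blast
    have QD: "(?Q has_derivative frechet_derivative ?Q (at (\<phi> a))) (at (P (\<phi> a)))"
      using infinitely_differentiable_on_has_derivative[OF infinitely_differentiable_on_derivative[OF Li] pa(1)]
      by (simp add: pa(2))
    have "frechet_derivative (coordinate_field e L \<circ> psi) (at (\<phi> a)) =
        frechet_derivative (\<lambda>y. ?Q (P y)) (at (\<phi> a))"
      by (rule frechet_derivative_cong_on[OF open_coord_chart pa(1)]) (rule coordinate_field_psi)
    also have "\<dots> = (\<lambda>v. frechet_derivative ?Q (at (\<phi> a)) (P v))"
      by (rule frechet_derivative_at[symmetric])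
        (rule has_derivative_compose[where f = P, OF bounded_linear_imp_has_derivative[OF bounded_linear_P] QD])
    finally show ?thesis using P_ident[OF e] by simp
  qed
  also have "\<dots> = second_derivative (L \<circ> psi) e (\<phi> a)"
    using LU smooth_fun_in_chart[OF openin_chart order_refl] chart_in_coord[OF a order_refl]
    by (intro second_derivative_eq[OF open_coord_chart]) blast+
  finally show ?thesis by (simp add: v_def)
qed

text \<open>A coordinate function with \<open>e \<bullet> b \<noteq> 0\<close> separates the vector
  from zero. Definiteness on nonzero tangent vectors thereby reaches all nonzero model
  vectors.\<close>

lemma coordinate_vector_nonzero:
  assumes a: "a \<in> U" and e: "e \<in> man_model M" "e \<noteq> 0"
  shows "coordinate_vector a e \<noteq> (\<lambda>_. 0)"
proof
  assume 0: "coordinate_vector a e = (\<lambda>_. 0)"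
  obtain b where b: "b \<in> Basis" "e \<bullet> b \<noteq> 0"
    using e(2) by (metis euclidean_all_zero_iff)
  have sm: "(\<lambda>x. \<phi> x \<bullet> b) \<in> smooth_near M a"
    by (rule smooth_funs_subset_smooth_near[OF openin_chart a smooth_coordinate])
  have "frechet_derivative ((\<lambda>x. \<phi> x \<bullet> b) \<circ> psi) (at (\<phi> a)) = frechet_derivative (\<lambda>y. P y \<bullet> b) (at (\<phi> a))"
    by (rule frechet_derivative_cong_on[OF open_coord_chart chart_in_coord[OF a order_refl]])
      (simp add: chart_psi)
  also have "\<dots> = (\<lambda>y. P y \<bullet> b)"
    by (rule frechet_derivative_at[symmetric], rule bounded_linear_imp_has_derivative,
        rule bounded_linear_compose[OF bounded_linear_inner_left bounded_linear_P])
  finally have "coordinate_vector a e (\<lambda>x. \<phi> x \<bullet> b) = e \<bullet> b"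
    using sm P_ident[OF e(1)] by (simp add: coordinate_vector_def)
  then show False using 0 b(2) by simp
qed

text \<open>Points of \<open>U\<close> have coordinates in the affine slice of the model through
  \<open>\<phi> a\<close>, so the Euclidean test is run with \<open>E\<close> the model space; the
  assumptions on tangent vectors enter through coordinate vectors.\<close>

lemma definite_hessian_imp_augmented_minimum:
  assumes a: "a \<in> U" and L: "L \<in> C_inf M" and J: "finite J" and C: "\<And>j. j \<in> J \<Longrightarrow> C j \<in> C_inf M"
    and crit: "\<forall>v\<in>tangent_space M a. v L = 0"
    and definite: "\<And>v. v \<in> tangent_space M a \<Longrightarrow> v \<noteq> (\<lambda>_. 0) \<Longrightarrow> (\<And>j. j \<in> J \<Longrightarrow> v (C j) = 0) \<Longrightarrow>
      hessian M L a v v > 0"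
  obtains K N where "openin (man_top M) N" "a \<in> N"
    "\<And>x. x \<in> N - {a} \<Longrightarrow> L x - L a + K * (\<Sum>j\<in>J. (C j x - C j a)\<^sup>2) > 0"
proof -
  have aM: "a \<in> points M" using a chart_subset_points by auto
  have sm: "infinitely_differentiable_on (coord U) (f \<circ> psi)" if "f \<in> C_inf M" for f
    using smooth_funs_subset[OF that chart_subset_points] smooth_fun_in_chart[OF openin_chart order_refl] by blast
  have near: "f \<in> smooth_near M a" if "f \<in> C_inf M" for f
    using that C_inf_subset_smooth_near[OF aM] by blast
  have vec: "coordinate_vector a e f = frechet_derivative (f \<circ> psi) (at (\<phi> a)) e" if "f \<in> C_inf M" for e f
    using near[OF that] by (simp add: coordinate_vector_def)
  have pa: "\<phi> a \<in> coord U" by (rule chart_in_coord[OF a order_refl])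
  obtain K r where Kr: "r > 0" "ball (\<phi> a) r \<subseteq> coord U"
    "\<And>y. y \<in> ball (\<phi> a) r \<Longrightarrow> y - \<phi> a \<in> man_model M \<Longrightarrow> y \<noteq> \<phi> a \<Longrightarrow>
      (L \<circ> psi) y - (L \<circ> psi) (\<phi> a) + K * (\<Sum>j\<in>J. ((C j \<circ> psi) y - (C j \<circ> psi) (\<phi> a))\<^sup>2) > 0"
  proof (rule augmented_second_derivative_test[OF open_coord_chart pa subspace_model J sm[OF L],
        of "\<lambda>j. C j \<circ> psi"])
    show "infinitely_differentiable_on (coord U) (C j \<circ> psi)" if "j \<in> J" for j
      by (rule sm[OF C[OF that]])
    show "frechet_derivative (L \<circ> psi) (at (\<phi> a)) v = 0" for v
      using bspec[OF crit coordinate_vector_in_tangent_space[OF a], of v] vec[OF L] by simp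
    show "second_derivative (L \<circ> psi) e (\<phi> a) > 0"
      if "e \<in> man_model M" "e \<noteq> 0" "\<And>j. j \<in> J \<Longrightarrow> frechet_derivative (C j \<circ> psi) (at (\<phi> a)) e = 0" for e
      using definite[OF coordinate_vector_in_tangent_space[OF a] coordinate_vector_nonzero[OF a that(1,2)]]
        hessian_eq[OF a L crit that(1)] that(3) vec[OF C] by simp
  qed blast
  show thesis
  proof
    show "openin (man_top M) {x \<in> U. \<phi> x \<in> ball (\<phi> a) r}"
      by (rule openin_chart_preimage[OF open_ball])
    show "a \<in> {x \<in> U. \<phi> x \<in> ball (\<phi> a) r}" using a Kr(1) by simp
    fix x assume x: "x \<in> {x \<in> U. \<phi> x \<in> ball (\<phi> a) r} - {a}"
    then have "\<phi> x \<noteq> \<phi> a" using inj_on_chart a by (auto simp: inj_on_def)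
    moreover have "\<phi> x - \<phi> a \<in> man_model M"
      using x a by (intro subspace_diff[OF subspace_model] chart_in_model) auto
    ultimately show "L x - L a + K * (\<Sum>j\<in>J. (C j x - C j a)\<^sup>2) > 0"
      using Kr(3)[of "\<phi> x"] x a by (simp add: psi_chart)
  qed
qed

end

section \<open>Stability\<close>

lemma C_inf_continuous:
  assumes M: "smooth_manifold M" and f: "f \<in> C_inf M"
  shows "continuous_map (man_top M) euclideanreal f"
  unfolding continuous_map_def
proof (intro conjI allI impI)
  fix S :: "real set" assume "openin euclidean S"
  then have S: "open S" by simp
  show "openin (man_top M) {x \<in> points M. f x \<in> S}"
  proof (subst openin_subopen, clarify)
    fix x assume x: "x \<in> points M" "f x \<in> S"
    then obtain U \<phi> where ch: "manifold_chart M U \<phi>" and xU: "x \<in> U"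
      using manifold_chart_at[OF M] by metis
    interpret manifold_chart M U \<phi> by (rule ch)
    define T where "T = coord U \<inter> (f \<circ> psi) -` S"
    have "f \<in> smooth_funs M U" by (rule smooth_funs_subset[OF f chart_subset_points])
    then have "infinitely_differentiable_on (coord U) (f \<circ> psi)"
      using smooth_fun_in_chart[OF openin_chart order_refl] by blast
    then have "open T"
      unfolding T_def
      by (rule continuous_open_preimage[OF infinitely_differentiable_on_continuous open_coord_chart S])
    show "\<exists>W. openin (man_top M) W \<and> x \<in> W \<and> W \<subseteq> {x \<in> points M. f x \<in> S}"
    proof (intro exI conjI)
      show "openin (man_top M) {y \<in> U. \<phi> y \<in> T}"
        by (rule openin_chart_preimage[OF \<open>open T\<close>])
      show "x \<in> {y \<in> U. \<phi> y \<in> T}"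
        using xU x(2) chart_in_coord[OF xU order_refl] by (simp add: T_def psi_chart)
      show "{y \<in> U. \<phi> y \<in> T} \<subseteq> {x \<in> points M. f x \<in> S}"
        using chart_subset_points psi_chart by (auto simp: T_def)
    qed
  qed
qed simp

text \<open>The quantity is twice the positive part of \<open>u\<close>. An increase in the only
  critical case \<open>u 0 < 0 < u T\<close> would need a zero of \<open>u\<close> in between, after
  which the modulus can no longer leave 0.\<close>

lemma add_abs_nonincreasing:
  fixes u :: "real \<Rightarrow> real"
  assumes T: "0 \<le> T" and u: "continuous_on {0..T} u"
    and sq: "\<And>s t. 0 \<le> s \<Longrightarrow> s \<le> t \<Longrightarrow> t \<le> T \<Longrightarrow> (u t)\<^sup>2 \<le> (u s)\<^sup>2"
  shows "u T + \<bar>u T\<bar> \<le> u 0 + \<bar>u 0\<bar>"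
proof -
  have abs: "\<bar>u t\<bar> \<le> \<bar>u s\<bar>" if "0 \<le> s" "s \<le> t" "t \<le> T" for s t
    using sq[OF that] by (simp add: abs_le_square_iff)
  show ?thesis
  proof (cases "u 0 \<ge> 0 \<or> u T \<le> 0")
    case True
    then show ?thesis using abs[of 0 T] T by auto
  next
    case False
    then obtain s where "0 \<le> s" "s \<le> T" "u s = 0"
      using IVT'[of u 0 0 T] u T by auto
    then show ?thesis using abs[of s T] False by simp
  qed
qed

context flow_field
begin

lemma nonincreasing_along_integral_curve:
  assumes c: "integral_curve M X c {p..q}" and pq: "p \<le> q" and f: "f \<in> C_inf M"
    and le: "\<And>x. x \<in> points M \<Longrightarrow> X f x \<le> 0"
  shows "f (c q) \<le> f (c p)"
proof (rule DERIV_nonpos_imp_decreasing_open[OF pq])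
  show "\<exists>y. DERIV (\<lambda>t. f (c t)) t :> y \<and> y \<le> 0" if "p < t" "t < q" for t
    using integral_curve_has_derivative[OF c _ f, of t] le[OF integral_curve_in_points[OF c, of t]] that
    by (auto simp: at_within_Icc_at)
  show "continuous_on {p..q} (\<lambda>t. f (c t))"
    unfolding continuous_on_eq_continuous_within
    using integral_curve_has_derivative[OF c _ f] DERIV_continuous by blast
qed

lemma constant_along_integral_curve:
  assumes c: "integral_curve M X c {p..q}" and pq: "p \<le> q" and f: "f \<in> C_inf M"
    and eq: "\<And>x. x \<in> points M \<Longrightarrow> X f x = 0"
  shows "f (c q) = f (c p)"
proof -
  have "f (c q) \<le> f (c p)"
    by (rule nonincreasing_along_integral_curve[OF c pq f]) (simp add: eq)
  moreover have "-1 * f (c q) \<le> -1 * f (c p)"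
  proof (rule nonincreasing_along_integral_curve[OF c pq smooth_funs_scale[OF f]])
    show "X (\<lambda>x. -1 * f x) x \<le> 0" if "x \<in> points M" for x
      using derivation_scale[OF field_derivation[OF that] f, of "-1"] eq[OF that] by simp
  qed
  ultimately show ?thesis by simp
qed

lemma constant_integral_curve:
  assumes "x \<in> points M" "\<And>f. f \<in> C_inf M \<Longrightarrow> X f x = 0"
  shows "integral_curve M X (\<lambda>t. x) I"
  using assms by (auto simp: integral_curve_def)

lemma singleton_asymptotically_stable:
  assumes z: "openin (man_top M) {z}" and fc: "flow_contracts M X {z}" and eq: "equilibrium M X z"
  shows "asymptotically_stable M X z"
  unfolding asymptotically_stable_def
proof (intro exI[of _ "{z}"] conjI allI impI)
  show "neighbourhood M z {z}"
    using z openin_subset[OF z] by (auto simp: neighbourhood_def)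
  show "flow_contracts M X {z}" by (rule fc)
  fix W assume W: "neighbourhood M z W"
  have "integral_curve M X (\<lambda>_. z) {0..t}" for t
    using eq by (intro constant_integral_curve) (auto simp: equilibrium_def)
  then have "flow M X t z = z" if "t \<ge> 1" for t
    using flow_eq(2)[of "\<lambda>_. z" 0 t t] that by auto
  then show "\<exists>T>0. \<forall>t\<ge>T. flow_image M X t {z} \<subseteq> W"
    using W by (intro exI[of _ 1]) (auto simp: flow_image_def neighbourhood_def)
qed

end

section \<open>Isolated points and the symplectic leaves through them\<close>

lemma smooth_near_isolated:
  assumes "smooth_manifold M" "openin (man_top M) {z}"
  shows "f \<in> smooth_near M z"
proof -
  have "f \<in> smooth_funs M {z}"
    by (rule smooth_funs_cong[OF assms(1) smooth_funs_const[of "f z"]]) simp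
  then show ?thesis using assms(2) by (auto simp: smooth_near_def)
qed

text \<open>At an isolated point every function agrees with a constant on an open set, and
  derivations are local.\<close>

lemma tangent_space_isolated:
  assumes M: "smooth_manifold M" and z: "openin (man_top M) {z}"
  shows "tangent_space M z = {\<lambda>_. 0}"
proof (intro equalityI subsetI)
  fix v assume v: "v \<in> tangent_space M z"
  have "z \<in> points M" using openin_subset[OF z] by simp
  then have der: "derivation_at M z (smooth_near M z) v"
    using tangent_space_derivation[OF M] v by blast
  have "v f = 0" for f
    using derivation_local[OF der smooth_near_isolated[OF M z] smooth_near_isolated[OF M z] z, of f "\<lambda>_. f z"]
      derivation_const[OF der] by simp
  then show "v \<in> {\<lambda>_. 0}" by auto
next
  fix v :: "('a \<Rightarrow> real) \<Rightarrow> real" assume "v \<in> {\<lambda>_. 0}"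
  then show "v \<in> tangent_space M z" by (simp add: tangent_space_def)
qed

lemma smooth_on_singleton: "A \<subseteq> {p} \<Longrightarrow> smooth_on A f"
  by (rule smooth_on_cong[OF smooth_on_const[of _ "f p"]]) auto

text \<open>The zero-dimensional candidate for the leaf through an isolated point.\<close>

definition point_manifold :: "'a \<Rightarrow> ('a, 'e::euclidean_space) manifold" where
  "point_manifold z = \<lparr>man_top = discrete_topology {z}, man_model = {0}, man_charts = {({z}, \<lambda>_. 0)}\<rparr>"

lemma smooth_manifold_point: "smooth_manifold (point_manifold z)"
proof -
  have "homeomorphic_map (discrete_topology {z}) (top_of_set {0 :: 'e::euclidean_space}) (\<lambda>_. 0)"
    by (rule bijective_open_imp_homeomorphic_map) (auto simp: open_map_def subset_singleton_iff)
  moreover have "subtopology (discrete_topology {z}) {z} = discrete_topology {z}"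
    by simp
  ultimately show ?thesis
    by (auto simp: smooth_manifold_def point_manifold_def subspace_single_0 second_countable_discrete_topology
        intro!: smooth_on_singleton)
qed

context poisson_manifold
begin

lemma bracket_derivation:
  assumes "h \<in> C_inf M" "x \<in> points M"
  shows "derivation_at M x (C_inf M) (\<lambda>f. br f h x)"
  using vector_field_derivation[OF manifold hamiltonian_vector_field[OF assms(1)] assms(2)]
  by (simp add: hamiltonian_vf_def)

lemma bracket_self: "h \<in> C_inf M \<Longrightarrow> x \<in> points M \<Longrightarrow> br h h x = 0"
  using br_antisym[of h h x] by simp

text \<open>Antisymmetry moves the locally constant \<open>h\<close> into the argument that is
  differentiated, where locality of derivations applies.\<close>

lemma bracket_locally_constant:
  assumes f: "f \<in> C_inf M" and h: "h \<in> C_inf M" and B: "openin (man_top M) B" "x \<in> B"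
    and const: "\<And>y. y \<in> B \<Longrightarrow> h y = a"
  shows "br f h x = 0"
proof -
  have x: "x \<in> points M" using openin_subset[OF B(1)] B(2) by blast
  have "br h f x = br (\<lambda>_. a) f x"
    by (rule derivation_local[OF bracket_derivation[OF f x] h smooth_funs_const B const])
  then show ?thesis
    using derivation_const[OF bracket_derivation[OF f x]] br_antisym[OF f h x] by simp
qed

lemma char_distribution_isolated:
  assumes "openin (man_top M) {z}"
  shows "char_distribution M br z = {\<lambda>_. 0}"
proof -
  have "\<exists>h\<in>C_inf M. \<forall>f\<in>C_inf M. 0 = br f h z"
  proof (intro bexI[of _ "\<lambda>_. 0"] ballI smooth_funs_const)
    fix f assume "f \<in> C_inf M"
    then have "br f (\<lambda>_. 0) z = 0"
      by (rule bracket_locally_constant[where a = 0, OF _ smooth_funs_const assms]) simp_all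
    then show "0 = br f (\<lambda>_. 0) z" by simp
  qed
  then have "(\<lambda>_. 0) \<in> char_distribution M br z"
    unfolding char_distribution_def hamiltonian_vf_def tangent_space_isolated[OF manifold assms] by blast
  moreover have "char_distribution M br z \<subseteq> {\<lambda>_. 0}"
    unfolding char_distribution_def tangent_space_isolated[OF manifold assms] by blast
  ultimately show ?thesis by blast
qed

lemma integral_manifold_isolated:
  assumes z: "openin (man_top M) {z}"
  shows "integral_manifold M br (point_manifold z)"
proof -
  have "z \<in> points M" using openin_subset[OF z] by simp
  moreover have "tangent_space (point_manifold z :: ('a, 'e) manifold) z = {\<lambda>_. 0}"
    by (rule tangent_space_isolated[OF smooth_manifold_point]) (simp add: point_manifold_def)
  moreover have "push_forward M (\<lambda>x. x) z (\<lambda>_. 0) = (\<lambda>_. 0)"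
    by (simp add: push_forward_def fun_eq_iff)
  moreover have "smooth_map (point_manifold z :: ('a, 'e) manifold) M (\<lambda>x. x)"
    using \<open>z \<in> points M\<close> by (auto simp: smooth_map_def point_manifold_def intro!: smooth_on_singleton[of _ 0])
  moreover have "points (point_manifold z :: ('a, 'e) manifold) = {z}"
    "connected_space (man_top (point_manifold z :: ('a, 'e) manifold))"
    by (auto simp: point_manifold_def connected_space_discrete_topology)
  ultimately show ?thesis
    unfolding integral_manifold_def
    by (simp add: smooth_manifold_point char_distribution_isolated[OF z])
qed

text \<open>The inclusion into \<open>M\<close> is continuous, so \<open>{z}\<close> is open also in
  the finer topology of \<open>N\<close>; it is closed there as well, and \<open>N\<close> is
  connected.\<close>

lemma integral_manifold_through_isolated:
  assumes z: "openin (man_top M) {z}" and N: "integral_manifold M br N" and zN: "z \<in> points N"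
  shows "points N = {z}"
proof -
  have "continuous_map (man_top N) (man_top M) (\<lambda>x. x)"
    using N by (simp add: integral_manifold_def smooth_map_def)
  then have "openin (man_top N) {x \<in> points N. x \<in> {z}}"
    using z by (rule openin_continuous_map_preimage)
  moreover have "{x \<in> points N. x \<in> {z}} = {z}" using zN by auto
  moreover have "closedin (man_top N) {z}"
    using N zN by (simp add: integral_manifold_def smooth_manifold_def closedin_Hausdorff_sing_eq)
  moreover have "connected_space (man_top N)"
    using N by (simp add: integral_manifold_def)
  ultimately show ?thesis
    unfolding connected_space_clopen_in by auto
qed

lemma symplectic_leaf_isolated:
  assumes z: "openin (man_top M) {z}"
  shows "{S. symplectic_leaf M br S \<and> z \<in> S} = {{z}}"
proof -
  have "symplectic_leaf M br {z}"
    unfolding symplectic_leaf_def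
  proof (intro conjI allI impI)
    show "\<exists>N. integral_manifold M br N \<and> points N = {z}"
      using integral_manifold_isolated[OF z] by (intro exI[of _ "point_manifold z"]) (simp add: point_manifold_def)
  qed (use integral_manifold_through_isolated[OF z] in blast)
  moreover have "S = {z}" if "symplectic_leaf M br S" "z \<in> S" for S
    using that integral_manifold_through_isolated[OF z] unfolding symplectic_leaf_def by blast
  ultimately show ?thesis by blast
qed

lemma asymptotically_stable_imp_isolated:
  assumes H: "H \<in> C_inf M" and as: "asymptotically_stable M (hamiltonian_vf br H) z"
  shows "openin (man_top M) {z}"
proof -
  let ?X = "hamiltonian_vf br H"
  interpret flow_field M ?X
    by unfold_locales (rule manifold, rule hamiltonian_vector_field[OF H])
  obtain V where V: "neighbourhood M z V" "flow_contracts M ?X V"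
    "\<And>W. neighbourhood M z W \<Longrightarrow> \<exists>T>0. \<forall>t\<ge>T. flow_image M ?X t V \<subseteq> W"
    using as by (auto simp: asymptotically_stable_def)
  obtain B where B: "openin (man_top M) B" "z \<in> B" "B \<subseteq> V" and VM: "V \<subseteq> points M"
    using V(1) by (auto simp: neighbourhood_def)
  have zM: "z \<in> points M" using B VM by blast
  have nbhd: "neighbourhood M z W" if "openin (man_top M) W" "z \<in> W" for W
    using that openin_subset by (auto simp: neighbourhood_def)
  have H_const: "H x = H z" if x: "x \<in> V" for x
  proof (rule ccontr)
    assume ne: "H x \<noteq> H z"
    \<comment> \<open>A neighbourhood of \<open>z\<close> that the level set of \<open>H\<close>
      through \<open>x\<close> avoids, although attraction would drive \<open>x\<close> into
      it.\<close>
    define W where "W = {y \<in> points M. H y \<in> - {H x}}"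
    have "openin (man_top M) W"
      unfolding W_def
      by (rule openin_continuous_map_preimage[OF C_inf_continuous[OF manifold H]]) (simp add: open_Compl)
    moreover have "z \<in> W" using ne zM by (simp add: W_def)
    ultimately obtain T where T: "T > 0" "\<forall>t\<ge>T. flow_image M ?X t V \<subseteq> W"
      using V(3)[OF nbhd] by blast
    have dom: "T \<in> flow_dom M ?X x" using V(2) x T(1) by (simp add: flow_contracts_def)
    then obtain c where c: "integral_curve M ?X c {0..T}" "c 0 = x"
      using T(1) by (auto simp: flow_dom_def closed_segment_eq_real_ivl)
    have "flow M ?X T x = c T" using flow_eq(2)[OF c(1), of T] c(2) T(1) by auto
    moreover have "H (c T) = H x"
      using constant_along_integral_curve[OF c(1) _ H] T(1) c(2) bracket_self[OF H]
      by (simp add: hamiltonian_vf_def)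
    moreover have "flow M ?X T x \<in> W" using T x dom by (auto simp: flow_image_def)
    ultimately show False by (simp add: W_def)
  qed
  have zero: "?X f x = 0" if "x \<in> B" "f \<in> C_inf M" for f x
    unfolding hamiltonian_vf_def
    by (rule bracket_locally_constant[OF that(2) H B(1) that(1), of "H z"]) (use H_const B(3) in auto)
  have "x = z" if x: "x \<in> B" for x
  proof (rule ccontr)
    assume ne: "x \<noteq> z"
    have xM: "x \<in> points M" using x B VM by blast
    have "closedin (man_top M) {x}"
      using manifold xM by (simp add: smooth_manifold_def closedin_Hausdorff_sing_eq)
    \<comment> \<open>A stationary \<open>x\<close> belongs to every forward flow image of
      \<open>V\<close>, so these images never fit into the neighbourhood
      \<open>points M - {x}\<close> of \<open>z\<close>.\<close>
    then obtain T where T: "T > 0" "\<forall>t\<ge>T. flow_image M ?X t V \<subseteq> points M - {x}"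
      using V(3)[OF nbhd, of "points M - {x}"] ne zM by auto
    have "integral_curve M ?X (\<lambda>_. x) {0..T}"
      by (rule constant_integral_curve[OF xM zero[OF x]])
    then have "T \<in> flow_dom M ?X x" "flow M ?X T x = x"
      using flow_eq[of "\<lambda>_. x" 0 T T] T(1) by auto
    then have "x \<in> flow_image M ?X T V"
      using x B(3) by (force simp: flow_image_def)
    then show False using T by blast
  qed
  then have "B = {z}" using B(2) by blast
  then show ?thesis using B(1) by simp
qed

text \<open>All terms in the \<open>C j\<close>, among which \<open>H\<close> may be counted, are
  constant along the curve; the change of \<open>\<Phi>\<close> is that of
  \<open>u + \<bar>u\<bar>\<close>, to which only the monotonicity of the square of \<open>u\<close>
  contributes.\<close>

lemma lyapunov_function:
  fixes H F :: "'a \<Rightarrow> real" and C :: "nat \<Rightarrow> 'a \<Rightarrow> real" and K \<mu> :: real and l :: "nat \<Rightarrow> real" and z :: 'a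
  assumes C: "\<And>j. j \<le> k \<Longrightarrow> C j \<in> C_inf M" and F: "F \<in> C_inf M" and H: "H \<in> C_inf M"
    and cons: "\<And>j x. j \<le> k \<Longrightarrow> x \<in> points M \<Longrightarrow> br (C j) H x = 0"
    and sq: "\<And>x. x \<in> points M \<Longrightarrow> br (\<lambda>x. (F x - F z)\<^sup>2) H x \<le> 0"
    and c: "integral_curve M (hamiltonian_vf br H) c {0..T}" and T: "T \<ge> 0"
  defines "\<Phi> \<equiv> \<lambda>x. ((\<Sum>j\<le>k. l j * C j x) + \<mu> * F x) - ((\<Sum>j\<le>k. l j * C j z) + \<mu> * F z) +
      K * (\<Sum>j\<le>k. (C j x - C j z)\<^sup>2) + \<bar>\<mu> * (F x - F z)\<bar>"
  shows "\<Phi> (c T) \<le> \<Phi> (c 0)"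
proof -
  interpret flow_field M "hamiltonian_vf br H"
    by unfold_locales (rule manifold, rule hamiltonian_vector_field[OF H])
  have Cc: "C j (c T) = C j (c 0)" if "j \<le> k" for j
    using constant_along_integral_curve[OF c T C[OF that]] cons[OF that] by (simp add: hamiltonian_vf_def)
  define u where "u t = \<mu> * (F (c t) - F z)" for t
  have "u T + \<bar>u T\<bar> \<le> u 0 + \<bar>u 0\<bar>"
  proof (rule add_abs_nonincreasing[OF T])
    have "continuous_on {0..T} (\<lambda>t. F (c t))"
      unfolding continuous_on_eq_continuous_within
      using integral_curve_has_derivative[OF c _ F] DERIV_continuous by blast
    then show "continuous_on {0..T} u"
      unfolding u_def by (intro continuous_intros)
    fix s t assume st: "0 \<le> s" "s \<le> t" "t \<le> T"
    have "(F (c t) - F z)\<^sup>2 \<le> (F (c s) - F z)\<^sup>2"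
    proof (rule nonincreasing_along_integral_curve[OF integral_curve_subset[OF c] st(2)])
      show "(\<lambda>x. (F x - F z)\<^sup>2) \<in> C_inf M"
        by (intro smooth_funs_power2 smooth_funs_diff F smooth_funs_const)
    qed (use st sq in \<open>auto simp: hamiltonian_vf_def\<close>)
    then show "(u t)\<^sup>2 \<le> (u s)\<^sup>2"
      by (simp add: u_def power_mult_distrib mult_left_mono)
  qed
  moreover have "(\<Sum>j\<le>k. l j * C j (c T)) = (\<Sum>j\<le>k. l j * C j (c 0))"
    "(\<Sum>j\<le>k. (C j (c T) - C j z)\<^sup>2) = (\<Sum>j\<le>k. (C j (c 0) - C j z)\<^sup>2)"
    by (simp_all add: Cc)
  ultimately show ?thesis
    by (simp add: \<Phi>_def u_def algebra_simps)
qed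

lemma strict_decrease_imp_isolated:
  fixes H \<Phi> g :: "'a \<Rightarrow> real"
  assumes H: "H \<in> C_inf M" and g: "g \<in> C_inf M"
    and strict: "\<And>x. x \<in> points M - {z} \<Longrightarrow> br g H x < 0"
    and \<Phi>: "\<And>c T. T \<ge> 0 \<Longrightarrow> integral_curve M (hamiltonian_vf br H) c {0..T} \<Longrightarrow> \<Phi> (c T) \<le> \<Phi> (c 0)"
    and V: "openin (man_top M) V" "z \<in> V"
    and inv: "\<And>x T. x \<in> V \<Longrightarrow> T \<ge> 0 \<Longrightarrow>
      \<exists>c. integral_curve M (hamiltonian_vf br H) c {0..T} \<and> c 0 = x \<and> c ` {0..T} \<subseteq> V"
    and cpt: "\<And>x. x \<in> V \<Longrightarrow> compactin (man_top M) {y \<in> V. \<Phi> y \<le> \<Phi> x}"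
  shows "V = {z}"
proof -
  let ?X = "hamiltonian_vf br H"
  interpret flow_field M ?X
    by unfold_locales (rule manifold, rule hamiltonian_vector_field[OF H])
  have VM: "V \<subseteq> points M" by (rule openin_subset[OF V(1)])
  have H_const: "H x = H z" if x: "x \<in> V" for x
  proof -
    \<comment> \<open>Orbits stay in \<open>S\<close> for a short time, so a minimiser of
      \<open>g\<close> other than \<open>z\<close> is impossible. The level condition on
      \<open>H\<close> is what turns \<open>z \<in> S\<close> into \<open>H z = H x\<close>.\<close>
    define S where "S = {y \<in> points M. H y \<in> {H x}} \<inter> {y \<in> V. \<Phi> y \<le> \<Phi> x}"
    have "compactin (man_top M) S"
      unfolding S_def
      by (intro closed_Int_compactin cpt x closedin_continuous_map_preimage[OF C_inf_continuous[OF manifold H]]) simp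
    then have "compact (g ` S)"
      using image_compactin[OF _ C_inf_continuous[OF manifold g]] by simp
    moreover have "S \<noteq> {}" using x VM by (auto simp: S_def)
    ultimately obtain y where y: "y \<in> S" "\<And>w. w \<in> S \<Longrightarrow> g y \<le> g w"
      using compact_attains_inf[of "g ` S"] by auto
    have "y = z"
    proof (rule ccontr)
      assume "y \<noteq> z"
      have yV: "y \<in> V" using y(1) by (simp add: S_def)
      then obtain c where c: "integral_curve M ?X c {0..1}" "c 0 = y" "c ` {0..1} \<subseteq> V"
        using inv[of y 1] by auto
      have "((\<lambda>s. g (c s)) has_real_derivative br g H y) (at 0 within {0..1})"
        using integral_curve_has_derivative[OF c(1) _ g, of 0] c(2) by (simp add: hamiltonian_vf_def)
      moreover have "br g H y < 0" using strict yV VM \<open>y \<noteq> z\<close> by blast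
      ultimately obtain d where d: "d > 0" "\<And>h. h > 0 \<Longrightarrow> 0 + h \<in> {0..1} \<Longrightarrow> h < d \<Longrightarrow> g (c (0 + h)) < g (c 0)"
        using has_real_derivative_neg_dec_right by blast
      define h where "h = min 1 (d / 2)"
      have h: "0 < h" "h \<le> 1" "h < d" using d(1) by (auto simp: h_def)
      have ch: "integral_curve M ?X c {0..h}"
        by (rule integral_curve_subset[OF c(1)]) (use h in auto)
      have "\<Phi> (c h) \<le> \<Phi> x"
        using \<Phi>[OF _ ch] h(1) c(2) y(1) by (simp add: S_def)
      moreover have "H (c h) = H x"
        using constant_along_integral_curve[OF ch _ H] h(1) c(2) y(1) bracket_self[OF H]
        by (simp add: hamiltonian_vf_def S_def)
      moreover have "c h \<in> V" using c(3) h by auto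
      ultimately have "c h \<in> S" using VM by (auto simp: S_def)
      then show False using y(2)[of "c h"] d(2)[of h] h c(2) by auto
    qed
    then show ?thesis using y(1) by (simp add: S_def)
  qed
  have "x = z" if x: "x \<in> V" for x
  proof (rule ccontr)
    assume "x \<noteq> z"
    then have "br g H x < 0" using strict x VM by blast
    moreover have "br g H x = 0"
      by (rule bracket_locally_constant[OF g H V(1) x H_const])
    ultimately show False by simp
  qed
  then show ?thesis using V(2) by blast
qed

end

theorem theorem2p5:
  fixes M :: "('a, 'e::euclidean_space) manifold"
    and br :: "('a \<Rightarrow> real) \<Rightarrow> ('a \<Rightarrow> real) \<Rightarrow> 'a \<Rightarrow> real"
    and H F :: "'a \<Rightarrow> real" and C :: "nat \<Rightarrow> 'a \<Rightarrow> real" and k :: nat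
    and z\<^sub>e :: 'a and l :: "nat \<Rightarrow> real" and \<mu> :: real
  defines "G \<equiv> \<lambda>x. F x - F z\<^sub>e"
    and "L \<equiv> \<lambda>x. l 0 * H x + (\<Sum>i=1..k. l i * C i x) + \<mu> * F x"
    and "W \<equiv> ker_d M H z\<^sub>e \<inter> (\<Inter>i\<in>{1..k}. ker_d M (C i) z\<^sub>e)"
  assumes poisson: "poisson_manifold M br"
    and H_smooth: "H \<in> C_inf M"
    and C_smooth: "\<forall>i\<in>{1..k}. C i \<in> C_inf M"
    and F_smooth: "F \<in> C_inf M"
    and equilibrium: "equilibrium M (hamiltonian_vf br H) z\<^sub>e"
    and conserved: "\<forall>i\<in>{1..k}. \<forall>z\<in>points M. br (C i) H z = 0"
    and F_cond:
      "((\<forall>z\<in>points M - {z\<^sub>e}. br (\<lambda>x. (G x)\<^sup>2) H z \<le> 0) \<and>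
        (\<forall>y\<in>points M - {z\<^sub>e}. br (\<lambda>x. (G x)\<^sup>2) H y = 0 \<longrightarrow> br G H y \<le> 0))
       \<or>
       ((\<forall>z\<in>points M - {z\<^sub>e}. br (\<lambda>x. (G x)\<^sup>2) H z \<le> 0) \<and>
        positive_around M G z\<^sub>e)"
    and critical: "\<forall>v\<in>tangent_space M z\<^sub>e. differential L v = 0"
    and definite: "\<forall>v\<in>W. v \<noteq> (\<lambda>_. 0) \<longrightarrow> hessian M L z\<^sub>e v v > 0"
  shows "weakly_asymptotically_stable M (hamiltonian_vf br H) z\<^sub>e \<and>
         lyapunov_stable M (hamiltonian_vf br H) z\<^sub>e \<and>
         ((\<forall>z\<in>points M - {z\<^sub>e}. br (\<lambda>x. (G x)\<^sup>2) H z < 0) \<longrightarrow>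
            asymptotically_stable M (hamiltonian_vf br H) z\<^sub>e) \<and>
         (asymptotically_stable M (hamiltonian_vf br H) z\<^sub>e \<longrightarrow>
            {S. symplectic_leaf M br S \<and> z\<^sub>e \<in> S} = {{z\<^sub>e}})"
proof -
  interpret poisson_manifold M br by (rule poisson)
  let ?X = "hamiltonian_vf br H"
  interpret flow_field M ?X
    by unfold_locales (rule manifold, rule hamiltonian_vector_field[OF H_smooth])
  have zM: "z\<^sub>e \<in> points M" using equilibrium by (simp add: equilibrium_def)
  \<comment> \<open>The Hamiltonian becomes the conserved quantity of index 0, matching its
    coefficient \<open>l 0\<close> and its kernel in \<open>W\<close>.\<close>
  define D where "D j = (if j = 0 then H else C j)" for j
  have D: "D j \<in> C_inf M" if "j \<le> k" for j
    using H_smooth C_smooth that by (auto simp: D_def)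
  have D_cons: "br (D j) H x = 0" if "j \<le> k" "x \<in> points M" for j x
    using conserved that bracket_self[OF H_smooth] by (auto simp: D_def)
  have L: "L = (\<lambda>x. (\<Sum>j\<le>k. l j * D j x) + \<mu> * F x)"
  proof
    fix x
    have "(\<Sum>j\<le>k. l j * D j x) = l 0 * D 0 x + (\<Sum>j=1..k. l j * D j x)"
      by (simp add: sum.atMost_shift sum.atLeast1_atMost_eq lessThan_Suc_atMost sum.lessThan_Suc_shift)
    also have "(\<Sum>j=1..k. l j * D j x) = (\<Sum>j=1..k. l j * C j x)"
      by (intro sum.cong) (auto simp: D_def)
    finally show "L x = (\<Sum>j\<le>k. l j * D j x) + \<mu> * F x"
      by (simp add: L_def D_def)
  qed
  have L_smooth: "L \<in> C_inf M"
    unfolding L by (intro smooth_funs_add smooth_funs_sum smooth_funs_scale F_smooth D) simp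
  have G2_smooth: "(\<lambda>x. (G x)\<^sup>2) \<in> C_inf M"
    unfolding G_def by (intro smooth_funs_power2 smooth_funs_diff F_smooth smooth_funs_const)
  \<comment> \<open>The assumption excludes \<open>z\<^sub>e\<close>; there the bracket vanishes by
    equilibrium. Monotonicity along curves needs the inequality at every point.\<close>
  have sq: "br (\<lambda>x. (G x)\<^sup>2) H x \<le> 0" if "x \<in> points M" for x
  proof (cases "x = z\<^sub>e")
    case True
    then show ?thesis using equilibrium G2_smooth by (simp add: equilibrium_def hamiltonian_vf_def)
  qed (use F_cond that in blast)
  obtain U \<phi> where "manifold_chart M U \<phi>" and zU: "z\<^sub>e \<in> U"
    using manifold_chart_at[OF manifold zM] by metis
  then interpret ch: manifold_chart M U \<phi> by simp
  obtain K N where N: "openin (man_top M) N" "z\<^sub>e \<in> N"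
    "\<And>x. x \<in> N - {z\<^sub>e} \<Longrightarrow> L x - L z\<^sub>e + K * (\<Sum>j\<le>k. (D j x - D j z\<^sub>e)\<^sup>2) > 0"
  proof (rule ch.definite_hessian_imp_augmented_minimum[OF zU L_smooth, of "{..k}" D])
    show "\<forall>v\<in>tangent_space M z\<^sub>e. v L = 0"
      using critical by (simp add: differential_def)
    fix v assume v: "v \<in> tangent_space M z\<^sub>e" "v \<noteq> (\<lambda>_. 0)" "\<And>j. j \<in> {..k} \<Longrightarrow> v (D j) = 0"
    have "v H = 0" using v(3)[of 0] by (simp add: D_def)
    moreover have "v (C i) = 0" if "i \<in> {1..k}" for i
      using v(3)[of i] that by (simp add: D_def)
    ultimately have "v \<in> W"
      using v(1) by (simp add: W_def ker_d_def differential_def)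
    then show "hessian M L z\<^sub>e v v > 0" using definite v(2) by blast
  qed (use D in auto)
  define \<Phi> where "\<Phi> x = L x - L z\<^sub>e + K * (\<Sum>j\<le>k. (D j x - D j z\<^sub>e)\<^sup>2) + \<bar>\<mu> * (F x - F z\<^sub>e)\<bar>" for x
  have \<Phi>_mono: "\<Phi> (c T) \<le> \<Phi> (c 0)" if "T \<ge> 0" "integral_curve M ?X c {0..T}" for c T
    unfolding \<Phi>_def L
    by (rule lyapunov_function[OF D F_smooth H_smooth D_cons sq[unfolded G_def] that(2,1)])
  have \<Phi>_cont: "continuous_map (man_top M) euclideanreal \<Phi>"
    unfolding \<Phi>_def
    by (intro continuous_intros continuous_map_real_abs C_inf_continuous[OF manifold] L_smooth F_smooth D) simp_all
  have \<Phi>_pos: "\<Phi> x > 0" if "x \<in> N - {z\<^sub>e}" for x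
    using N(3)[OF that] by (simp add: \<Phi>_def add_pos_nonneg)
  \<comment> \<open>Stated for every neighbourhood \<open>O'\<close>: the whole manifold serves the
    contraction claims, an arbitrary one Lyapunov stability.\<close>
  have trap: "\<exists>V. openin (man_top M) V \<and> z\<^sub>e \<in> V \<and> V \<subseteq> O' \<and>
      (\<forall>x\<in>V. \<forall>T\<ge>0. \<exists>c. integral_curve M ?X c {0..T} \<and> c 0 = x \<and> c ` {0..T} \<subseteq> V) \<and>
      (\<forall>x\<in>V. compactin (man_top M) {y \<in> V. \<Phi> y \<le> \<Phi> x})"
    if "openin (man_top M) O'" "z\<^sub>e \<in> O'" for O'
    by (rule lyapunov_trapping[OF zM \<Phi>_cont \<Phi>_mono _ openin_Int[OF N(1) that(1)]])
      (use N(2) that(2) \<Phi>_pos in \<open>auto simp: \<Phi>_def\<close>)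
  obtain V where V: "openin (man_top M) V" "z\<^sub>e \<in> V"
    "\<forall>x\<in>V. \<forall>T\<ge>0. \<exists>c. integral_curve M ?X c {0..T} \<and> c 0 = x \<and> c ` {0..T} \<subseteq> V"
    "\<forall>x\<in>V. compactin (man_top M) {y \<in> V. \<Phi> y \<le> \<Phi> x}"
    using trap[OF openin_topspace zM] by (elim exE conjE) (rule that)
  have contracts: "flow_contracts M ?X V"
    by (rule flow_contracts_forward_invariant[OF V(3)[rule_format]])
  have "weakly_asymptotically_stable M ?X z\<^sub>e"
    unfolding weakly_asymptotically_stable_def neighbourhood_def
    using contracts V(1,2) openin_subset[OF V(1)] by blast
  moreover have "lyapunov_stable M ?X z\<^sub>e"
    unfolding lyapunov_stable_def
  proof (intro allI impI, elim conjE)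
    fix O' assume O': "openin (man_top M) O'" "z\<^sub>e \<in> O'"
    obtain V where V: "openin (man_top M) V" "z\<^sub>e \<in> V" "V \<subseteq> O'"
      "\<forall>x\<in>V. \<forall>T\<ge>0. \<exists>c. integral_curve M ?X c {0..T} \<and> c 0 = x \<and> c ` {0..T} \<subseteq> V"
      using trap[OF O'] by (elim exE conjE) (rule that)
    have "t \<in> flow_dom M ?X x \<and> flow M ?X t x \<in> O'" if x: "x \<in> V" and t: "t > 0" for x t
    proof -
      obtain c where c: "integral_curve M ?X c {0..t}" "c 0 = x" "c ` {0..t} \<subseteq> V"
        using V(4)[rule_format, OF x, of t] t by auto
      have "t \<in> flow_dom M ?X x" "flow M ?X t x = c t"
        using flow_eq[OF c(1), of t] c(2) t by auto
      moreover have "c t \<in> V" using c(3) t by auto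
      ultimately show ?thesis using V(3) by auto
    qed
    then show "\<exists>V. openin (man_top M) V \<and> z\<^sub>e \<in> V \<and> V \<subseteq> O' \<and>
        (\<forall>x\<in>V. \<forall>t>0. t \<in> flow_dom M ?X x \<and> flow M ?X t x \<in> O')"
      using V by blast
  qed
  moreover have "asymptotically_stable M ?X z\<^sub>e"
    if strict: "\<forall>z\<in>points M - {z\<^sub>e}. br (\<lambda>x. (G x)\<^sup>2) H z < 0"
  proof -
    have "V = {z\<^sub>e}"
      by (rule strict_decrease_imp_isolated[OF H_smooth G2_smooth _ \<Phi>_mono V(1,2) V(3,4)[rule_format]])
        (use strict in auto)
    then show ?thesis
      using singleton_asymptotically_stable V(1) contracts equilibrium by simp
  qed
  moreover have "{S. symplectic_leaf M br S \<and> z\<^sub>e \<in> S} = {{z\<^sub>e}}"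
    if "asymptotically_stable M ?X z\<^sub>e"
    by (rule symplectic_leaf_isolated[OF asymptotically_stable_imp_isolated[OF H_smooth that]])
  ultimately show ?thesis by blast
qed

end
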